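(* Consider the signed weighted triangle on vertices $\{1,2,3\}$ with $\varepsilon_{12}=\varepsilon_{13}=\varepsilon_{23}=-1$, $$(a_{12},a_{13},a_{23})=(8739145,\,3903820,\,8576922),$$ $$b=(-3969860,\,-8425563,\,20915687727748),\qquad\nu=(12411,\,482,\,20915691304489).$$ There is an open interval $J$, relatively compact in $(2,\infty)$ and containing $4$, such that for every $p\in J$ the graph has exactly nine eigenlines and nine distinct spectral values. Four eigenlines have Morse index $0$ on $\mathbb RP^2$, four have index $1$, and one has index $2$. The spectral shift $b\mapsto b+17481\,\nu$ produces the nonnegative integer potential $(212986831,\,279,\,365648115381499957)$ and preserves the nine eigenlines, their Morse indices, and the distinctness of their spectral values. In particular, $B_3(p)\geq9$ for every $p\in J$.
   Context: For data $d=(a,\varepsilon,b,\nu)$ on $n$ vertices ($a_{ij}=a_{ji}\ge0$, $\varepsilon_{ij}=\varepsilon_{ji}\in\{-1,1\}$ for $i\ne j$, $b_i\in\mathbb R$, $\nu_i>0$) and $p>1$, with $\Phi_p(t)=|t|^{p-2}t$, $\Phi_p(0)=0$, the eigenproblem is $$\sum_{j\neq i}a_{ij}\Phi_p(x_i-\varepsilon_{ij}x_j)+b_i\Phi_p(x_i)=\lambda\nu_i\Phi_p(x_i)\quad(1\le i\le n),\qquad x\ne0,\ \lambda\in\mathbb R.$$ Spectral values are the $\lambda$ that occur, forming $\sigma_p(d)$; eigenlines are the classes $[x]\in\mathbb RP^{n-1}$ of solutions. Eigenlines are the critical points on $\mathbb RP^{n-1}$ of the Rayleigh quotient $$[x]\mapsto\frac{\sum_{i<j}a_{ij}|x_i-\varepsilon_{ij}x_j|^p+\sum_ib_i|x_i|^p}{\sum_i\nu_i|x_i|^p},$$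 and the Morse index is the index of this function at the (nondegenerate) critical point. $B_3(p)$ is the maximum of $\#\sigma_p(d)$ over all such data on $3$ vertices. *)

theory Defs
  imports "HOL-Analysis.Analysis" "HOL-Library.Extended_Nat"
begin

section \<open>Signed weighted graphs and their p-eigenproblem\<close>

record 'n graph_data =
  edge_weight :: "'n \<Rightarrow> 'n \<Rightarrow> real"
  edge_sign :: "'n \<Rightarrow> 'n \<Rightarrow> real"
  potential :: "real ^ 'n"
  mass :: "real ^ 'n"

text \<open>The diagonals of the weight and sign functions carry no meaning; they are unconstrained here
  and are never used below.\<close>

definition valid_data :: "'n::finite graph_data \<Rightarrow> bool" where
  "valid_data d \<longleftrightarrow>
     (\<forall>i j. i \<noteq> j \<longrightarrow>
        edge_weight d i j = edge_weight d j i \<and> edge_weight d i j \<ge> 0 \<and>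
        edge_sign d i j = edge_sign d j i \<and> edge_sign d i j \<in> {-1, 1}) \<and>
     (\<forall>i. mass d $ i > 0)"

definition Phi :: "real \<Rightarrow> real \<Rightarrow> real" where
  "Phi p t = \<bar>t\<bar> powr (p - 2) * t"

definition eigenpair :: "real \<Rightarrow> 'n::finite graph_data \<Rightarrow> real ^ 'n \<Rightarrow> real \<Rightarrow> bool" where
  "eigenpair p d x l \<longleftrightarrow> x \<noteq> 0 \<and>
     (\<forall>i. (\<Sum>j\<in>UNIV - {i}. edge_weight d i j * Phi p (x $ i - edge_sign d i j * x $ j))
            + potential d $ i * Phi p (x $ i)
          = l * mass d $ i * Phi p (x $ i))"

definition p_spectrum :: "real \<Rightarrow> 'n::finite graph_data \<Rightarrow> real set" where
  "p_spectrum p d = {l. \<exists>x. eigenpair p d x l}"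

text \<open>Points of the real projective space are represented by one-dimensional linear subspaces;
  the class of a vector \<open>x \<noteq> 0\<close> is \<open>span {x}\<close>.\<close>

definition eigenlines :: "real \<Rightarrow> 'n::finite graph_data \<Rightarrow> (real ^ 'n) set set" where
  "eigenlines p d = {span {x} | x. \<exists>l. eigenpair p d x l}"

definition rayleigh :: "real \<Rightarrow> 'n::{finite,linorder} graph_data \<Rightarrow> (real, 'n) vec \<Rightarrow> real" where
  "rayleigh p d x =
     ((\<Sum>(i, j)\<in>{(i, j). i < j}. edge_weight d i j * \<bar>x $ i - edge_sign d i j * x $ j\<bar> powr p)
        + (\<Sum>i\<in>UNIV. potential d $ i * \<bar>x $ i\<bar> powr p))
     / (\<Sum>i\<in>UNIV. mass d $ i * \<bar>x $ i\<bar> powr p)"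

text \<open>The induced function on projective space; see \<open>proj_rayleigh_span\<close> below for
  well-definedness.\<close>

definition proj_rayleigh :: "real \<Rightarrow> 'n::{finite,linorder} graph_data \<Rightarrow> (real, 'n) vec set \<Rightarrow> real" where
  "proj_rayleigh p d L = (THE r. \<forall>x\<in>L - {0}. rayleigh p d x = r)"

lemma rayleigh_scaleR:
  assumes "c \<noteq> 0"
  shows "rayleigh p d (c *\<^sub>R x) = rayleigh p d x"
proof -
  have 1: "\<bar>c * s - c * (e * t)\<bar> powr p = \<bar>c\<bar> powr p * \<bar>s - e * t\<bar> powr p" for s t e :: real
  proof -
    have "c * s - c * (e * t) = c * (s - e * t)" by (simp add: algebra_simps)
    then show ?thesis by (simp add: abs_mult powr_mult)
  qed
  have 2: "\<bar>c * s\<bar> powr p = \<bar>c\<bar> powr p * \<bar>s\<bar> powr p" for s :: real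
    by (simp add: abs_mult powr_mult)
  have "rayleigh p d (c *\<^sub>R x) =
     (\<bar>c\<bar> powr p * ((\<Sum>(i, j)\<in>{(i, j). i < j}. edge_weight d i j * \<bar>x $ i - edge_sign d i j * x $ j\<bar> powr p)
        + (\<Sum>i\<in>UNIV. potential d $ i * \<bar>x $ i\<bar> powr p)))
     / (\<bar>c\<bar> powr p * (\<Sum>i\<in>UNIV. mass d $ i * \<bar>x $ i\<bar> powr p))"
    unfolding rayleigh_def
    by (simp add: 1 2 distrib_left sum_distrib_left mult.left_commute case_prod_unfold)
  with assms show ?thesis
    by (simp add: rayleigh_def)
qed

lemma proj_rayleigh_span:
  assumes "x \<noteq> 0"
  shows "proj_rayleigh p d (span {x}) = rayleigh p d x"
  unfolding proj_rayleigh_def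
proof (rule the_equality)
  show "\<forall>y\<in>span {x} - {0}. rayleigh p d y = rayleigh p d x"
  proof
    fix y assume "y \<in> span {x} - {0}"
    then obtain c where "y = c *\<^sub>R x" "c \<noteq> 0"
      by (auto simp: span_singleton)
    then show "rayleigh p d y = rayleigh p d x"
      by (simp add: rayleigh_scaleR)
  qed
  show "r = rayleigh p d x" if "\<forall>y\<in>span {x} - {0}. rayleigh p d y = r" for r
    using that assms by (auto simp: span_base)
qed

section \<open>Nondegenerate critical points and Morse index\<close>

text \<open>Second derivative of a function at a point \<open>u\<close> of a linear subspace \<open>H\<close>, for the function
  restricted to \<open>H\<close>: \<open>Q v w\<close> is the value on the directions \<open>v, w \<in> H\<close>.  Derivatives within \<open>H\<close>
  are determined only in directions of \<open>H\<close>, and only these are used.\<close>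

definition has_hessian_on ::
  "('a::real_normed_vector \<Rightarrow> real) \<Rightarrow> 'a set \<Rightarrow> 'a \<Rightarrow> ('a \<Rightarrow> 'a \<Rightarrow> real) \<Rightarrow> bool" where
  "has_hessian_on g H u Q \<longleftrightarrow>
     (\<exists>D. (\<exists>e>0. \<forall>y\<in>H \<inter> ball u e. (g has_derivative D y) (at y within H)) \<and>
          (\<forall>v\<in>H. ((\<lambda>y. D y v) has_derivative Q v) (at u within H)))"

definition nondegenerate_on :: "'a::real_vector set \<Rightarrow> ('a \<Rightarrow> 'a \<Rightarrow> real) \<Rightarrow> bool" where
  "nondegenerate_on H Q \<longleftrightarrow> (\<forall>v\<in>H. (\<forall>w\<in>H. Q v w = 0) \<longrightarrow> v = 0)"

definition negative_index_on :: "'a::euclidean_space set \<Rightarrow> ('a \<Rightarrow> 'a \<Rightarrow> real) \<Rightarrow> nat" where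
  "negative_index_on H Q =
     Max {dim V | V. subspace V \<and> V \<subseteq> H \<and> (\<forall>v\<in>V - {0}. Q v v < 0)}"

definition nondegenerate_critical_on ::
  "('a::euclidean_space \<Rightarrow> real) \<Rightarrow> 'a set \<Rightarrow> 'a \<Rightarrow> nat \<Rightarrow> bool" where
  "nondegenerate_critical_on g H u k \<longleftrightarrow>
     (g has_derivative (\<lambda>_. 0)) (at u within H) \<and>
     (\<exists>Q. has_hessian_on g H u Q \<and> nondegenerate_on H Q \<and> negative_index_on H Q = k)"

text \<open>The standard affine charts of projective space: \<open>u\<close> with \<open>u $ i = 0\<close> parametrizes the line
  through \<open>u + e\<^sub>i\<close>, i.e. the lines on which the \<open>i\<close>-th homogeneous coordinate does not vanish.\<close>

definition chart_space :: "'n::finite \<Rightarrow> (real ^ 'n) set" where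
  "chart_space i = {u. u $ i = 0}"

definition affine_chart :: "'n::finite \<Rightarrow> real ^ 'n \<Rightarrow> (real ^ 'n) set" where
  "affine_chart i u = span {u + axis i 1}"

text \<open>\<open>L\<close> is a nondegenerate critical point of \<open>F\<close> with Morse index \<open>k\<close>, computed in an affine chart
  around \<open>L\<close> (criticality, nondegeneracy and index do not depend on the chart).\<close>

definition has_morse_index :: "((real ^ 'n::finite) set \<Rightarrow> real) \<Rightarrow> (real ^ 'n) set \<Rightarrow> nat \<Rightarrow> bool" where
  "has_morse_index F L k \<longleftrightarrow>
     (\<exists>i. \<exists>u\<in>chart_space i. L = affine_chart i u \<and>
        nondegenerate_critical_on (F \<circ> affine_chart i) (chart_space i) u k)"

section \<open>The maximal number of spectral values\<close>

text \<open>The maximum over all data with vertex type \<open>'n\<close> is taken as a supremum in \<^typ>\<open>enat\<close>, where it is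
  attained whenever it is finite.\<close>

definition max_spectral_count :: "'n::finite itself \<Rightarrow> real \<Rightarrow> enat" where
  "max_spectral_count N p =
     (SUP d\<in>{d :: 'n graph_data. valid_data d}.
        if finite (p_spectrum p d) then enat (card (p_spectrum p d)) else \<infinity>)"

section \<open>The triangle\<close>

definition spectral_shift :: "real \<Rightarrow> 'n::finite graph_data \<Rightarrow> 'n graph_data" where
  "spectral_shift t d = d\<lparr>potential := potential d + t *\<^sub>R mass d\<rparr>"

text \<open>The vertex type is \<^typ>\<open>3\<close>, whose elements are \<open>1\<close>, \<open>2\<close> and \<open>3\<close> (the last being equal to \<open>0\<close>).\<close>

definition signed_triangle :: "3 graph_data" where
  "signed_triangle = \<lparr>
     edge_weight = (\<lambda>i j. if {i, j} = {1, 2} then 8739145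
                          else if {i, j} = {1, 3} then 3903820
                          else if {i, j} = {2, 3} then 8576922
                          else 0),
     edge_sign = (\<lambda>i j. -1),
     potential = vector [-3969860, -8425563, 20915687727748],
     mass = vector [12411, 482, 20915691304489]\<rparr>"

lemma valid_data_signed_triangle: "valid_data signed_triangle"
  by (auto simp: valid_data_def signed_triangle_def forall_3 insert_commute)

end

theory Submission
  imports Defs
begin

text \<open>
  At \<open>p = 4\<close> the eigenproblem is polynomial.  Normalizing one coordinate to \<open>1\<close> and eliminating the
  eigenvalue leaves two polynomial equations of degree \<open>6\<close> in two unknowns, and three rectangles, one per
  chart, cover the projective plane.  The rectangles are subdivided, following an explicitly given tree.
  On each piece the Bernstein coefficients show either that some linear combination of the two polynomials
  has no zero, or that the preconditioned system is diagonally dominant with the sign pattern of the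
  Poincare-Miranda theorem on the edges, so that it has exactly one zero there.  Nine pieces are of the
  latter kind.  All these conditions are strict and live on compact sets, hence they persist for \<open>p\<close>
  near \<open>4\<close>.  The Jacobian determinant of the system is a positive multiple of the determinant of
  the Hessian of the Rayleigh quotient in the chart, so its sign, together with one diagonal entry of the
  Hessian, gives the Morse index; the spectral values are separated by nine disjoint intervals.
\<close>

section \<open>Bernstein polynomials and de Casteljau subdivision\<close>

text \<open>The mass at vertex 3 is more than a billion times each of the others. As a result three
  spectral values lie within 2/10^6 of 1, and in the chart normalized at vertex 1 all zeros satisfy
  |v| < 1/100. The pieces are therefore far from square, and a piece good enough for uniqueness may
  still be too coarse to bound the spectral value; hence the refinement below a
  \<open>Solve\<close>. An integer preconditioner C serves twice: dominance of C times the system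
  isolates the zero, and it makes det (C J) positive for the Jacobian J, so that nondegeneracy and
  the sign of det J are read off the integer det C. Persistence uses two kinds of compact sets: the
  isolating rectangles, and, to exclude eigenlines elsewhere, the unit sphere minus nine open cells,
  on which the eigenproblem is stated without charts by 2x2 minors. The chart regions overlap, so
  the nine zeros are known to be different lines only through their disjoint spectral intervals.
  Finally, \<open>has_morse_index\<close> hides a chart and a Hessian under existential quantifiers;
  counting lines by index needs independence of both.\<close>

definition bez :: "nat \<Rightarrow> (nat \<Rightarrow> real) \<Rightarrow> real \<Rightarrow> real" where
  "bez n f t = (\<Sum>k\<le>n. real (n choose k) * t ^ k * (1 - t) ^ (n - k) * f k)"

lemma bez_0 [simp]: "bez 0 f t = f 0"
  by (simp add: bez_def)

text \<open>Pascal's rule. This de Casteljau recursion, not the sum, drives the inductions on the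
  degree below.\<close>

lemma bez_Suc: "bez (Suc n) f t = (1 - t) * bez n f t + t * bez n (\<lambda>k. f (Suc k)) t"
proof -
  have "bez (Suc n) f t = (1 - t) ^ Suc n * f 0 +
      (\<Sum>k\<le>n. real (Suc n choose Suc k) * t ^ Suc k * (1 - t) ^ (n - k) * f (Suc k))"
    unfolding bez_def by (subst sum.atMost_Suc_shift) simp
  also have "(\<Sum>k\<le>n. real (Suc n choose Suc k) * t ^ Suc k * (1 - t) ^ (n - k) * f (Suc k)) =
     (\<Sum>k\<le>n. real (n choose Suc k) * t ^ Suc k * (1 - t) ^ (n - k) * f (Suc k)) +
     t * bez n (\<lambda>k. f (Suc k)) t"
    unfolding bez_def sum_distrib_left sum.distrib [symmetric]
    by (rule sum.cong) (auto simp: algebra_simps)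
  also have "(1 - t) ^ Suc n * f 0 +
      ((\<Sum>k\<le>n. real (n choose Suc k) * t ^ Suc k * (1 - t) ^ (n - k) * f (Suc k)) + t * bez n (\<lambda>k. f (Suc k)) t)
    = (\<Sum>k\<le>Suc n. real (n choose k) * t ^ k * (1 - t) ^ (Suc n - k) * f k) + t * bez n (\<lambda>k. f (Suc k)) t"
    by (subst sum.atMost_Suc_shift) simp
  also have "(\<Sum>k\<le>Suc n. real (n choose k) * t ^ k * (1 - t) ^ (Suc n - k) * f k) = (1 - t) * bez n f t"
    unfolding bez_def sum_distrib_left by (simp add: Suc_diff_le) (auto simp: algebra_simps intro!: sum.cong)
  finally show ?thesis .
qed

lemma bez_add: "bez n (\<lambda>k. f k + g k) t = bez n f t + bez n g t"
  by (simp add: bez_def sum.distrib algebra_simps)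

lemma bez_cmult: "bez n (\<lambda>k. c * f k) t = c * bez n f t"
  by (simp add: bez_def sum_distrib_left algebra_simps)

lemma bez_const [simp]: "bez n (\<lambda>_. c) t = c"
  by (induction n) (simp_all add: bez_Suc algebra_simps)

lemma bez_mono:
  assumes "t \<in> {0..1}" "\<And>k. k \<le> n \<Longrightarrow> f k \<le> g k"
  shows "bez n f t \<le> bez n g t"
  unfolding bez_def using assms by (intro sum_mono mult_left_mono) auto

lemma bez_cong: "(\<And>k. k \<le> n \<Longrightarrow> f k = g k) \<Longrightarrow> bez n f t = bez n g t"
  unfolding bez_def by (intro sum.cong) auto

lemma bez_swap: "bez m (\<lambda>k. bez n (f k) t) s = bez n (\<lambda>l. bez m (\<lambda>k. f k l) s) t"
  unfolding bez_def sum_distrib_left by (subst sum.swap) (simp add: algebra_simps)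

lemma bez_at_0: "bez n f 0 = f 0" and bez_at_1: "bez n f 1 = f n"
  by (induction n arbitrary: f) (simp_all add: bez_Suc)

lemma bez_deriv:
  "(bez (Suc n) f has_real_derivative real (Suc n) * bez n (\<lambda>k. f (Suc k) - f k) t) (at t)"
proof (induction n arbitrary: f)
  case 0
  have "bez (Suc 0) f = (\<lambda>t. (1 - t) * f 0 + t * f 1)"
    by (auto simp: bez_Suc)
  then show ?case by (auto intro!: derivative_eq_intros)
next
  case (Suc n)
  have e: "bez (Suc (Suc n)) f = (\<lambda>t. (1 - t) * bez (Suc n) f t + t * bez (Suc n) (\<lambda>k. f (Suc k)) t)"
    by (intro ext bez_Suc)
  have l: "bez m (\<lambda>k. g k - h k) t = bez m (\<lambda>k. g k) t - bez m (\<lambda>k. h k) t" for m and g h :: "nat \<Rightarrow> real"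
    using bez_add[of m "\<lambda>k. g k - h k" h t] by simp
  show ?case
    unfolding e
    by (rule derivative_eq_intros Suc.IH refl)+ (simp add: l bez_Suc[of n] algebra_simps)
qed

definition avg :: "(nat \<Rightarrow> real) \<Rightarrow> nat \<Rightarrow> real" where
  "avg f k = (f k + f (Suc k)) / 2"

lemma bez_avg: "bez n (avg f) t = (bez n f t + bez n (\<lambda>k. f (Suc k)) t) / 2"
  using bez_cmult[of n "1/2" "\<lambda>k. f k + f (Suc k)" t] by (simp add: bez_add avg_def [abs_def])

lemma funpow_avg_Suc: "(avg ^^ k) f (Suc i) = (avg ^^ k) (\<lambda>k. f (Suc k)) i"
  by (induction k arbitrary: i) (auto simp: avg_def)

text \<open>The left edge of the de Casteljau triangle gives the coefficients on the left half
  interval. Without its first entry, the edge for \<open>f\<close> is the edge for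
  \<open>avg f\<close> in one degree less, which is what the induction uses.\<close>

lemma bez_left: "bez n (\<lambda>k. (avg ^^ k) f 0) t = bez n f (t / 2)"
proof (induction n arbitrary: f)
  case (Suc n)
  have "bez (Suc n) (\<lambda>k. (avg ^^ k) f 0) t = (1 - t) * bez n f (t / 2) + t * bez n (avg f) (t / 2)"
    using Suc.IH[of f] Suc.IH[of "avg f"] by (simp add: bez_Suc funpow_swap1)
  then show ?case by (simp add: bez_avg bez_Suc field_simps)
qed simp

lemma bez_right: "bez n (\<lambda>k. (avg ^^ (n - k)) f k) t = bez n f ((1 + t) / 2)"
proof (induction n arbitrary: f)
  case (Suc n)
  have "bez n (\<lambda>k. (avg ^^ (Suc n - k)) f k) t = bez n (\<lambda>k. (avg ^^ (n - k)) (avg f) k) t"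
    by (rule bez_cong) (simp add: Suc_diff_le funpow_swap1)
  then have "bez (Suc n) (\<lambda>k. (avg ^^ (Suc n - k)) f k) t =
      (1 - t) * bez n (avg f) ((1 + t) / 2) + t * bez n (\<lambda>k. f (Suc k)) ((1 + t) / 2)"
    using Suc.IH[of "avg f"] Suc.IH[of "\<lambda>k. f (Suc k)"] by (simp add: bez_Suc funpow_avg_Suc)
  then show ?case by (simp add: bez_avg bez_Suc field_simps)
qed simp

section \<open>Subdivision in integers with downward rounding\<close>

fun mids :: "int list \<Rightarrow> int list" where
  "mids (x # y # xs) = drop_bit (Suc 0) (x + y) # mids (y # xs)"
| "mids xs = []"

lemma length_mids [simp]: "length (mids xs) = length xs - 1"
  by (induction xs rule: mids.induct) auto

lemma nth_mids: "Suc k < length xs \<Longrightarrow> mids xs ! k = (xs ! k + xs ! Suc k) div 2"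
  by (induction xs arbitrary: k rule: mids.induct) (auto simp: nth_Cons drop_bit_Suc split: nat.splits)

text \<open>One pass yields both edges of the triangle: the first entries of the successive rows
  from the top down, and their last entries from the apex up. These are the coefficients on the left
  and on the right half.\<close>

function dec :: "int list \<Rightarrow> int list \<times> int list" where
  "dec [] = ([], [])"
| "dec (x # xs) = (case dec (mids (x # xs)) of (l, r) \<Rightarrow> (x # l, r @ [last (x # xs)]))"
  by pat_completeness auto
termination by (relation "Wellfounded.measure length") auto

text \<open>The enclosure is one-sided because halving always rounds down.\<close>

definition approx :: "real \<Rightarrow> int list \<Rightarrow> (nat \<Rightarrow> real) \<Rightarrow> bool" where
  "approx e xs f \<longleftrightarrow> (\<forall>k<length xs. of_int (xs ! k) \<le> f k \<and> f k \<le> of_int (xs ! k) + e)"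

text \<open>Averaging two enclosures of width \<open>e\<close> keeps the width; the floor loses a
  further 1/2 when the sum is odd.\<close>

lemma approx_mids:
  assumes "approx e xs f"
  shows "approx (e + 1 / 2) (mids xs) (avg f)"
  unfolding approx_def
proof (intro allI impI)
  fix k assume k: "k < length (mids xs)"
  define z where "z = xs ! k + xs ! Suc k"
  have "2 * (z div 2) \<le> z" "z \<le> 2 * (z div 2) + 1" by auto
  then have "2 * real_of_int (z div 2) \<le> of_int z" "real_of_int z \<le> 2 * of_int (z div 2) + 1"
    by linarith+
  moreover have "of_int (xs ! k) \<le> f k" "f k \<le> of_int (xs ! k) + e"
    "of_int (xs ! Suc k) \<le> f (Suc k)" "f (Suc k) \<le> of_int (xs ! Suc k) + e"
    using assms k by (auto simp: approx_def)
  moreover have "mids xs ! k = z div 2" using k by (simp add: nth_mids z_def)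
  ultimately show "of_int (mids xs ! k) \<le> avg f k \<and> avg f k \<le> of_int (mids xs ! k) + (e + 1 / 2)"
    by (simp add: avg_def z_def field_simps)
qed

lemma length_dec: "length (fst (dec xs)) = length xs \<and> length (snd (dec xs)) = length xs"
  by (induction xs rule: dec.induct) (auto split: prod.splits)

text \<open>An entry of row i of the triangle has been rounded i times, at 1/2 each, and i is at
  most \<open>n\<close>. In degree 6 this is the 3 by which every subdivision enlarges the
  error.\<close>

lemma approx_dec:
  assumes "approx e xs f" "length xs = Suc n"
  shows "approx (e + n / 2) (fst (dec xs)) (\<lambda>k. (avg ^^ k) f 0) \<and>
         approx (e + n / 2) (snd (dec xs)) (\<lambda>k. (avg ^^ (n - k)) f k)"
  using assms
proof (induction xs arbitrary: e f n rule: dec.induct)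
  case (2 x xs)
  let ?m = "mids (x # xs)"
  have l: "length ?m = n" "length xs = n" using 2 by auto
  have x: "of_int x \<le> f 0" "f 0 \<le> of_int x + e" using 2(2) by (auto simp: approx_def)
  have lst: "of_int (last (x # xs)) \<le> f n" "f n \<le> of_int (last (x # xs)) + e"
    using 2(2) l by (auto simp: approx_def last_conv_nth nth_Cons')
  have d: "dec (x # xs) = (x # fst (dec ?m), snd (dec ?m) @ [last (x # xs)])"
    by (simp split: prod.splits)
  show ?case
  proof (cases n)
    case 0
    then show ?thesis using x lst l by (auto simp: approx_def)
  next
    case (Suc m)
    have IH: "approx (e + n / 2) (fst (dec ?m)) (\<lambda>k. (avg ^^ k) (avg f) 0)"
      "approx (e + n / 2) (snd (dec ?m)) (\<lambda>k. (avg ^^ (m - k)) (avg f) k)"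
      using 2(1)[OF approx_mids[OF 2(2)], of m] l Suc by (auto simp: field_simps)
    have L: "length (fst (dec ?m)) = n" "length (snd (dec ?m)) = n" using length_dec[of ?m] l by auto
    have "approx (e + n / 2) (x # fst (dec ?m)) (\<lambda>k. (avg ^^ k) f 0)"
      unfolding approx_def
    proof (intro allI impI)
      fix k assume "k < length (x # fst (dec ?m))"
      then show "of_int ((x # fst (dec ?m)) ! k) \<le> (avg ^^ k) f 0 \<and> (avg ^^ k) f 0 \<le> of_int ((x # fst (dec ?m)) ! k) + (e + n / 2)"
        using IH(1) x L by (cases k) (auto simp: approx_def funpow_swap1)
    qed
    moreover have "approx (e + n / 2) (snd (dec ?m) @ [last (x # xs)]) (\<lambda>k. (avg ^^ (n - k)) f k)"
      unfolding approx_def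
    proof (intro allI impI)
      fix k assume k: "k < length (snd (dec ?m) @ [last (x # xs)])"
      show "of_int ((snd (dec ?m) @ [last (x # xs)]) ! k) \<le> (avg ^^ (n - k)) f k \<and>
        (avg ^^ (n - k)) f k \<le> of_int ((snd (dec ?m) @ [last (x # xs)]) ! k) + (e + n / 2)"
      proof (cases "k < n")
        case True
        then have "n - k = Suc (m - k)" using Suc by simp
        then show ?thesis using True IH(2) L by (auto simp: approx_def nth_append funpow_swap1)
      next
        case False
        then have "k = n" using k L by simp
        then show ?thesis using lst L by (auto simp: nth_append)
      qed
    qed
    ultimately show ?thesis using d by simp
  qed
qed simp

section \<open>Certified subdivision of a bivariate polynomial system\<close>

type_synonym coeffs = "int list list"

definition bez2 :: "(nat \<Rightarrow> nat \<Rightarrow> real) \<Rightarrow> real \<Rightarrow> real \<Rightarrow> real" where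
  "bez2 f s t = bez 6 (\<lambda>k. bez 6 (f k) t) s"

definition square7 :: "coeffs \<Rightarrow> bool" where
  "square7 A \<longleftrightarrow> length A = 7 \<and> (\<forall>r\<in>set A. length r = 7)"

text \<open>The exact Bernstein coefficients stay hidden behind the existential; computation only
  ever touches their integer lower bounds, which are off by at most \<open>e\<close>.\<close>

definition rep :: "real \<Rightarrow> coeffs \<Rightarrow> (real \<Rightarrow> real \<Rightarrow> real) \<Rightarrow> bool" where
  "rep e A g \<longleftrightarrow> square7 A \<and> (\<exists>f. (\<forall>k<7. approx e (A ! k) (f k)) \<and> (\<forall>s t. g s t = bez2 f s t))"

text \<open>Matrix transposition. Whatever concerns the first variable is done by transposing and
  working on rows.\<close>

definition flip :: "coeffs \<Rightarrow> coeffs" where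
  "flip A = foldr (map2 (#)) A (replicate 7 [])"

definition split_t :: "coeffs \<Rightarrow> coeffs \<times> coeffs" where
  "split_t A = (case map dec A of ps \<Rightarrow> (map fst ps, map snd ps))"

definition split_s :: "coeffs \<Rightarrow> coeffs \<times> coeffs" where
  "split_s A = (case split_t (flip A) of (l, r) \<Rightarrow> (flip l, flip r))"

lemma flip_aux:
  assumes "\<forall>r\<in>set A. length r = n"
  shows "length (foldr (map2 (#)) A (replicate n [])) = n \<and>
    (\<forall>l<n. foldr (map2 (#)) A (replicate n []) ! l = map (\<lambda>r. r ! l) A)"
  using assms by (induction A) auto

lemma square7_flip: "square7 A \<Longrightarrow> square7 (flip A)"
  and nth_flip: "square7 A \<Longrightarrow> k < 7 \<Longrightarrow> l < 7 \<Longrightarrow> flip A ! l ! k = A ! k ! l"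
  using flip_aux[of A 7] by (auto simp: square7_def flip_def in_set_conv_nth)

lemma rep_flip:
  assumes "rep e A g"
  shows "rep e (flip A) (\<lambda>s t. g t s)"
proof -
  from assms obtain f where A: "square7 A" and f: "\<forall>k<7. approx e (A ! k) (f k)" and g: "\<forall>s t. g s t = bez2 f s t"
    by (auto simp: rep_def)
  have l: "length (A ! k) = 7" "length (flip A ! k) = 7" if "k < 7" for k
    using that A square7_flip[OF A] by (auto simp: square7_def)
  show ?thesis
    unfolding rep_def
  proof (intro conjI exI)
    show "square7 (flip A)" by (rule square7_flip[OF A])
    show "\<forall>k<7. approx e (flip A ! k) ((\<lambda>l k. f k l) k)"
      using f l nth_flip[OF A] by (auto simp: approx_def)
    show "\<forall>s t. g t s = bez2 (\<lambda>l k. f k l) s t"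
      using g by (auto simp: bez2_def intro: bez_swap)
  qed
qed

lemma rep_split_t:
  assumes "rep e A g"
  shows "rep (e + 3) (fst (split_t A)) (\<lambda>s t. g s (t / 2))"
    and "rep (e + 3) (snd (split_t A)) (\<lambda>s t. g s ((1 + t) / 2))"
proof -
  from assms obtain f where A: "square7 A" and f: "\<And>k. k < 7 \<Longrightarrow> approx e (A ! k) (f k)" and g: "\<And>s t. g s t = bez2 f s t"
    by (auto simp: rep_def)
  have l: "length A = 7" "\<And>k. k < 7 \<Longrightarrow> length (A ! k) = Suc 6"
    using A by (auto simp: square7_def)
  have sq: "square7 (fst (split_t A))" "square7 (snd (split_t A))"
    using A length_dec by (auto simp: square7_def split_t_def)
  note d = approx_dec[OF f l(2)]
  have "\<forall>k<7. approx (e + 3) (fst (split_t A) ! k) (\<lambda>l. (avg ^^ l) (f k) 0)"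
    "\<forall>k<7. approx (e + 3) (snd (split_t A) ! k) (\<lambda>l. (avg ^^ (6 - l)) (f k) l)"
    using d l by (auto simp: split_t_def)
  moreover have "\<forall>s t. g s (t / 2) = bez2 (\<lambda>k l. (avg ^^ l) (f k) 0) s t"
    "\<forall>s t. g s ((1 + t) / 2) = bez2 (\<lambda>k l. (avg ^^ (6 - l)) (f k) l) s t"
    using g by (simp_all add: bez2_def bez_left bez_right)
  ultimately show "rep (e + 3) (fst (split_t A)) (\<lambda>s t. g s (t / 2))"
    "rep (e + 3) (snd (split_t A)) (\<lambda>s t. g s ((1 + t) / 2))"
    using sq unfolding rep_def
    by - (rule conjI, assumption, rule exI[of _ "\<lambda>k l. (avg ^^ l) (f k) 0"], rule conjI, assumption, assumption,
          rule conjI, assumption, rule exI[of _ "\<lambda>k l. (avg ^^ (6 - l)) (f k) l"], rule conjI, assumption, assumption)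
qed

lemma rep_split_s:
  assumes "rep e A g"
  shows "rep (e + 3) (fst (split_s A)) (\<lambda>s t. g (s / 2) t)"
    and "rep (e + 3) (snd (split_s A)) (\<lambda>s t. g ((1 + s) / 2) t)"
  using rep_split_t[OF rep_flip[OF assms], THEN rep_flip]
  by (auto simp: split_s_def split: prod.splits)

text \<open>\<open>Solve\<close> carries the two rows of a preconditioner, each preceded by a number that separates the diagonal
  from the off-diagonal derivatives of the preconditioned system.  The tree below it locates the zero more
  precisely, in the pieces marked \<open>Here\<close>; the first argument of \<open>check\<close> says whether we are below a \<open>Solve\<close>.\<close>

datatype tree =
    Excl int int
  | Solve int int int int int int tree
  | Here
  | SplitS tree tree
  | SplitT tree tree

definition lin :: "int \<Rightarrow> int \<Rightarrow> coeffs \<Rightarrow> coeffs \<Rightarrow> coeffs" where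
  "lin c d A B = map2 (map2 (\<lambda>x y. c * x + d * y)) A B"

text \<open>A stored entry is a lower bound, so only negative weights can make the combination
  smaller than computed; \<open>m * e\<close> is that loss. If all Bernstein coefficients are
  positive, so is the polynomial on the square.\<close>

definition excl :: "int \<Rightarrow> int \<Rightarrow> int \<Rightarrow> coeffs \<Rightarrow> coeffs \<Rightarrow> bool" where
  "excl e c d A B = (case (if c < 0 then - c else 0) + (if d < 0 then - d else 0) of m \<Rightarrow>
     case m * e of b \<Rightarrow> list_all (list_all (\<lambda>x. b < x)) (lin c d A B))"

text \<open>Partial derivatives of a Bernstein polynomial have 6 times the first differences as
  coefficients. The factor 6 is common to both directions and cancels, so differences are compared
  through the separating number \<open>b\<close>; \<open>w\<close> is the width of the enclosure of
  one coefficient of the combination. The first and last rows are the values on the two opposite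
  edges.\<close>

definition solve_s :: "int \<Rightarrow> int \<Rightarrow> int \<Rightarrow> int \<Rightarrow> coeffs \<Rightarrow> coeffs \<Rightarrow> bool" where
  "solve_s e b c d A B = (case (\<bar>c\<bar> + \<bar>d\<bar>) * e of w \<Rightarrow> case lin c d A B of G \<Rightarrow>
     list_all2 (list_all2 (\<lambda>x y. b + w < y - x)) (butlast G) (tl G) \<and>
     list_all (\<lambda>r. list_all2 (\<lambda>x y. \<bar>y - x\<bar> + w \<le> b) (butlast r) (tl r)) G \<and>
     list_all (\<lambda>x. x + w < 0) (hd G) \<and> list_all (\<lambda>x. w < x) (last G))"

text \<open>The second preconditioner row is tested on the transposed tables, so both rows share one
  test. The \<open>e + 3\<close> accounts for six rounds of averaging with error 1/2 each.\<close>

fun check :: "bool \<Rightarrow> int \<Rightarrow> coeffs \<Rightarrow> coeffs \<Rightarrow> tree \<Rightarrow> bool" where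
  "check h e A B (Excl c d) = excl e c d A B"
| "check h e A B (Solve b c11 c12 b' c21 c22 T) \<longleftrightarrow>
     \<not> h \<and> solve_s e b c11 c12 A B \<and> solve_s e b' c21 c22 (flip A) (flip B) \<and> check True e A B T"
| "check h e A B Here = h"
| "check h e A B (SplitS l r) = (case split_s A of (A1, A2) \<Rightarrow> case split_s B of (B1, B2) \<Rightarrow>
     check h (e + 3) A1 B1 l \<and> check h (e + 3) A2 B2 r)"
| "check h e A B (SplitT l r) = (case split_t A of (A1, A2) \<Rightarrow> case split_t B of (B1, B2) \<Rightarrow>
     check h (e + 3) A1 B1 l \<and> check h (e + 3) A2 B2 r)"


type_synonym box = "real \<times> real \<times> real \<times> real"

definition in_box :: "box \<Rightarrow> real \<Rightarrow> real \<Rightarrow> bool" where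
  "in_box b u v = (case b of (x, h, y, k) \<Rightarrow> u \<in> {x..x + h} \<and> v \<in> {y..y + k})"

fun cands :: "box \<Rightarrow> tree \<Rightarrow> box list" where
  "cands b Here = [b]"
| "cands (x, h, y, k) (SplitS l r) = cands (x, h / 2, y, k) l @ cands (x + h / 2, h / 2, y, k) r"
| "cands (x, h, y, k) (SplitT l r) = cands (x, h, y, k / 2) l @ cands (x, h, y + k / 2, k / 2) r"
| "cands b _ = []"

fun solves :: "box \<Rightarrow> tree \<Rightarrow> (box \<times> (int \<times> int \<times> int \<times> int) \<times> box list) list" where
  "solves b (Solve _ c11 c12 _ c21 c22 T) = [(b, (c11, c12, c21, c22), cands b T)]"
| "solves (x, h, y, k) (SplitS l r) = solves (x, h / 2, y, k) l @ solves (x + h / 2, h / 2, y, k) r"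
| "solves (x, h, y, k) (SplitT l r) = solves (x, h, y, k / 2) l @ solves (x, h, y + k / 2, k / 2) r"
| "solves b _ = []"

text \<open>The four numbers \<open>p1, p2, q1, q2\<close> are the partial derivatives of \<open>g1\<close> and \<open>g2\<close> at \<open>(u, v)\<close>.\<close>

definition dominant :: "(real \<Rightarrow> real \<Rightarrow> real) \<Rightarrow> (real \<Rightarrow> real \<Rightarrow> real) \<Rightarrow> box \<Rightarrow> int \<Rightarrow> int \<Rightarrow> bool" where
  "dominant g1 g2 b c d = (case b of (x, h, y, k) \<Rightarrow>
     (\<forall>u v p1 p2 q1 q2. in_box b u v \<longrightarrow>
        ((\<lambda>u. g1 u v) has_real_derivative p1) (at u) \<longrightarrow> ((\<lambda>v. g1 u v) has_real_derivative p2) (at v) \<longrightarrow>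
        ((\<lambda>u. g2 u v) has_real_derivative q1) (at u) \<longrightarrow> ((\<lambda>v. g2 u v) has_real_derivative q2) (at v) \<longrightarrow>
        \<bar>of_int c * p2 + of_int d * q2\<bar> * k < (of_int c * p1 + of_int d * q1) * h) \<and>
     (\<forall>v. in_box b x v \<longrightarrow> of_int c * g1 x v + of_int d * g2 x v < 0) \<and>
     (\<forall>v. in_box b (x + h) v \<longrightarrow> 0 < of_int c * g1 (x + h) v + of_int d * g2 (x + h) v))"

definition swap_box :: "box \<Rightarrow> box" where
  "swap_box b = (case b of (x, h, y, k) \<Rightarrow> (y, k, x, h))"

definition swap_args :: "('a \<Rightarrow> 'a \<Rightarrow> 'b) \<Rightarrow> 'a \<Rightarrow> 'a \<Rightarrow> 'b" where
  "swap_args g u v = g v u"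

lemma bez2_lin: "bez2 (\<lambda>k l. c * f k l + d * g k l) s t = c * bez2 f s t + d * bez2 g s t"
  by (simp add: bez2_def bez_add bez_cmult)

lemma bez2_mono:
  assumes "s \<in> {0..1}" "t \<in> {0..1}" "\<And>k l. k < 7 \<Longrightarrow> l < 7 \<Longrightarrow> f k l \<le> g k l"
  shows "bez2 f s t \<le> bez2 g s t"
  unfolding bez2_def using assms by (intro bez_mono) auto

lemma nth_lin: "square7 A \<Longrightarrow> square7 B \<Longrightarrow> k < 7 \<Longrightarrow> l < 7 \<Longrightarrow> lin c d A B ! k ! l = c * A ! k ! l + d * B ! k ! l"
  by (auto simp: lin_def square7_def)

lemma square7_lin: "square7 A \<Longrightarrow> square7 B \<Longrightarrow> square7 (lin c d A B)"
  by (auto simp: lin_def square7_def set_zip)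

lemma excl_sound:
  assumes "excl e c d A B" "rep e A g1" "rep e B g2" "s \<in> {0..1}" "t \<in> {0..1}"
  shows "0 < of_int c * g1 s t + of_int d * g2 s t"
proof -
  obtain f where A: "square7 A" and f: "\<And>k. k < 7 \<Longrightarrow> approx e (A ! k) (f k)" and g1: "\<And>s t. g1 s t = bez2 f s t"
    using assms(2) by (auto simp: rep_def)
  obtain f' where B: "square7 B" and f': "\<And>k. k < 7 \<Longrightarrow> approx e (B ! k) (f' k)" and g2: "\<And>s t. g2 s t = bez2 f' s t"
    using assms(3) by (auto simp: rep_def)
  define m where "m = (if c < 0 then - c else 0) + (if d < 0 then - d else 0)"
  have ex: "m * e < c * A ! k ! l + d * B ! k ! l" if kl: "k < 7" "l < 7" for k l
  proof -
    have "m * e < lin c d A B ! k ! l"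
      using assms(1) kl square7_lin[OF A B, of c d]
      by (auto simp: excl_def m_def [symmetric] list_all_length square7_def)
    then show ?thesis by (simp add: nth_lin[OF A B kl])
  qed
  \<comment> \<open>Integers turn the strict inequality into a gap of 1, so the constant 1 is a
    Bernstein minorant.\<close>
  have low: "1 \<le> of_int c * f k l + of_int d * f' k l" if kl: "k < 7" "l < 7" for k l
  proof -
    have a: "of_int (A ! k ! l) \<le> f k l" "f k l \<le> of_int (A ! k ! l) + real_of_int e"
      and b: "of_int (B ! k ! l) \<le> f' k l" "f' k l \<le> of_int (B ! k ! l) + real_of_int e"
      using f[OF kl(1)] f'[OF kl(1)] A B kl by (auto simp: approx_def square7_def)
    have bd: "of_int (z * w - (if z < 0 then - z else 0) * e) \<le> of_int z * r"
      if "of_int w \<le> r" "r \<le> of_int w + real_of_int e" for z w r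
    proof (cases "z < 0")
      case True
      have "of_int z * (of_int w + real_of_int e) \<le> of_int z * r"
        using that(2) True by (intro mult_left_mono_neg) auto
      then show ?thesis using True by (simp add: algebra_simps)
    next
      case False
      then show ?thesis using that(1) by (simp add: mult_left_mono)
    qed
    have "of_int (m * e + 1) \<le> real_of_int (c * A ! k ! l + d * B ! k ! l)"
      using ex[OF kl] by linarith
    then show ?thesis
      using bd[OF a, of c] bd[OF b, of d] unfolding m_def by (simp add: algebra_simps split: if_splits)
  qed
  have "1 = bez2 (\<lambda>k l. 1) s t" by (simp add: bez2_def)
  also have "\<dots> \<le> bez2 (\<lambda>k l. of_int c * f k l + of_int d * f' k l) s t"
    using low assms by (intro bez2_mono) auto
  finally show ?thesis by (simp add: bez2_lin g1 g2)
qed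


lemma solve_s_sound:
  assumes ok: "solve_s e b c d A B"
    and rep: "rep e A (\<lambda>s t. g1 (x + h * s) (y + k * t))" "rep e B (\<lambda>s t. g2 (x + h * s) (y + k * t))"
    and pos: "h > 0" "k > 0"
  shows "dominant g1 g2 (x, h, y, k) c d"
proof -
  obtain f where A: "square7 A" and f: "\<And>k. k < 7 \<Longrightarrow> approx e (A ! k) (f k)"
    and g1: "\<And>s t. g1 (x + h * s) (y + k * t) = bez2 f s t"
    using rep(1) by (auto simp: rep_def)
  obtain f' where B: "square7 B" and f': "\<And>k. k < 7 \<Longrightarrow> approx e (B ! k) (f' k)"
    and g2: "\<And>s t. g2 (x + h * s) (y + k * t) = bez2 f' s t"
    using rep(2) by (auto simp: rep_def)
  define w where "w = (\<bar>c\<bar> + \<bar>d\<bar>) * e"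
  define G where "G = lin c d A B"
  define F where "F k l = of_int c * f k l + of_int d * f' k l" for k l
  \<comment> \<open>The exact coefficient lies in [G - \<open>m\<close>, G - \<open>m\<close> +
    \<open>w\<close>]: negative weights shift the enclosure down by \<open>m\<close>, while its
    width is \<open>w\<close> regardless of signs.\<close>
  define m where "m = ((if c < 0 then \<bar>c\<bar> else 0) + (if d < 0 then \<bar>d\<bar> else 0)) * e"
  have G7: "length G = 7" "\<And>k. k < 7 \<Longrightarrow> length (G ! k) = 7"
    using square7_lin[OF A B, of c d] by (auto simp: G_def square7_def)
  have GF: "of_int (G ! k ! l) - of_int m \<le> F k l" "F k l \<le> of_int (G ! k ! l) - of_int m + of_int w"
    if kl: "k < 7" "l < 7" for k l
  proof -
    have a: "of_int (A ! k ! l) \<le> f k l" "f k l \<le> of_int (A ! k ! l) + real_of_int e"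
      and b: "of_int (B ! k ! l) \<le> f' k l" "f' k l \<le> of_int (B ! k ! l) + real_of_int e"
      using f[OF kl(1)] f'[OF kl(1)] A B kl by (auto simp: approx_def square7_def)
    have bd: "of_int (z * v) - of_int ((if z < 0 then \<bar>z\<bar> else 0) * e) \<le> of_int z * r \<and>
        of_int z * r \<le> of_int (z * v) - of_int ((if z < 0 then \<bar>z\<bar> else 0) * e) + of_int (\<bar>z\<bar> * e)"
      if "of_int v \<le> r" "r \<le> of_int v + real_of_int e" for z v r
    proof (cases "z < 0")
      case True
      then show ?thesis
        using mult_left_mono_neg[OF that(1), of "of_int z"] mult_left_mono_neg[OF that(2), of "of_int z"]
        by (simp add: algebra_simps)
    next
      case False
      then show ?thesis
        using mult_left_mono[OF that(1), of "of_int z"] mult_left_mono[OF that(2), of "of_int z"]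
        by (simp add: algebra_simps)
    qed
    have "G ! k ! l = c * A ! k ! l + d * B ! k ! l" by (simp add: G_def nth_lin[OF A B kl])
    moreover have "w = \<bar>c\<bar> * e + \<bar>d\<bar> * e" by (simp add: w_def algebra_simps)
    moreover have "m = (if c < 0 then \<bar>c\<bar> else 0) * e + (if d < 0 then \<bar>d\<bar> else 0) * e"
      by (simp add: m_def algebra_simps)
    ultimately show "of_int (G ! k ! l) - of_int m \<le> F k l" "F k l \<le> of_int (G ! k ! l) - of_int m + of_int w"
      using bd[OF a, of c] bd[OF b, of d] unfolding F_def by linarith+
  qed
  have m: "0 \<le> e \<Longrightarrow> 0 \<le> m \<and> m \<le> w"
    using mult_nonneg_nonneg[of "\<bar>c\<bar>" e] mult_nonneg_nonneg[of "\<bar>d\<bar>" e]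
    unfolding m_def w_def distrib_right by auto
  \<comment> \<open>Any one enclosure is nonempty, which forces a nonnegative error.\<close>
  have "0 \<le> e"
    using f[of 0] A by (force simp: approx_def square7_def)
  note m = m[OF this]
  have os: "b + w < G ! Suc k ! l - G ! k ! l" if "k < 6" "l < 7" for k l
    using ok that G7 unfolding solve_s_def w_def [symmetric] G_def [symmetric]
    by (auto simp: list_all2_conv_all_nth nth_butlast nth_tl)
  have ot: "\<bar>G ! k ! Suc l - G ! k ! l\<bar> + w \<le> b" if "k < 7" "l < 6" for k l
    using ok that G7 unfolding solve_s_def w_def [symmetric] G_def [symmetric]
    by (auto simp: list_all2_conv_all_nth list_all_length nth_butlast nth_tl)
  have "G \<noteq> []" using G7(1) by auto
  then have hl: "hd G = G ! 0" "last G = G ! 6" using G7(1) by (auto simp: hd_conv_nth last_conv_nth)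
  have o0: "G ! 0 ! l + w < 0" "w < G ! 6 ! l" if "l < 7" for l
    using ok that G7(1) G7(2)[of 0] G7(2)[of 6] unfolding solve_s_def w_def [symmetric] G_def [symmetric]
    by (auto simp: list_all_length hl)
  \<comment> \<open>The offset \<open>m\<close> cancels in differences; only the width
    \<open>w\<close> remains as a loss.\<close>
  have Fs: "of_int b + 1 \<le> F (Suc k) l - F k l" if "k < 6" "l < 7" for k l
  proof -
    have "of_int (b + w + 1) \<le> real_of_int (G ! Suc k ! l - G ! k ! l)" using os[OF that] by linarith
    then show ?thesis using GF[of k l] GF[of "Suc k" l] that by (simp add: algebra_simps)
  qed
  have Ft: "\<bar>F k (Suc l) - F k l\<bar> \<le> of_int b" if "k < 7" "l < 6" for k l
  proof -
    have "of_int (\<bar>G ! k ! Suc l - G ! k ! l\<bar> + w) \<le> real_of_int b" using ot[OF that] by linarith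
    then show ?thesis using GF[of k l] GF[of k "Suc l"] that by (simp add: abs_if split: if_splits)
  qed
  have Ft': "- of_int b \<le> F k (Suc l) - F k l" if "k < 7" "l < 6" for k l
    using Ft[OF that] by linarith
  have F0: "F 0 l \<le> -1" "1 \<le> F 6 l" if "l < 7" for l
  proof -
    have "of_int (G ! 0 ! l + w + 1) \<le> (0 :: real)" "of_int (w + 1) \<le> real_of_int (G ! 6 ! l)"
      using o0[OF that] by linarith+
    moreover have "0 \<le> real_of_int m" "real_of_int m \<le> of_int w" using m by auto
    ultimately show "F 0 l \<le> -1" "1 \<le> F 6 l" using GF[of 0 l] GF[of 6 l] that by simp_all
  qed
  have gF: "of_int c * g1 (x + h * s) (y + k * t) + of_int d * g2 (x + h * s) (y + k * t) = bez2 F s t" for s t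
    unfolding g1 g2 F_def by (simp add: bez2_lin)
  show ?thesis
    unfolding dominant_def prod.case
  proof (intro conjI allI impI)
    fix u v p1 p2 q1 q2
    assume uv: "in_box (x, h, y, k) u v"
      and p1: "((\<lambda>u. g1 u v) has_real_derivative p1) (at u)" and p2: "((\<lambda>v. g1 u v) has_real_derivative p2) (at v)"
      and q1: "((\<lambda>u. g2 u v) has_real_derivative q1) (at u)" and q2: "((\<lambda>v. g2 u v) has_real_derivative q2) (at v)"
    define s where "s = (u - x) / h"
    define t where "t = (v - y) / k"
    have u: "u = x + h * s" and v: "v = y + k * t" and s: "s \<in> {0..1}" and t: "t \<in> {0..1}"
      using uv pos by (auto simp: s_def t_def in_box_def field_simps)
    \<comment> \<open>The same function of \<open>s\<close> is differentiated by the chain rule and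
      through its Bernstein form; uniqueness of derivatives identifies the two results. The same is
      done for \<open>t\<close> below.\<close>
    have "((\<lambda>s. of_int c * g1 (x + h * s) v + of_int d * g2 (x + h * s) v) has_real_derivative
        of_int c * (p1 * h) + of_int d * (q1 * h)) (at s)"
      using p1 q1 unfolding u
      by (auto intro!: derivative_eq_intros DERIV_chain2[where f = "\<lambda>u. g1 u v"] DERIV_chain2[where f = "\<lambda>u. g2 u v"])
    moreover have "((\<lambda>s. of_int c * g1 (x + h * s) v + of_int d * g2 (x + h * s) v) has_real_derivative
        6 * bez 5 (\<lambda>k. bez 6 (F (Suc k)) t - bez 6 (F k) t) s) (at s)"
      using bez_deriv[of 5 "\<lambda>k. bez 6 (F k) t" s] unfolding v gF bez2_def by simp
    ultimately have ds: "(of_int c * p1 + of_int d * q1) * h = 6 * bez 5 (\<lambda>k. bez 6 (F (Suc k)) t - bez 6 (F k) t) s"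
      using DERIV_unique by (simp add: algebra_simps) blast
    have "((\<lambda>t. of_int c * g1 u (y + k * t) + of_int d * g2 u (y + k * t)) has_real_derivative
        of_int c * (p2 * k) + of_int d * (q2 * k)) (at t)"
      using p2 q2 unfolding v
      by (auto intro!: derivative_eq_intros DERIV_chain2[where f = "\<lambda>v. g1 u v"] DERIV_chain2[where f = "\<lambda>v. g2 u v"])
    moreover have "((\<lambda>t. of_int c * g1 u (y + k * t) + of_int d * g2 u (y + k * t)) has_real_derivative
        6 * bez 5 (\<lambda>l. bez 6 (\<lambda>k. F k (Suc l)) s - bez 6 (\<lambda>k. F k l) s) t) (at t)"
      using bez_deriv[of 5 "\<lambda>l. bez 6 (\<lambda>k. F k l) s" t] unfolding u gF bez2_def bez_swap[of 6 6 F] by simp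
    ultimately have dt: "(of_int c * p2 + of_int d * q2) * k = 6 * bez 5 (\<lambda>l. bez 6 (\<lambda>k. F k (Suc l)) s - bez 6 (\<lambda>k. F k l) s) t"
      using DERIV_unique by (simp add: algebra_simps) blast
    have sub: "bez n (\<lambda>k. p k) r - bez n (\<lambda>k. q k) r = bez n (\<lambda>k. p k - q k) r" for n r p q
      using bez_add[of n "\<lambda>k. p k - q k" q r] by simp
    have "bez 5 (\<lambda>k. bez 6 (\<lambda>l. of_int b + 1) t) s \<le> bez 5 (\<lambda>k. bez 6 (F (Suc k)) t - bez 6 (F k) t) s"
      unfolding sub using s t Fs by (intro bez_mono) auto
    moreover have "bez 5 (\<lambda>l. bez 6 (\<lambda>k. F k (Suc l)) s - bez 6 (\<lambda>k. F k l) s) t \<le> bez 5 (\<lambda>k. bez 6 (\<lambda>l. of_int b) s) t"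
      unfolding sub using s t Ft by (intro bez_mono) (auto simp: abs_le_iff)
    moreover have "bez 5 (\<lambda>k. bez 6 (\<lambda>l. - of_int b) s) t \<le> bez 5 (\<lambda>l. bez 6 (\<lambda>k. F k (Suc l)) s - bez 6 (\<lambda>k. F k l) s) t"
      unfolding sub using s t Ft' by (intro bez_mono) auto
    ultimately have "\<bar>(of_int c * p2 + of_int d * q2) * k\<bar> < (of_int c * p1 + of_int d * q1) * h"
      unfolding ds dt by (simp add: abs_less_iff)
    then show "\<bar>of_int c * p2 + of_int d * q2\<bar> * k < (of_int c * p1 + of_int d * q1) * h"
      using pos by (simp add: abs_mult)
  next
    fix v assume v: "in_box (x, h, y, k) x v"
    define t where "t = (v - y) / k"
    have t: "v = y + k * t" "t \<in> {0..1}" using v pos by (auto simp: t_def in_box_def field_simps)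
    have "bez2 F 0 t = bez 6 (F 0) t" by (simp add: bez2_def bez_at_0)
    also have "\<dots> \<le> bez 6 (\<lambda>_. -1) t" using t F0 by (intro bez_mono) auto
    finally show "of_int c * g1 x v + of_int d * g2 x v < 0" using gF[of 0 t] t by simp
  next
    fix v assume v: "in_box (x, h, y, k) (x + h) v"
    define t where "t = (v - y) / k"
    have t: "v = y + k * t" "t \<in> {0..1}" using v pos by (auto simp: t_def in_box_def field_simps)
    have "1 = bez 6 (\<lambda>_. 1) t" by simp
    also have "\<dots> \<le> bez 6 (F 6) t" using t F0 by (intro bez_mono) auto
    also have "\<dots> = bez2 F 1 t" by (simp add: bez2_def bez_at_1)
    finally show "0 < of_int c * g1 (x + h) v + of_int d * g2 (x + h) v" using gF[of 1 t] t by simp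
  qed
qed

definition solvable :: "(real \<Rightarrow> real \<Rightarrow> real) \<Rightarrow> (real \<Rightarrow> real \<Rightarrow> real) \<Rightarrow> box \<Rightarrow> int \<times> int \<times> int \<times> int \<Rightarrow> bool" where
  "solvable g1 g2 b C = (case C of (c11, c12, c21, c22) \<Rightarrow>
     dominant g1 g2 b c11 c12 \<and> dominant (swap_args g1) (swap_args g2) (swap_box b) c21 c22)"

text \<open>The flag selects the invariant carried by the induction: below a \<open>Solve\<close>,
  zeros are only traced into the marked pieces; elsewhere they are traced into solved pieces, each
  of which carries its own refinement.\<close>

definition covered :: "(real \<Rightarrow> real \<Rightarrow> real) \<Rightarrow> (real \<Rightarrow> real \<Rightarrow> real) \<Rightarrow> bool \<Rightarrow> box \<Rightarrow> tree \<Rightarrow> bool" where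
  "covered g1 g2 hr b T = (if hr
      then (\<forall>u v. in_box b u v \<longrightarrow> g1 u v = 0 \<longrightarrow> g2 u v = 0 \<longrightarrow> (\<exists>b'\<in>set (cands b T). in_box b' u v))
      else (\<forall>u v. in_box b u v \<longrightarrow> g1 u v = 0 \<longrightarrow> g2 u v = 0 \<longrightarrow>
          (\<exists>(b', C, bs)\<in>set (solves b T). in_box b' u v)) \<and>
        (\<forall>(b', C, bs)\<in>set (solves b T). solvable g1 g2 b' C \<and>
          (\<forall>u v. in_box b' u v \<longrightarrow> g1 u v = 0 \<longrightarrow> g2 u v = 0 \<longrightarrow> (\<exists>b''\<in>set bs. in_box b'' u v))))"

theorem check_sound:
  assumes "check hr e A B T" "h > 0" "k > 0"
    and "rep e A (\<lambda>s t. g1 (x + h * s) (y + k * t))" "rep e B (\<lambda>s t. g2 (x + h * s) (y + k * t))"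
  shows "covered g1 g2 hr (x, h, y, k) T"
  using assms
proof (induction T arbitrary: hr e A B x h y k)
  case (Excl c d)
  have "\<not> (g1 u v = 0 \<and> g2 u v = 0)" if uv: "in_box (x, h, y, k) u v" for u v
  proof -
    have st: "(u - x) / h \<in> {0..1}" "(v - y) / k \<in> {0..1}" "excl e c d A B"
      using Excl uv by (auto simp: in_box_def field_simps)
    have uv': "x + h * ((u - x) / h) = u" "y + k * ((v - y) / k) = v" using Excl by auto
    show ?thesis
      using excl_sound[OF st(3) Excl(4,5) st(1,2)] unfolding uv' by auto
  qed
  then show ?case by (auto simp: covered_def)
next
  case (Solve b c11 c12 b' c21 c22 T)
  have hr: "\<not> hr" and T: "check True e A B T" and ok: "solve_s e b c11 c12 A B" "solve_s e b' c21 c22 (flip A) (flip B)"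
    using Solve.prems(1) by auto
  have "dominant g1 g2 (x, h, y, k) c11 c12"
    by (rule solve_s_sound[OF ok(1) Solve.prems(4,5,2,3)])
  moreover have "dominant (swap_args g1) (swap_args g2) (y, k, x, h) c21 c22"
    by (rule solve_s_sound[OF ok(2) _ _ Solve.prems(3,2)])
       (use rep_flip[OF Solve.prems(4)] rep_flip[OF Solve.prems(5)] in \<open>simp_all add: swap_args_def\<close>)
  ultimately show ?case
    using hr Solve.IH[OF T Solve.prems(2-5)] by (simp add: solvable_def swap_box_def covered_def)
next
  case Here
  then show ?case by (auto simp: covered_def)
next
  case (SplitS l r)
  obtain A1 A2 B1 B2 where sp: "split_s A = (A1, A2)" "split_s B = (B1, B2)" by (metis surj_pair)
  have chk: "check hr (e + 3) A1 B1 l" "check hr (e + 3) A2 B2 r" using SplitS.prems(1) sp by auto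
  have eqs: "x + h * (s / 2) = x + h / 2 * s" "x + h * ((1 + s) / 2) = x + h / 2 + h / 2 * s" for s
    by (auto simp: field_simps)
  have pos: "h / 2 > 0" "k > 0" using SplitS.prems by auto
  note reps = rep_split_s[OF SplitS.prems(4)] rep_split_s[OF SplitS.prems(5)]
  have "covered g1 g2 hr (x, h / 2, y, k) l"
    by (rule SplitS.IH(1)[OF chk(1) pos]) (use reps(1,3) in \<open>simp_all only: sp eqs(1) fst_conv of_int_add of_int_numeral\<close>)
  moreover have "covered g1 g2 hr (x + h / 2, h / 2, y, k) r"
    by (rule SplitS.IH(2)[OF chk(2) pos]) (use reps(2,4) in \<open>simp_all only: sp eqs(2) snd_conv of_int_add of_int_numeral\<close>)
  moreover have "in_box (x, h, y, k) u v \<longleftrightarrow> in_box (x, h / 2, y, k) u v \<or> in_box (x + h / 2, h / 2, y, k) u v" for u v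
    using SplitS.prems by (auto simp: in_box_def)
  ultimately show ?case
    unfolding covered_def by (simp add: bex_Un ball_Un split: if_splits)
next
  case (SplitT l r)
  obtain A1 A2 B1 B2 where sp: "split_t A = (A1, A2)" "split_t B = (B1, B2)" by (metis surj_pair)
  have chk: "check hr (e + 3) A1 B1 l" "check hr (e + 3) A2 B2 r" using SplitT.prems(1) sp by auto
  have eqs: "y + k * (s / 2) = y + k / 2 * s" "y + k * ((1 + s) / 2) = y + k / 2 + k / 2 * s" for s
    by (auto simp: field_simps)
  have pos: "h > 0" "k / 2 > 0" using SplitT.prems by auto
  note reps = rep_split_t[OF SplitT.prems(4)] rep_split_t[OF SplitT.prems(5)]
  have "covered g1 g2 hr (x, h, y, k / 2) l"
    by (rule SplitT.IH(1)[OF chk(1) pos]) (use reps(1,3) in \<open>simp_all only: sp eqs(1) fst_conv of_int_add of_int_numeral\<close>)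
  moreover have "covered g1 g2 hr (x, h, y + k / 2, k / 2) r"
    by (rule SplitT.IH(2)[OF chk(2) pos]) (use reps(2,4) in \<open>simp_all only: sp eqs(2) snd_conv of_int_add of_int_numeral\<close>)
  moreover have "in_box (x, h, y, k) u v \<longleftrightarrow> in_box (x, h, y, k / 2) u v \<or> in_box (x, h, y + k / 2, k / 2) u v" for u v
    using SplitT.prems by (auto simp: in_box_def)
  ultimately show ?case
    unfolding covered_def by (simp add: bex_Un ball_Un split: if_splits)
qed

section \<open>From the power basis to Bernstein coefficients\<close>

fun poly1 :: "int list \<Rightarrow> real \<Rightarrow> real" where
  "poly1 [] v = 0"
| "poly1 (c # cs) v = of_int c + v * poly1 cs v"

fun poly2 :: "coeffs \<Rightarrow> real \<Rightarrow> real \<Rightarrow> real" where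
  "poly2 [] u v = 0"
| "poly2 (r # rs) u v = poly1 r v + u * poly2 rs u v"

fun lincomb :: "int list \<Rightarrow> coeffs \<Rightarrow> int list" where
  "lincomb (c # cs) (w # W) = map2 (\<lambda>x a. c * x + a) w (lincomb cs W)"
| "lincomb cs W = replicate 7 0"

text \<open>The change of basis is made one variable at a time: rows are converted in the second
  variable, columns in the first.\<close>

definition bernstein :: "coeffs \<Rightarrow> coeffs \<Rightarrow> coeffs \<Rightarrow> coeffs" where
  "bernstein W1 W2 M = flip (map (\<lambda>r. lincomb r W1) (flip (map (\<lambda>r. lincomb r W2) M)))"

text \<open>Row \<open>i\<close> holds the degree 6 Bernstein coefficients of the
  \<open>i\<close>-th power of the affine parametrization; the factor \<open>q\<close> makes them
  integers.\<close>

definition powers :: "coeffs \<Rightarrow> real \<Rightarrow> real \<Rightarrow> real \<Rightarrow> bool" where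
  "powers W q x h \<longleftrightarrow> square7 W \<and> (\<forall>i<7. \<forall>s. bez 6 (\<lambda>k. of_int (W ! i ! k)) s = q * (x + h * s) ^ i)"

lemma length_lincomb: "\<forall>w\<in>set W. length w = 7 \<Longrightarrow> length (lincomb cs W) = 7"
  by (induction cs W rule: lincomb.induct) auto

lemma bez_lincomb:
  assumes "length cs \<le> length W" "\<forall>w\<in>set W. length w = 7"
    and "\<forall>i<length W. bez 6 (\<lambda>k. of_int (W ! i ! k)) s = q * u ^ i"
  shows "bez 6 (\<lambda>k. of_int (lincomb cs W ! k)) s = q * poly1 cs u"
  using assms
proof (induction cs W arbitrary: q rule: lincomb.induct)
  case (1 c cs w W)
  have l: "length w = 7" "length (lincomb cs W) = 7" using 1 length_lincomb[of W cs] by auto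
  \<comment> \<open>Dropping the first row of the table replaces \<open>q\<close> by
    \<open>q * u\<close>; this is why the induction generalizes \<open>q\<close>.\<close>
  have "bez 6 (\<lambda>k. of_int (lincomb cs W ! k)) s = q * u * poly1 cs u"
  proof (rule 1(1))
    show "\<forall>i<length W. bez 6 (\<lambda>k. of_int (W ! i ! k)) s = q * u * u ^ i"
    proof (intro allI impI)
      fix i assume "i < length W"
      then show "bez 6 (\<lambda>k. of_int (W ! i ! k)) s = q * u * u ^ i"
        using 1(4)[rule_format, of "Suc i"] by simp
    qed
  qed (use 1 in auto)
  moreover have "bez 6 (\<lambda>k. of_int (w ! k)) s = q"
    using 1(4) by (auto dest: spec[of _ 0])
  moreover have "bez 6 (\<lambda>k. of_int (lincomb (c # cs) (w # W) ! k)) s =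
      bez 6 (\<lambda>k. of_int c * of_int (w ! k) + of_int (lincomb cs W ! k)) s"
    using l by (intro bez_cong) auto
  ultimately show ?case by (simp add: bez_add bez_cmult algebra_simps)
qed (auto intro!: trans[OF bez_cong bez_const])

text \<open>The Bernstein sum in \<open>t\<close> and Horner evaluation in \<open>u\<close> are both
  linear in the coefficients, so they commute; the induction peels off one power of \<open>u\<close>
  at a time.\<close>

lemma bez_poly1_column:
  assumes "\<forall>r\<in>set N. length r = 7" "length M = length N"
    and "\<forall>i<length N. bez 6 (\<lambda>k. of_int (N ! i ! k)) t = q * poly1 (M ! i) v"
  shows "bez 6 (\<lambda>l. poly1 (map (\<lambda>r. r ! l) N) u) t = q * poly2 M u v"
  using assms(2,1,3)
proof (induction M N rule: list_induct2)
  case (Cons m M n N)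
  have "bez 6 (\<lambda>l. poly1 (map (\<lambda>r. r ! l) N) u) t = q * poly2 M u v"
  proof (rule Cons.IH)
    show "\<forall>i<length N. bez 6 (\<lambda>k. of_int (N ! i ! k)) t = q * poly1 (M ! i) v"
    proof (intro allI impI)
      fix i assume "i < length N"
      then show "bez 6 (\<lambda>k. of_int (N ! i ! k)) t = q * poly1 (M ! i) v"
        using Cons.prems(2)[rule_format, of "Suc i"] by simp
    qed
  qed (use Cons in auto)
  moreover have "bez 6 (\<lambda>k. of_int (n ! k)) t = q * poly1 m v"
    using Cons.prems by (auto dest: spec[of _ 0])
  ultimately show ?case by (simp add: bez_add bez_cmult algebra_simps)
qed simp

lemma bez2_bernstein:
  assumes W: "powers W1 q1 x h" "powers W2 q2 y w"
    and M: "length M = 7" "\<forall>r\<in>set M. length r \<le> 7"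
  shows "square7 (bernstein W1 W2 M) \<and>
    bez2 (\<lambda>k l. of_int (bernstein W1 W2 M ! k ! l)) s t = q1 * q2 * poly2 M (x + h * s) (y + w * t)"
proof -
  define N where "N = map (\<lambda>r. lincomb r W2) M"
  define N' where "N' = map (\<lambda>r. lincomb r W1) (flip N)"
  have sq: "length W1 = 7" "length W2 = 7" "\<forall>r\<in>set W1. length r = 7" "\<forall>r\<in>set W2. length r = 7"
    using W by (auto simp: powers_def square7_def)
  have N7: "square7 N" using M sq by (auto simp: N_def square7_def intro: length_lincomb)
  note fN = square7_flip[OF N7]
  have N'7: "square7 N'" using fN sq by (auto simp: N'_def square7_def intro: length_lincomb)
  have fl: "flip N ! l = map (\<lambda>r. r ! l) N" if "l < 7" for l
    using that nth_flip[OF N7] fN N7 by (auto simp: square7_def intro!: nth_equalityI)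
  have r1: "bez 6 (\<lambda>k. of_int (N' ! l ! k)) s = q1 * poly1 (flip N ! l) (x + h * s)" if "l < 7" for l
  proof -
    have "N' ! l = lincomb (flip N ! l) W1" "length (flip N ! l) = 7"
      using that fN by (auto simp: N'_def square7_def)
    then show ?thesis
      using bez_lincomb[of "flip N ! l" W1 s q1 "x + h * s"] W(1) sq by (auto simp: powers_def)
  qed
  have r2: "bez 6 (\<lambda>k. of_int (N ! i ! k)) t = q2 * poly1 (M ! i) (y + w * t)" if "i < 7" for i
  proof -
    have "N ! i = lincomb (M ! i) W2" "length (M ! i) \<le> 7"
      using that M by (auto simp: N_def)
    then show ?thesis
      using bez_lincomb[of "M ! i" W2 t q2 "y + w * t"] W(2) sq by (auto simp: powers_def)
  qed
  have "bez2 (\<lambda>k l. of_int (flip N' ! k ! l)) s t = bez 6 (\<lambda>l. bez 6 (\<lambda>k. of_int (flip N' ! k ! l)) s) t"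
    unfolding bez2_def by (rule bez_swap)
  also have "\<dots> = bez 6 (\<lambda>l. q1 * poly1 (map (\<lambda>r. r ! l) N) (x + h * s)) t"
  proof (rule bez_cong)
    fix l :: nat assume l: "l \<le> 6"
    have "bez 6 (\<lambda>k. of_int (flip N' ! k ! l)) s = bez 6 (\<lambda>k. of_int (N' ! l ! k)) s"
      using l nth_flip[OF N'7] by (intro bez_cong) auto
    then show "bez 6 (\<lambda>k. of_int (flip N' ! k ! l)) s = q1 * poly1 (map (\<lambda>r. r ! l) N) (x + h * s)"
      using r1[of l] fl[of l] l by simp
  qed
  also have "\<dots> = q1 * q2 * poly2 M (x + h * s) (y + w * t)"
    using bez_poly1_column[of N M t q2 "y + w * t" "x + h * s"] r2 N7 M
    by (simp add: bez_cmult square7_def)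
  finally show ?thesis
    using square7_flip[OF N'7] by (simp add: bernstein_def N_def N'_def)
qed

text \<open>Dropping \<open>m\<close> low bits keeps the integers short. On the rescaled polynomial
  the floor costs at most 1, which is the initial error in the calls of
  \<open>check\<close>.\<close>

lemma rep_bernstein:
  assumes W: "powers W1 q1 x h" "powers W2 q2 y w"
    and M: "length M = 7" "\<forall>r\<in>set M. length r \<le> 7"
  shows "rep 1 (map (map (drop_bit m)) (bernstein W1 W2 M))
     (\<lambda>s t. q1 * q2 / 2 ^ m * poly2 M (x + h * s) (y + w * t))"
proof -
  let ?A = "bernstein W1 W2 M"
  note b = bez2_bernstein[OF W M]
  have l: "length ?A = 7" "\<And>k. k < 7 \<Longrightarrow> length (?A ! k) = 7" using b by (auto simp: square7_def)
  have fl: "of_int (drop_bit m z) \<le> real_of_int z / 2 ^ m \<and> real_of_int z / 2 ^ m \<le> of_int (drop_bit m z) + 1" for z :: int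
  proof -
    have "of_int (drop_bit m z) = (of_int \<lfloor>real_of_int z / of_int (2 ^ m)\<rfloor> :: real)"
      by (simp only: floor_divide_of_int_eq drop_bit_eq_div)
    then show ?thesis by (simp add: real_of_int_floor_add_one_ge)
  qed
  show ?thesis
    unfolding rep_def
  proof (intro conjI exI[of _ "\<lambda>k l. of_int (?A ! k ! l) / 2 ^ m"] allI impI)
    show "square7 (map (map (drop_bit m)) ?A)" using b by (auto simp: square7_def)
    show "approx 1 (map (map (drop_bit m)) ?A ! k) (\<lambda>l. of_int (?A ! k ! l) / 2 ^ m)" if "k < 7" for k
      using that l fl by (auto simp: approx_def)
    show "q1 * q2 / 2 ^ m * poly2 M (x + h * s) (y + w * t) = bez2 (\<lambda>k l. of_int (?A ! k ! l) / 2 ^ m) s t" for s t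
      using b[of s t] bez2_lin[of "1 / 2 ^ m" "\<lambda>k l. of_int (?A ! k ! l)" 0 "\<lambda>k l. 0" s t] by simp
  qed
qed

lemma bez_6: "bez 6 f s = (1 - s) ^ 6 * f 0 + 6 * s * (1 - s) ^ 5 * f 1 + 15 * s ^ 2 * (1 - s) ^ 4 * f 2 +
    20 * s ^ 3 * (1 - s) ^ 3 * f 3 + 15 * s ^ 4 * (1 - s) ^ 2 * f 4 + 6 * s ^ 5 * (1 - s) * f 5 + s ^ 6 * f 6"
proof -
  have "bez 6 f s = (\<Sum>k\<in>{0,1,2,3,4,5,6}. real (6 choose k) * s ^ k * (1 - s) ^ (6 - k) * f k)"
    unfolding bez_def by (rule sum.cong) auto
  moreover have "(6::nat) choose 1 = 6" "(6::nat) choose 2 = 15" "(6::nat) choose 3 = 20"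
      "(6::nat) choose 4 = 15" "(6::nat) choose 5 = 6"
    by (simp_all add: numeral_eq_Suc)
  ultimately show ?thesis by simp
qed

lemma powers_I:
  assumes "square7 W"
    and "\<And>s. \<forall>i<7. bez 6 (\<lambda>k. of_int (W ! i ! k)) s = q * (x + h * s) ^ i"
  shows "powers W q x h"
  using assms by (auto simp: powers_def)

lemma all_less_7: "(\<forall>i<7. P i) \<longleftrightarrow> P 0 \<and> P 1 \<and> P 2 \<and> P 3 \<and> P 4 \<and> P 5 \<and> P (6 :: nat)"
  by (auto simp: numeral_nat All_less_Suc)

section \<open>Calculus of the p-power and persistence in p\<close>

definition dPhi :: "real \<Rightarrow> real \<Rightarrow> real" where
  "dPhi p t = (p - 1) * \<bar>t\<bar> powr (p - 2)"

lemma abs_powr_deriv: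
  assumes "q > 1"
  shows "((\<lambda>t. \<bar>t\<bar> powr q) has_real_derivative q * (\<bar>t\<bar> powr (q - 2) * t)) (at t)"
proof -
  consider "t > 0" | "t < 0" | "t = 0" by linarith
  then show ?thesis
  proof cases
    case 1
    have "((\<lambda>t. t powr q) has_real_derivative q * t powr (q - 1)) (at t)"
      using has_real_derivative_powr[OF 1] by simp
    moreover have "t powr (q - 1) = t powr (q - 2) * t"
      using powr_add[of t "q - 2" 1] 1 by simp
    moreover have "\<forall>\<^sub>F s in nhds t. \<bar>s\<bar> powr q = s powr q"
      by (rule eventually_nhds_in_open[of "{0<..}", THEN eventually_mono]) (use 1 in auto)
    ultimately show ?thesis
      using 1 DERIV_cong_ev[OF refl, of "\<lambda>s. \<bar>s\<bar> powr q" "\<lambda>s. s powr q" t] by simp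
  next
    case 2
    have "((\<lambda>t. (- t) powr q) has_real_derivative - (q * (- t) powr (q - 1))) (at t)"
      using 2 by (auto intro!: derivative_eq_intros simp: field_simps powr_diff)
    moreover have "(- t) powr (q - 1) = (- t) powr (q - 2) * (- t)"
      using powr_add[of "- t" "q - 2" 1] 2 by simp
    moreover have "\<forall>\<^sub>F s in nhds t. \<bar>s\<bar> powr q = (- s) powr q"
      by (rule eventually_nhds_in_open[of "{..<0}", THEN eventually_mono]) (use 2 in auto)
    ultimately show ?thesis
      using 2 DERIV_cong_ev[OF refl, of "\<lambda>s. \<bar>s\<bar> powr q" "\<lambda>s. (- s) powr q" t] by simp
  next
    \<comment> \<open>At the origin the difference quotient is bounded by
      \<open>\<bar>h\<bar> powr (q - 1)\<close>, which tends to 0 because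
      \<open>q > 1\<close>.\<close>
    case 3
    have "isCont (\<lambda>h::real. \<bar>h\<bar> powr (q - 1)) 0"
      using continuous_on_powr'[of UNIV "\<lambda>h::real. \<bar>h\<bar>" "\<lambda>_. q - 1"] assms
      by (simp add: continuous_on_eq_continuous_at continuous_on_rabs)
    then have "((\<lambda>h::real. \<bar>h\<bar> powr (q - 1)) \<longlongrightarrow> 0) (at 0)"
      by (simp add: isCont_def)
    moreover have "norm (\<bar>h\<bar> powr q / h) \<le> \<bar>h\<bar> powr (q - 1)" for h :: real
      using powr_add[of "\<bar>h\<bar>" "q - 1" 1] by (cases "h = 0") (auto simp: abs_mult field_simps)
    ultimately have "((\<lambda>h::real. \<bar>h\<bar> powr q / h) \<longlongrightarrow> 0) (at 0)"
      by (intro Lim_null_comparison[of "\<lambda>h. \<bar>h\<bar> powr q / h" "\<lambda>h. \<bar>h\<bar> powr (q - 1)"]) auto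
    then show ?thesis using 3 assms by (simp add: has_field_derivative_iff)
  qed
qed

lemma DERIV_abs_powr:
  "p > 2 \<Longrightarrow> ((\<lambda>t. \<bar>t\<bar> powr p) has_real_derivative p * Phi p t) (at t)"
  using abs_powr_deriv[of p t] by (simp add: Phi_def)

lemma DERIV_Phi:
  assumes "p > 2"
  shows "(Phi p has_real_derivative dPhi p t) (at t)"
proof (cases "t = 0")
  case False
  have "\<forall>\<^sub>F s in nhds t. Phi p s = \<bar>s\<bar> powr p / s"
    using powr_add[of "\<bar>_\<bar>" "p - 2" 2]
    by (intro eventually_nhds_in_open[of "- {0}", THEN eventually_mono])
       (use False in \<open>auto simp: Phi_def field_simps power2_eq_square\<close>)
  moreover have "((\<lambda>s. \<bar>s\<bar> powr p / s) has_real_derivative dPhi p t) (at t)"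
    using powr_add[of "\<bar>t\<bar>" "p - 2" 2] False
    by (intro DERIV_cong[OF DERIV_divide[OF DERIV_abs_powr[OF assms] DERIV_ident False]])
       (simp add: dPhi_def Phi_def field_simps power2_eq_square)
  ultimately show ?thesis
    using DERIV_cong_ev[OF refl, of "Phi p" "\<lambda>s. \<bar>s\<bar> powr p / s" t] by simp
next
  case True
  have "isCont (\<lambda>h::real. \<bar>h\<bar> powr (p - 2)) 0"
    using continuous_on_powr'[of UNIV "\<lambda>h::real. \<bar>h\<bar>" "\<lambda>_. p - 2"] assms
    by (simp add: continuous_on_eq_continuous_at continuous_on_rabs)
  then have "((\<lambda>h::real. \<bar>h\<bar> powr (p - 2)) \<longlongrightarrow> 0) (at 0)"
    by (simp add: isCont_def)
  moreover have "norm (Phi p h / h) \<le> \<bar>h\<bar> powr (p - 2)" for h :: real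
    by (auto simp: Phi_def)
  ultimately have "((\<lambda>h::real. Phi p h / h) \<longlongrightarrow> 0) (at 0)"
    by (intro Lim_null_comparison[of "\<lambda>h. Phi p h / h" "\<lambda>h. \<bar>h\<bar> powr (p - 2)"]) auto
  then show ?thesis using True assms by (simp add: has_field_derivative_iff dPhi_def Phi_def)
qed

lemma continuous_on_Phi [continuous_intros]:
  assumes "continuous_on S a" "continuous_on S b" "\<And>x. x \<in> S \<Longrightarrow> a x > 2"
  shows "continuous_on S (\<lambda>x. Phi (a x) (b x))"
  unfolding Phi_def using assms by (auto intro!: continuous_intros continuous_on_powr')

lemma continuous_on_dPhi [continuous_intros]:
  assumes "continuous_on S a" "continuous_on S b" "\<And>x. x \<in> S \<Longrightarrow> a x > 2"
  shows "continuous_on S (\<lambda>x. dPhi (a x) (b x))"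
  unfolding dPhi_def using assms by (auto intro!: continuous_intros continuous_on_powr')

lemma Phi_mult: "Phi p (c * t) = Phi p c * Phi p t"
  by (simp add: Phi_def abs_mult powr_mult)

lemma Phi_eq_0_iff [simp]: "Phi p t = 0 \<longleftrightarrow> t = 0"
  by (simp add: Phi_def)

lemma Phi_0 [simp]: "Phi p 0 = 0" and Phi_1 [simp]: "Phi p 1 = 1"
  by (simp_all add: Phi_def)

lemma Phi_4: "Phi 4 t = t ^ 3"
  by (cases "t = 0") (simp_all add: Phi_def powr_numeral power3_eq_cube power2_eq_square)

lemma dPhi_4: "dPhi 4 t = 3 * t ^ 2"
  by (cases "t = 0") (simp_all add: dPhi_def)

lemma mult_dPhi: "t * dPhi p t = (p - 1) * Phi p t"
  by (simp add: dPhi_def Phi_def)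

lemma dPhi_mult: "dPhi p (c * t) = \<bar>c\<bar> powr (p - 2) * dPhi p t"
  by (simp add: dPhi_def abs_mult powr_mult)

text \<open>The pairs violating the claim form a compact set; its projection to the parameter is
  compact and misses \<open>c\<close>, so a neighbourhood of \<open>c\<close> is free of violations.
  The premise \<open>f p y = 0\<close> allows \<open>g\<close> to be controlled on a moving zero set
  only.\<close>

lemma eventually_compact_param:
  fixes f g :: "real \<Rightarrow> 'a::metric_space \<Rightarrow> real"
  assumes K: "compact K" and lh: "lo < c" "c < hi"
    and f: "continuous_on ({lo..hi} \<times> K) (\<lambda>(p, y). f p y)"
    and g: "continuous_on ({lo..hi} \<times> K) (\<lambda>(p, y). g p y)"
    and c: "\<And>y. y \<in> K \<Longrightarrow> f c y = 0 \<Longrightarrow> 0 < g c y"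
  shows "\<forall>\<^sub>F p in nhds c. \<forall>y\<in>K. f p y = 0 \<longrightarrow> 0 < g p y"
proof -
  have KK: "compact ({lo..hi} \<times> K)" using K by (intro compact_Times) auto
  have "closedin (top_of_set ({lo..hi} \<times> K)) {z \<in> {lo..hi} \<times> K. (case z of (p, y) \<Rightarrow> f p y) = 0}"
    using continuous_closedin_preimage_constant[OF f, of 0] .
  moreover have "closedin (top_of_set ({lo..hi} \<times> K)) ({lo..hi} \<times> K \<inter> (\<lambda>(p, y). g p y) -` {..0})"
    using continuous_closedin_preimage[OF g closed_atMost] .
  ultimately have "compact ({z \<in> {lo..hi} \<times> K. (case z of (p, y) \<Rightarrow> f p y) = 0} \<inter> ({lo..hi} \<times> K \<inter> (\<lambda>(p, y). g p y) -` {..0}))"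
    (is "compact ?B") using KK closedin_compact by blast
  then have "compact (fst ` ?B)" by (intro compact_continuous_image continuous_intros)
  then have "open (- (fst ` ?B) \<inter> {lo<..<hi})" by (intro open_Int) (auto simp: compact_imp_closed)
  moreover have "c \<in> - (fst ` ?B) \<inter> {lo<..<hi}" using c lh by force
  ultimately show ?thesis
  proof (rule eventually_nhds_in_open[THEN eventually_mono])
    fix p assume p: "p \<in> - (fst ` ?B) \<inter> {lo<..<hi}"
    show "\<forall>y\<in>K. f p y = 0 \<longrightarrow> 0 < g p y"
    proof (intro ballI impI, rule ccontr)
      fix y assume "y \<in> K" "f p y = 0" "\<not> 0 < g p y"
      then have "(p, y) \<in> ?B" using p by auto
      then show False using p by force
    qed
  qed
qed

lemma eventually_compact_param_pos:
  fixes g :: "real \<Rightarrow> 'a::metric_space \<Rightarrow> real"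
  assumes "compact K" "lo < c" "c < hi" "continuous_on ({lo..hi} \<times> K) (\<lambda>(p, y). g p y)"
    and "\<And>y. y \<in> K \<Longrightarrow> 0 < g c y"
  shows "\<forall>\<^sub>F p in nhds c. \<forall>y\<in>K. 0 < g p y"
  using eventually_compact_param[OF assms(1-3), of "\<lambda>_ _. 0" g] assms(4,5) by (simp add: case_prod_unfold)

text \<open>Poincare-Miranda: clamp \<open>z - G z\<close> to the rectangle and apply Brouwer.\<close>

lemma rectangle_zero_exists:
  fixes G1 G2 :: "real \<Rightarrow> real \<Rightarrow> real"
  assumes h: "h > 0" and k: "k > 0"
    and c1: "continuous_on (cbox (x, y) (x + h, y + k)) (\<lambda>(u, v). G1 u v)"
    and c2: "continuous_on (cbox (x, y) (x + h, y + k)) (\<lambda>(u, v). G2 u v)"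
    and l: "\<And>v. v \<in> {y..y + k} \<Longrightarrow> G1 x v < 0" and r: "\<And>v. v \<in> {y..y + k} \<Longrightarrow> 0 < G1 (x + h) v"
    and b: "\<And>u. u \<in> {x..x + h} \<Longrightarrow> G2 u y < 0" and t: "\<And>u. u \<in> {x..x + h} \<Longrightarrow> 0 < G2 u (y + k)"
  shows "\<exists>u v. u \<in> {x..x + h} \<and> v \<in> {y..y + k} \<and> G1 u v = 0 \<and> G2 u v = 0"
proof -
  let ?K = "cbox (x, y) (x + h, y + k)"
  define f where "f = (\<lambda>z. (max x (min (x + h) (fst z - (case z of (u, v) \<Rightarrow> G1 u v))),
      max y (min (y + k) (snd z - (case z of (u, v) \<Rightarrow> G2 u v)))))"
  have "continuous_on ?K f" unfolding f_def by (intro continuous_intros c1 c2)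
  moreover have "f ` ?K \<subseteq> ?K" using h k by (auto simp: f_def cbox_Pair_eq)
  moreover have "?K \<noteq> {}" using h k by (simp add: cbox_Pair_eq)
  ultimately obtain z where z: "z \<in> ?K" "f z = z"
    using brouwer[of ?K f] by (auto simp: image_subset_iff_funcset)
  obtain u v where uv: "z = (u, v)" by force
  have m: "u \<in> {x..x + h}" "v \<in> {y..y + k}" using z uv by (auto simp: cbox_Pair_eq)
  have e: "max x (min (x + h) (u - G1 u v)) = u" "max y (min (y + k) (v - G2 u v)) = v"
    using z uv by (auto simp: f_def)
  \<comment> \<open>In the interior the clamp is inactive at a fixed point, so \<open>G1\<close>
    vanishes. On a vertical side the sign of \<open>G1\<close> would move the point strictly
    inwards, so no fixed point lies there.\<close>
  have "G1 u v = 0"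
  proof (cases "u = x \<or> u = x + h")
    case True
    then show ?thesis using e(1) l[OF m(2)] r[OF m(2)] h by (auto simp: max_def min_def split: if_splits)
  next
    case False
    then show ?thesis using e(1) m by (auto simp: max_def min_def split: if_splits)
  qed
  moreover have "G2 u v = 0"
  proof (cases "v = y \<or> v = y + k")
    case True
    then show ?thesis using e(2) b[OF m(1)] t[OF m(1)] k by (auto simp: max_def min_def split: if_splits)
  next
    case False
    then show ?thesis using e(2) m by (auto simp: max_def min_def split: if_splits)
  qed
  ultimately show ?thesis using m by blast
qed

text \<open>The displacement between two zeros is measured in units of the sides. The mean value
  theorem is applied to the row belonging to the larger scaled component: there the diagonal term
  outweighs the other one, so the two values cannot agree.\<close>

lemma rectangle_zero_unique:
  fixes G1 G2 P1 P2 Q1 Q2 :: "real \<Rightarrow> real \<Rightarrow> real"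
  assumes d1: "\<And>u v du dv \<theta>. ((\<lambda>\<theta>. G1 (u + \<theta> * du) (v + \<theta> * dv)) has_real_derivative
        P1 (u + \<theta> * du) (v + \<theta> * dv) * du + P2 (u + \<theta> * du) (v + \<theta> * dv) * dv) (at \<theta>)"
    and d2: "\<And>u v du dv \<theta>. ((\<lambda>\<theta>. G2 (u + \<theta> * du) (v + \<theta> * dv)) has_real_derivative
        Q1 (u + \<theta> * du) (v + \<theta> * dv) * du + Q2 (u + \<theta> * du) (v + \<theta> * dv) * dv) (at \<theta>)"
    and h: "h > 0" and k: "k > 0"
    and dom1: "\<And>u v. u \<in> {x..x + h} \<Longrightarrow> v \<in> {y..y + k} \<Longrightarrow> \<bar>P2 u v\<bar> * k < P1 u v * h"
    and dom2: "\<And>u v. u \<in> {x..x + h} \<Longrightarrow> v \<in> {y..y + k} \<Longrightarrow> \<bar>Q1 u v\<bar> * h < Q2 u v * k"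
    and in1: "u1 \<in> {x..x + h}" "v1 \<in> {y..y + k}" "G1 u1 v1 = 0" "G2 u1 v1 = 0"
    and in2: "u2 \<in> {x..x + h}" "v2 \<in> {y..y + k}" "G1 u2 v2 = 0" "G2 u2 v2 = 0"
  shows "u1 = u2 \<and> v1 = v2"
proof -
  define a where "a = (u2 - u1) / h"
  define b where "b = (v2 - v1) / k"
  have ab: "u2 = u1 + a * h" "v2 = v1 + b * k" using h k by (auto simp: a_def b_def)
  have seg: "u1 + \<theta> * (a * h) \<in> {x..x + h}" "v1 + \<theta> * (b * k) \<in> {y..y + k}" if "0 < \<theta>" "\<theta> < 1" for \<theta>
  proof -
    have "u1 + \<theta> * (a * h) = (1 - \<theta>) * u1 + \<theta> * u2" "v1 + \<theta> * (b * k) = (1 - \<theta>) * v1 + \<theta> * v2"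
      by (simp_all add: ab algebra_simps)
    moreover have "(1 - \<theta>) *\<^sub>R u1 + \<theta> *\<^sub>R u2 \<in> {x..x + h}" "(1 - \<theta>) *\<^sub>R v1 + \<theta> *\<^sub>R v2 \<in> {y..y + k}"
      using that in1 in2 convexD_alt[OF convex_real_interval(5)] by (smt (verit))+
    ultimately show "u1 + \<theta> * (a * h) \<in> {x..x + h}" "v1 + \<theta> * (b * k) \<in> {y..y + k}" by auto
  qed
  have small: "\<bar>P2 * (b * k)\<bar> < P1 * \<bar>a\<bar> * h" if "\<bar>b\<bar> \<le> \<bar>a\<bar>" "a \<noteq> 0" "\<bar>P2\<bar> * k < P1 * h" "k > 0" for a b P1 P2 h k :: real
  proof -
    have "\<bar>P2 * (b * k)\<bar> = \<bar>b\<bar> * (\<bar>P2\<bar> * k)" using that by (simp add: abs_mult)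
    also have "\<dots> \<le> \<bar>a\<bar> * (\<bar>P2\<bar> * k)" using that by (intro mult_right_mono) auto
    also have "\<dots> < \<bar>a\<bar> * (P1 * h)" using that by (intro mult_strict_left_mono) auto
    finally show ?thesis by (simp add: algebra_simps)
  qed
  have "a = 0 \<and> b = 0"
  proof (rule ccontr)
    assume n: "\<not> (a = 0 \<and> b = 0)"
    show False
    proof (cases "\<bar>b\<bar> \<le> \<bar>a\<bar>")
      case True
      obtain \<theta> where \<theta>: "0 < \<theta>" "\<theta> < 1" "G1 u2 v2 - G1 u1 v1 =
          P1 (u1 + \<theta> * (a * h)) (v1 + \<theta> * (b * k)) * (a * h) + P2 (u1 + \<theta> * (a * h)) (v1 + \<theta> * (b * k)) * (b * k)"
        using MVT2[of 0 1 "\<lambda>\<theta>. G1 (u1 + \<theta> * (a * h)) (v1 + \<theta> * (b * k))", OF _ d1] by (auto simp: ab)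
      have "\<bar>P2 (u1 + \<theta> * (a * h)) (v1 + \<theta> * (b * k)) * (b * k)\<bar> < P1 (u1 + \<theta> * (a * h)) (v1 + \<theta> * (b * k)) * \<bar>a\<bar> * h"
        using True n \<theta> k by (intro small dom1 seg) auto
      then show False using \<theta>(3) in1 in2 h by (cases "a \<ge> 0") (auto simp: algebra_simps abs_if split: if_splits)
    next
      case False
      obtain \<theta> where \<theta>: "0 < \<theta>" "\<theta> < 1" "G2 u2 v2 - G2 u1 v1 =
          Q1 (u1 + \<theta> * (a * h)) (v1 + \<theta> * (b * k)) * (a * h) + Q2 (u1 + \<theta> * (a * h)) (v1 + \<theta> * (b * k)) * (b * k)"
        using MVT2[of 0 1 "\<lambda>\<theta>. G2 (u1 + \<theta> * (a * h)) (v1 + \<theta> * (b * k))", OF _ d2] by (auto simp: ab)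
      have "\<bar>Q1 (u1 + \<theta> * (a * h)) (v1 + \<theta> * (b * k)) * (a * h)\<bar> < Q2 (u1 + \<theta> * (a * h)) (v1 + \<theta> * (b * k)) * \<bar>b\<bar> * k"
        using False n \<theta> h by (intro small dom2 seg) auto
      then show False using \<theta>(3) in1 in2 h by (cases "b \<ge> 0") (auto simp: algebra_simps abs_if split: if_splits)
    qed
  qed
  then show ?thesis using ab by simp
qed

section \<open>The eigenproblem in a chart\<close>

definition wt :: "3 \<Rightarrow> 3 \<Rightarrow> real" where "wt = edge_weight signed_triangle"
definition pot :: "3 \<Rightarrow> real" where "pot i = potential signed_triangle $ i"
definition ms :: "3 \<Rightarrow> real" where "ms i = mass signed_triangle $ i"

lemma wt_sym: "wt i j = wt j i"
  by (simp add: wt_def signed_triangle_def insert_commute)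

lemma wt_simps [simp]:
  "wt 1 2 = 8739145" "wt 1 3 = 3903820" "wt 2 3 = 8576922"
  "wt 2 1 = 8739145" "wt 3 1 = 3903820" "wt 3 2 = 8576922"
  by (auto simp: wt_def signed_triangle_def doubleton_eq_iff)

lemma pot_simps [simp]: "pot 1 = -3969860" "pot 2 = -8425563" "pot 3 = 20915687727748"
  by (simp_all add: pot_def signed_triangle_def)

lemma ms_simps [simp]: "ms 1 = 12411" "ms 2 = 482" "ms 3 = 20915691304489"
  by (simp_all add: ms_def signed_triangle_def)

lemma ms_pos: "ms i > 0"
  using exhaust_3[of i] by auto

definition perm3 :: "3 \<Rightarrow> 3 \<Rightarrow> 3 \<Rightarrow> bool" where
  "perm3 i j k \<longleftrightarrow> i \<noteq> j \<and> i \<noteq> k \<and> j \<noteq> k"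

lemma perm3_cases:
  assumes "perm3 i j k"
  shows "(i, j, k) \<in> {(1, 2, 3), (1, 3, 2), (2, 1, 3), (2, 3, 1), (3, 1, 2), (3, 2, 1)}"
  using assms exhaust_3[of i] exhaust_3[of j] exhaust_3[of k] by (auto simp: perm3_def)

lemma perm3_all: "perm3 i j k \<Longrightarrow> (\<forall>m. P m) \<longleftrightarrow> P i \<and> P j \<and> P k"
  using perm3_cases[of i j k] by (auto simp: forall_3)

lemma perm3_UNIV: "perm3 i j k \<Longrightarrow> UNIV - {i} = {j, k}"
  using perm3_all[of i j k "\<lambda>m. m \<in> {i, j, k}"] by (auto simp: perm3_def)

definition Ef :: "real \<Rightarrow> 3 \<Rightarrow> 3 \<Rightarrow> 3 \<Rightarrow> real \<Rightarrow> real \<Rightarrow> real \<Rightarrow> real" where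
  "Ef p i j k x y z = wt i j * Phi p (x + y) + wt i k * Phi p (x + z) + pot i * Phi p x"

text \<open>\<open>Ef\<close> is the left-hand side of the equation at vertex \<open>i\<close>; \<open>Fc\<close> results from eliminating the spectral value
  between the equations at \<open>i\<close> and \<open>k\<close>, where the coordinate at \<open>k\<close> is \<open>1\<close>.\<close>

definition Fc :: "real \<Rightarrow> 3 \<Rightarrow> 3 \<Rightarrow> 3 \<Rightarrow> real \<Rightarrow> real \<Rightarrow> real" where
  "Fc p i j k u v = ms k * Ef p i j k u v 1 - ms i * Ef p k i j 1 u v * Phi p u"

definition lam :: "real \<Rightarrow> 3 \<Rightarrow> 3 \<Rightarrow> 3 \<Rightarrow> real \<Rightarrow> real \<Rightarrow> real" where
  "lam p i j k u v = Ef p k i j 1 u v / ms k"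

definition cpt :: "3 \<Rightarrow> 3 \<Rightarrow> 3 \<Rightarrow> real \<Rightarrow> real \<Rightarrow> real ^ 3" where
  "cpt i j k u v = (\<chi> m. if m = i then u else if m = j then v else 1)"

lemma cpt_nth:
  assumes "perm3 i j k"
  shows "cpt i j k u v $ i = u" "cpt i j k u v $ j = v" "cpt i j k u v $ k = 1"
  using assms by (auto simp: cpt_def perm3_def)

lemma eigenpair_iff_all:
  "eigenpair p signed_triangle x l \<longleftrightarrow> x \<noteq> 0 \<and>
     (\<forall>i. (\<Sum>j\<in>UNIV - {i}. wt i j * Phi p (x $ i + x $ j)) + pot i * Phi p (x $ i) = l * ms i * Phi p (x $ i))"
  by (simp add: eigenpair_def wt_def pot_def ms_def) (simp add: signed_triangle_def)

lemma eigenpair_iff: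
  assumes "perm3 i j k"
  shows "eigenpair p signed_triangle x l \<longleftrightarrow> x \<noteq> 0 \<and>
    Ef p i j k (x $ i) (x $ j) (x $ k) = l * ms i * Phi p (x $ i) \<and>
    Ef p j i k (x $ j) (x $ i) (x $ k) = l * ms j * Phi p (x $ j) \<and>
    Ef p k i j (x $ k) (x $ i) (x $ j) = l * ms k * Phi p (x $ k)"
proof -
  have "UNIV - {j} = {i, k}" "UNIV - {k} = {i, j}" "UNIV - {i} = {j, k}"
    using perm3_UNIV[of i j k] perm3_UNIV[of j i k] perm3_UNIV[of k i j] assms by (auto simp: perm3_def)
  then show ?thesis
    unfolding eigenpair_iff_all perm3_all[OF assms]
    using assms by (simp add: Ef_def perm3_def)
qed

lemma Ef_scale: "Ef p i j k (c * x) (c * y) (c * z) = Phi p c * Ef p i j k x y z"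
  by (simp add: Ef_def Phi_mult flip: distrib_left) (simp add: algebra_simps)

lemma eigenpair_scale:
  assumes "c \<noteq> 0" "eigenpair p signed_triangle x l"
  shows "eigenpair p signed_triangle (c *\<^sub>R x) l"
  using assms unfolding eigenpair_iff[of 1 2 3, unfolded perm3_def, simplified]
  by (simp add: Ef_scale Phi_mult)

lemma vec3_eq:
  assumes "perm3 i j k"
  shows "(x :: real ^ 3) = y \<longleftrightarrow> x $ i = y $ i \<and> x $ j = y $ j \<and> x $ k = y $ k"
  unfolding vec_eq_iff perm3_all[OF assms] ..

lemma cpt_normalize:
  assumes "perm3 i j k" "x $ k \<noteq> 0"
  shows "x = x $ k *\<^sub>R cpt i j k (x $ i / x $ k) (x $ j / x $ k)"
  using assms by (simp add: vec3_eq[OF assms(1)] cpt_nth)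

text \<open>Since the coordinate at \<open>k\<close> is 1 and \<open>ms k\<close> is nonzero, the
  equation at \<open>k\<close> merely determines \<open>l\<close>; substituting it into the other
  two equations leaves the two values of \<open>Fc\<close>.\<close>

lemma eigenpair_cpt_iff:
  assumes p3: "perm3 i j k"
  shows "eigenpair p signed_triangle (cpt i j k u v) l \<longleftrightarrow>
     Fc p i j k u v = 0 \<and> Fc p j i k v u = 0 \<and> l = lam p i j k u v"
proof -
  have "cpt i j k u v \<noteq> 0"
    using cpt_nth(3)[OF p3, of u v] by auto
  moreover have "ms k \<noteq> 0" using ms_pos[of k] by simp
  moreover have "Ef p k j i 1 v u = Ef p k i j 1 u v" by (simp add: Ef_def)
  moreover have "l = lam p i j k u v \<longleftrightarrow> Ef p k i j 1 u v = l * ms k"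
    using \<open>ms k \<noteq> 0\<close> by (auto simp: lam_def)
  moreover have "Fc p i j k u v = ms k * (Ef p i j k u v 1 - l * ms i * Phi p u)"
    "Fc p j i k v u = ms k * (Ef p j i k v u 1 - l * ms j * Phi p v)" if "Ef p k i j 1 u v = l * ms k"
    using that \<open>Ef p k j i 1 v u = Ef p k i j 1 u v\<close> by (simp_all add: Fc_def algebra_simps)
  ultimately show ?thesis
    unfolding eigenpair_iff[OF p3] by (auto simp: cpt_nth[OF p3])
qed

lemma eigenpair_chart:
  assumes "perm3 i j k" "x $ k \<noteq> 0" "u = x $ i / x $ k" "v = x $ j / x $ k"
  shows "eigenpair p signed_triangle x l \<longleftrightarrow>
     Fc p i j k u v = 0 \<and> Fc p j i k v u = 0 \<and> l = lam p i j k u v"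
proof -
  have "eigenpair p signed_triangle x l \<longleftrightarrow> eigenpair p signed_triangle (cpt i j k u v) l"
    using eigenpair_scale[of "x $ k" p "cpt i j k u v" l] eigenpair_scale[of "1 / x $ k" p x l]
      cpt_normalize[OF assms(1,2)] assms(2-) by (metis (no_types, lifting) divide_eq_0_iff scaleR_one scaleR_scaleR nonzero_eq_divide_eq one_neq_zero)
  then show ?thesis using eigenpair_cpt_iff[OF assms(1)] by simp
qed

definition dFu :: "real \<Rightarrow> 3 \<Rightarrow> 3 \<Rightarrow> 3 \<Rightarrow> real \<Rightarrow> real \<Rightarrow> real" where
  "dFu p i j k u v = ms k * (wt i j * dPhi p (u + v) + wt i k * dPhi p (u + 1) + pot i * dPhi p u)
     - ms i * (wt k i * dPhi p (1 + u) * Phi p u + Ef p k i j 1 u v * dPhi p u)"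

definition dFv :: "real \<Rightarrow> 3 \<Rightarrow> 3 \<Rightarrow> 3 \<Rightarrow> real \<Rightarrow> real \<Rightarrow> real" where
  "dFv p i j k u v = ms k * wt i j * dPhi p (u + v) - ms i * wt k j * dPhi p (1 + v) * Phi p u"

lemma DERIV_Phi_chain:
  assumes "p > 2" "(f has_real_derivative f') (at t)"
  shows "((\<lambda>t. Phi p (f t)) has_real_derivative dPhi p (f t) * f') (at t)"
  using DERIV_chain2[OF DERIV_Phi[OF assms(1)] assms(2)] .

lemma DERIV_Fc:
  assumes "p > 2"
  shows "((\<lambda>\<theta>. Fc p i j k (u + \<theta> * du) (v + \<theta> * dv)) has_real_derivative
     dFu p i j k (u + \<theta> * du) (v + \<theta> * dv) * du + dFv p i j k (u + \<theta> * du) (v + \<theta> * dv) * dv) (at \<theta>)"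
  unfolding Fc_def Ef_def
  by (rule derivative_eq_intros DERIV_Phi_chain[OF assms] refl)+
     (simp add: dFu_def dFv_def Ef_def algebra_simps)

lemma continuous_on_Ef [continuous_intros]:
  assumes "continuous_on S a" "continuous_on S b" "continuous_on S c" "continuous_on S d" "\<And>x. x \<in> S \<Longrightarrow> a x > 2"
  shows "continuous_on S (\<lambda>x. Ef (a x) i j k (b x) (c x) (d x))"
  using assms unfolding Ef_def by (auto intro!: continuous_intros)

lemma continuous_on_Fc [continuous_intros]:
  assumes "continuous_on S a" "continuous_on S b" "continuous_on S c" "\<And>x. x \<in> S \<Longrightarrow> a x > 2"
  shows "continuous_on S (\<lambda>x. Fc (a x) i j k (b x) (c x))"
    and "continuous_on S (\<lambda>x. lam (a x) i j k (b x) (c x))"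
    and "continuous_on S (\<lambda>x. dFu (a x) i j k (b x) (c x))"
    and "continuous_on S (\<lambda>x. dFv (a x) i j k (b x) (c x))"
  using assms ms_pos[THEN less_imp_neq, THEN not_sym] unfolding Fc_def lam_def dFu_def dFv_def
  by (auto intro!: continuous_intros)

text \<open>The Hessian, up to a positive factor, of the Rayleigh quotient in the chart \<open>x $ k = 1\<close>.\<close>

definition Hd :: "real \<Rightarrow> 3 \<Rightarrow> 3 \<Rightarrow> 3 \<Rightarrow> real \<Rightarrow> real \<Rightarrow> real" where
  "Hd p i j k u v = wt i j * dPhi p (u + v) + wt i k * dPhi p (u + 1) + (pot i - lam p i j k u v * ms i) * dPhi p u"

definition Ho :: "real \<Rightarrow> 3 \<Rightarrow> 3 \<Rightarrow> real \<Rightarrow> real \<Rightarrow> real" where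
  "Ho p i j u v = wt i j * dPhi p (u + v)"

lemma lam_swap: "lam p j i k v u = lam p i j k u v"
  by (simp add: lam_def Ef_def)

text \<open>Euler's identity: the residual of the equation at \<open>i\<close> is homogeneous of
  degree p - 1 in all three coordinates, so its gradient paired with (u, v, 1) is p - 1 times the
  residual, which is 0 here.\<close>

lemma Fc_homogeneity:
  assumes "Fc p i j k u v = 0"
  shows "u * Hd p i j k u v + v * Ho p i j u v + wt i k * dPhi p (u + 1) = 0"
proof -
  have "ms k * (Ef p i j k u v 1 - lam p i j k u v * ms i * Phi p u) = 0"
    using assms ms_pos[of k] by (simp add: Fc_def lam_def algebra_simps)
  then have "Ef p i j k u v 1 - lam p i j k u v * ms i * Phi p u = 0"
    using ms_pos[of k] by simp
  moreover have "u * Hd p i j k u v + v * Ho p i j u v + wt i k * dPhi p (u + 1) =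
      wt i j * ((u + v) * dPhi p (u + v)) + wt i k * ((u + 1) * dPhi p (u + 1)) +
      (pot i - lam p i j k u v * ms i) * (u * dPhi p u)"
    by (simp add: Hd_def Ho_def algebra_simps)
  then have "u * Hd p i j k u v + v * Ho p i j u v + wt i k * dPhi p (u + 1) =
      (p - 1) * (Ef p i j k u v 1 - lam p i j k u v * ms i * Phi p u)"
    by (simp only: mult_dPhi) (simp add: Ef_def algebra_simps)
  ultimately show ?thesis by simp
qed

text \<open>Let H be the symmetric matrix with entries \<open>a\<close>, \<open>b\<close>,
  \<open>c\<close>, and put m = \<open>ms k\<close>, y = (\<open>u\<close>, \<open>v\<close>), z =
  (\<open>q\<close>, \<open>r\<close>). By homogeneity the edge terms towards \<open>k\<close> equal
  -H y, so the Jacobian is (m I + z y^T) H. The rank-one determinant formula gives det (m I + z y^T)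
  = m (m + y.z), a positive number.\<close>

lemma jacobian_hessian:
  assumes "Fc p i j k u v = 0" "Fc p j i k v u = 0"
  shows "dFu p i j k u v * dFu p j i k v u - dFv p i j k u v * dFv p j i k v u =
    ms k * (ms k + ms i * (u * Phi p u) + ms j * (v * Phi p v)) *
    (Hd p i j k u v * Hd p j i k v u - (Ho p i j u v)\<^sup>2)"
proof -
  have k: "ms k \<noteq> 0" using ms_pos[of k] by simp
  define a where "a = Hd p i j k u v"
  define b where "b = Ho p i j u v"
  define c where "c = Hd p j i k v u"
  define q where "q = ms i * Phi p u"
  define r where "r = ms j * Phi p v"
  have b': "Ho p j i v u = b" by (simp add: b_def Ho_def wt_sym[of j i] add.commute)
  have hi: "wt i k * dPhi p (u + 1) = - (u * a + v * b)"
    using Fc_homogeneity[OF assms(1)] by (simp add: a_def b_def)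
  have hj: "wt j k * dPhi p (v + 1) = - (v * c + u * b)"
    using Fc_homogeneity[OF assms(2)] by (simp add: c_def b')
  have Ek: "Ef p k i j 1 u v = ms k * lam p i j k u v" "Ef p k j i 1 v u = ms k * lam p i j k u v"
    using k by (simp_all add: lam_def Ef_def)
  have "dFu p i j k u v = ms k * a - q * (wt i k * dPhi p (u + 1))"
    unfolding dFu_def Ek by (simp add: a_def q_def Hd_def wt_sym[of k i] algebra_simps)
  moreover have "dFu p j i k v u = ms k * c - r * (wt j k * dPhi p (v + 1))"
    unfolding dFu_def Ek by (simp add: c_def r_def Hd_def wt_sym[of k j] lam_swap[of p j i] algebra_simps)
  moreover have "dFv p i j k u v = ms k * b - q * (wt j k * dPhi p (v + 1))"
    unfolding dFv_def by (simp add: b_def q_def Ho_def wt_sym[of k j] algebra_simps)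
  moreover have "dFv p j i k v u = ms k * b - r * (wt i k * dPhi p (u + 1))"
    unfolding dFv_def by (simp add: b'[symmetric] r_def Ho_def wt_sym[of k i] algebra_simps)
  moreover have "ms k + ms i * (u * Phi p u) + ms j * (v * Phi p v) = ms k + u * q + v * r"
    by (simp add: q_def r_def)
  ultimately show ?thesis
    unfolding hi hj a_def [symmetric] b_def [symmetric] c_def [symmetric]
    by (simp only:) (simp add: algebra_simps power2_eq_square)
qed

lemma DERIV_Fc_u: "p > 2 \<Longrightarrow> ((\<lambda>u. Fc p i j k u v) has_real_derivative dFu p i j k u v) (at u)"
  and DERIV_Fc_v: "p > 2 \<Longrightarrow> ((\<lambda>v. Fc p i j k u v) has_real_derivative dFv p i j k u v) (at v)"
  using DERIV_Fc[of p i j k 0 1 v 0 u] DERIV_Fc[of p i j k u 0 0 1 v] by simp_all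

text \<open>\<open>dominant\<close> speaks of arbitrary derivatives, so it can be instantiated with
  \<open>dFu\<close> and \<open>dFv\<close>, which are jointly continuous in the exponent and the
  point. The exponent range from 3 to 5 only has to be compact, lie above 2 and have 4 in its
  interior. \<kappa>1 and \<kappa>2 are the scalings of the Bernstein tables.\<close>

lemma dominant_near:
  assumes dom: "dominant (\<lambda>u v. \<kappa>1 * Fc 4 i j k u v) (\<lambda>u v. \<kappa>2 * Fc 4 j i k v u) (x, h, y, w) c d"
    and pos: "h > 0" "w > 0"
  defines "\<alpha> \<equiv> of_int c * \<kappa>1" and "\<beta> \<equiv> of_int d * \<kappa>2"
  shows "\<forall>\<^sub>F p in nhds 4.
     (\<forall>u v. in_box (x, h, y, w) u v \<longrightarrow>
        \<bar>\<alpha> * dFv p i j k u v + \<beta> * dFu p j i k v u\<bar> * w < (\<alpha> * dFu p i j k u v + \<beta> * dFv p j i k v u) * h) \<and>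
     (\<forall>v\<in>{y..y + w}. \<alpha> * Fc p i j k x v + \<beta> * Fc p j i k v x < 0) \<and>
     (\<forall>v\<in>{y..y + w}. 0 < \<alpha> * Fc p i j k (x + h) v + \<beta> * Fc p j i k v (x + h))"
proof -
  let ?K = "{x..x + h} \<times> {y..y + w}"
  have K: "compact ?K" by (intro compact_Times) auto
  have d1: "((\<lambda>u. \<kappa>1 * Fc 4 i j k u v) has_real_derivative \<kappa>1 * dFu 4 i j k u v) (at u)"
    "((\<lambda>v. \<kappa>1 * Fc 4 i j k u v) has_real_derivative \<kappa>1 * dFv 4 i j k u v) (at v)"
    "((\<lambda>u. \<kappa>2 * Fc 4 j i k v u) has_real_derivative \<kappa>2 * dFv 4 j i k v u) (at u)"
    "((\<lambda>v. \<kappa>2 * Fc 4 j i k v u) has_real_derivative \<kappa>2 * dFu 4 j i k v u) (at v)" for u v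
    by (intro DERIV_cmult DERIV_Fc_u DERIV_Fc_v; simp)+
  have D: "\<bar>\<alpha> * dFv 4 i j k u v + \<beta> * dFu 4 j i k v u\<bar> * w < (\<alpha> * dFu 4 i j k u v + \<beta> * dFv 4 j i k v u) * h"
    if "in_box (x, h, y, w) u v" for u v
    using dom that d1 unfolding dominant_def prod.case \<alpha>_def \<beta>_def mult.assoc by blast
  have "\<forall>\<^sub>F p in nhds 4. \<forall>z\<in>?K.
     0 < (\<alpha> * dFu p i j k (fst z) (snd z) + \<beta> * dFv p j i k (snd z) (fst z)) * h -
       \<bar>\<alpha> * dFv p i j k (fst z) (snd z) + \<beta> * dFu p j i k (snd z) (fst z)\<bar> * w"
    by (rule eventually_compact_param_pos[OF K, of 3 4 5])
       (use D in \<open>auto simp: case_prod_unfold in_box_def intro!: continuous_intros\<close>)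
  moreover have "\<forall>\<^sub>F p in nhds 4. \<forall>v\<in>{y..y + w}. 0 < - (\<alpha> * Fc p i j k x v + \<beta> * Fc p j i k v x)"
    by (rule eventually_compact_param_pos[OF compact_Icc, of 3 4 5])
       (use dom pos in \<open>auto simp: case_prod_unfold in_box_def dominant_def \<alpha>_def \<beta>_def mult.assoc intro!: continuous_intros\<close>)
  moreover have "\<forall>\<^sub>F p in nhds 4. \<forall>v\<in>{y..y + w}. 0 < \<alpha> * Fc p i j k (x + h) v + \<beta> * Fc p j i k v (x + h)"
    by (rule eventually_compact_param_pos[OF compact_Icc, of 3 4 5])
       (use dom pos in \<open>auto simp: case_prod_unfold in_box_def dominant_def \<alpha>_def \<beta>_def mult.assoc intro!: continuous_intros\<close>)
  ultimately show ?thesis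
    by eventually_elim (auto simp: in_box_def)
qed

text \<open>Multiplying the two dominance inequalities makes the determinant of the preconditioned
  Jacobian positive. It equals \<kappa>1 \<kappa>2 times the integer determinant of the
  preconditioner times the Jacobian determinant, so the last two factors have equal signs. Strict
  edge signs keep the zero off the boundary.\<close>

lemma solvable_near:
  fixes x h y w :: real
  assumes sol: "solvable (\<lambda>u v. \<kappa>1 * Fc 4 i j k u v) (\<lambda>u v. \<kappa>2 * Fc 4 j i k v u) (x, h, y, w) (c11, c12, c21, c22)"
    and pos: "h > 0" "w > 0" "\<kappa>1 > 0" "\<kappa>2 > 0"
  shows "\<forall>\<^sub>F p in nhds 4.
     (\<exists>u v. in_box (x, h, y, w) u v \<and> Fc p i j k u v = 0 \<and> Fc p j i k v u = 0) \<and>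
     (\<forall>u v. in_box (x, h, y, w) u v \<longrightarrow> Fc p i j k u v = 0 \<longrightarrow> Fc p j i k v u = 0 \<longrightarrow>
        x < u \<and> u < x + h \<and> y < v \<and> v < y + w) \<and>
     (\<forall>u v u' v'. in_box (x, h, y, w) u v \<longrightarrow> Fc p i j k u v = 0 \<longrightarrow> Fc p j i k v u = 0 \<longrightarrow>
        in_box (x, h, y, w) u' v' \<longrightarrow> Fc p i j k u' v' = 0 \<longrightarrow> Fc p j i k v' u' = 0 \<longrightarrow> u = u' \<and> v = v') \<and>
     (\<forall>u v. in_box (x, h, y, w) u v \<longrightarrow>
        0 < of_int (c11 * c22 - c12 * c21) * (dFu p i j k u v * dFu p j i k v u - dFv p i j k u v * dFv p j i k v u))"
proof -
  define \<alpha> where "\<alpha> = of_int c11 * \<kappa>1"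
  define \<beta> where "\<beta> = of_int c12 * \<kappa>2"
  define \<gamma> where "\<gamma> = of_int c21 * \<kappa>1"
  define \<delta> where "\<delta> = of_int c22 * \<kappa>2"
  have s1: "dominant (\<lambda>u v. \<kappa>1 * Fc 4 i j k u v) (\<lambda>u v. \<kappa>2 * Fc 4 j i k v u) (x, h, y, w) c11 c12"
    using sol by (simp add: solvable_def)
  have s2: "dominant (\<lambda>u v. \<kappa>1 * Fc 4 i j k v u) (\<lambda>u v. \<kappa>2 * Fc 4 j i k u v) (y, w, x, h) c21 c22"
    using sol by (simp add: solvable_def swap_args_def [abs_def] swap_box_def)
  \<comment> \<open>Exchanging the two functions along with the two variables brings the second row
    into the form of the first, with \<open>i\<close> and \<open>j\<close> interchanged.\<close>
  then have s2': "dominant (\<lambda>u v. \<kappa>2 * Fc 4 j i k u v) (\<lambda>u v. \<kappa>1 * Fc 4 i j k v u) (y, w, x, h) c22 c21"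
    unfolding dominant_def prod.case by (simp add: add.commute)
  have inb: "in_box (y, w, x, h) v u \<longleftrightarrow> in_box (x, h, y, w) u v" for u v
    by (auto simp: in_box_def)
  note e1 = dominant_near[OF s1 pos(1,2), folded \<alpha>_def \<beta>_def]
  note e2 = dominant_near[OF s2' pos(2,1), folded \<gamma>_def \<delta>_def]
  have "\<forall>\<^sub>F p in nhds (4 :: real). p > 2"
    by (rule eventually_nhds_in_open[of "{2<..}", THEN eventually_mono]) auto
  with e1 e2 show ?thesis
  proof eventually_elim
    case (elim p)
    have p: "p > 2" using elim by simp
    define P1 where "P1 u v = \<alpha> * dFu p i j k u v + \<beta> * dFv p j i k v u" for u v
    define P2 where "P2 u v = \<alpha> * dFv p i j k u v + \<beta> * dFu p j i k v u" for u v
    define Q1 where "Q1 u v = \<gamma> * dFu p i j k u v + \<delta> * dFv p j i k v u" for u v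
    define Q2 where "Q2 u v = \<gamma> * dFv p i j k u v + \<delta> * dFu p j i k v u" for u v
    define G1 where "G1 u v = \<alpha> * Fc p i j k u v + \<beta> * Fc p j i k v u" for u v
    define G2 where "G2 u v = \<gamma> * Fc p i j k u v + \<delta> * Fc p j i k v u" for u v
    have dom1: "\<bar>P2 u v\<bar> * w < P1 u v * h" if "in_box (x, h, y, w) u v" for u v
      using elim that by (auto simp: P1_def P2_def)
    have dom2: "\<bar>Q1 u v\<bar> * h < Q2 u v * w" if "in_box (x, h, y, w) u v" for u v
      using elim that inb[of v u] by (auto simp: Q1_def Q2_def add.commute)
    have edge: "G1 x v < 0" "0 < G1 (x + h) v" if "v \<in> {y..y + w}" for v
      using elim that by (auto simp: G1_def)
    have edge': "G2 u y < 0" "0 < G2 u (y + w)" if "u \<in> {x..x + h}" for u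
      using elim that by (auto simp: G2_def add.commute)
    have det: "0 < P1 u v * Q2 u v - P2 u v * Q1 u v" if "in_box (x, h, y, w) u v" for u v
    proof -
      have "\<bar>P2 u v\<bar> * w * (\<bar>Q1 u v\<bar> * h) < P1 u v * h * (Q2 u v * w)"
        by (rule mult_strict_mono'[OF dom1[OF that] dom2[OF that]]) (use pos in auto)
      then have "\<bar>P2 u v * Q1 u v\<bar> * (w * h) < (P1 u v * Q2 u v) * (w * h)"
        by (simp add: abs_mult algebra_simps)
      then have "\<bar>P2 u v * Q1 u v\<bar> < P1 u v * Q2 u v"
        unfolding mult_less_cancel_right_pos[OF mult_pos_pos[OF pos(2,1)]] .
      then show ?thesis by linarith
    qed
    have det': "P1 u v * Q2 u v - P2 u v * Q1 u v = \<kappa>1 * \<kappa>2 * (of_int (c11 * c22 - c12 * c21) *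
        (dFu p i j k u v * dFu p j i k v u - dFv p i j k u v * dFv p j i k v u))" for u v
      by (simp add: P1_def P2_def Q1_def Q2_def \<alpha>_def \<beta>_def \<gamma>_def \<delta>_def algebra_simps)
    have sgn: "0 < of_int (c11 * c22 - c12 * c21) *
        (dFu p i j k u v * dFu p j i k v u - dFv p i j k u v * dFv p j i k v u)" if "in_box (x, h, y, w) u v" for u v
      using det[OF that] unfolding det' by (rule zero_less_mult_pos) (use pos in simp)
    \<comment> \<open>The sign condition at one corner already excludes a singular preconditioner,
      so preconditioning does not change the zero set.\<close>
    have "real_of_int (c11 * c22 - c12 * c21) \<noteq> 0"
      using sgn[of x y] pos by (auto simp: in_box_def simp del: of_int_diff of_int_mult)
    then have ne: "\<alpha> * \<delta> - \<beta> * \<gamma> \<noteq> 0"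
      using pos by (simp add: \<alpha>_def \<beta>_def \<gamma>_def \<delta>_def algebra_simps)
    have G0: "G1 u v = 0 \<and> G2 u v = 0 \<longleftrightarrow> Fc p i j k u v = 0 \<and> Fc p j i k v u = 0" for u v
    proof
      assume "G1 u v = 0 \<and> G2 u v = 0"
      moreover have "\<delta> * G1 u v - \<beta> * G2 u v = (\<alpha> * \<delta> - \<beta> * \<gamma>) * Fc p i j k u v"
        "\<alpha> * G2 u v - \<gamma> * G1 u v = (\<alpha> * \<delta> - \<beta> * \<gamma>) * Fc p j i k v u"
        by (simp_all add: G1_def G2_def algebra_simps)
      ultimately show "Fc p i j k u v = 0 \<and> Fc p j i k v u = 0" using ne by simp
    qed (simp add: G1_def G2_def)
    have line: "((\<lambda>\<theta>. a * Fc p i j k (u + \<theta> * du) (v + \<theta> * dv) + b * Fc p j i k (v + \<theta> * dv) (u + \<theta> * du))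
        has_real_derivative (a * dFu p i j k (u + \<theta> * du) (v + \<theta> * dv) + b * dFv p j i k (v + \<theta> * dv) (u + \<theta> * du)) * du +
          (a * dFv p i j k (u + \<theta> * du) (v + \<theta> * dv) + b * dFu p j i k (v + \<theta> * dv) (u + \<theta> * du)) * dv) (at \<theta>)"
      for a b u v du dv \<theta>
      by (rule DERIV_cong[OF DERIV_add[OF DERIV_cmult[OF DERIV_Fc[OF p]] DERIV_cmult[OF DERIV_Fc[OF p]]]])
         (simp add: algebra_simps)
    have ex: "\<exists>u v. u \<in> {x..x + h} \<and> v \<in> {y..y + w} \<and> G1 u v = 0 \<and> G2 u v = 0"
      by (rule rectangle_zero_exists[OF pos(1,2)])
         (use edge edge' p in \<open>auto simp: G1_def G2_def case_prod_unfold intro!: continuous_intros\<close>)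
    have un: "u = u' \<and> v = v'"
      if "in_box (x, h, y, w) u v" "G1 u v = 0 \<and> G2 u v = 0" "in_box (x, h, y, w) u' v'" "G1 u' v' = 0 \<and> G2 u' v' = 0" for u v u' v'
    proof (rule rectangle_zero_unique[of G1 P1 P2 G2 Q1 Q2, OF _ _ pos(1,2)])
    qed (use that line dom1 dom2 in \<open>auto simp: in_box_def P1_def P2_def Q1_def Q2_def G1_def G2_def\<close>)
    have inn: "x < u \<and> u < x + h \<and> y < v \<and> v < y + w"
      if "in_box (x, h, y, w) u v" "G1 u v = 0 \<and> G2 u v = 0" for u v
      using that edge[of v] edge'[of u] by (auto simp: in_box_def order.order_iff_strict)
    show ?case
    proof (intro conjI)
      show "\<exists>u v. in_box (x, h, y, w) u v \<and> Fc p i j k u v = 0 \<and> Fc p j i k v u = 0"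
        using ex unfolding G0 by (simp add: in_box_def)
    qed (use un inn sgn in \<open>unfold G0, blast+\<close>)
  qed
qed

section \<open>Hessian of the Rayleigh quotient and Morse index\<close>

text \<open>In this type the numeral 3 denotes 0, so the order is 3 < 1 < 2; hence the pairs (3, 1)
  and (3, 2).\<close>

lemma triple_sum:
  fixes f :: "3 \<Rightarrow> 3 \<Rightarrow> real"
  shows "(\<Sum>(i, j)\<in>{(i, j). i < j}. f i j) = f 1 2 + f 3 1 + f 3 2"
proof -
  have lt: "(3 :: 3) < 1" "(3 :: 3) < 2" "(1 :: 3) < 2"
    by (simp_all add: less_bit1_def bit1.Rep_numeral bit1.Rep_1)
  have nlt: "\<not> (1 :: 3) < 3" "\<not> (2 :: 3) < 3" "\<not> (2 :: 3) < 1"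
    using lt by (auto dest: less_asym)
  have "i < j \<longleftrightarrow> (i, j) \<in> {(1, 2), (3, 1), (3, 2)}" for i j :: 3
    using exhaust_3[of i] exhaust_3[of j] by (elim disjE; simp add: lt nlt)
  then have "{(i, j). i < j} = {(1, 2), (3, 1), (3, 2 :: 3)}" by auto
  then show ?thesis by simp
qed

section \<open>First and second differentials of the Rayleigh quotient\<close>

definition rnum :: "real \<Rightarrow> real ^ 3 \<Rightarrow> real" where
  "rnum p x = wt 1 2 * \<bar>x $ 1 + x $ 2\<bar> powr p + wt 1 3 * \<bar>x $ 1 + x $ 3\<bar> powr p + wt 2 3 * \<bar>x $ 2 + x $ 3\<bar> powr p
     + (pot 1 * \<bar>x $ 1\<bar> powr p + pot 2 * \<bar>x $ 2\<bar> powr p + pot 3 * \<bar>x $ 3\<bar> powr p)"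

definition rden :: "real \<Rightarrow> real ^ 3 \<Rightarrow> real" where
  "rden p x = ms 1 * \<bar>x $ 1\<bar> powr p + ms 2 * \<bar>x $ 2\<bar> powr p + ms 3 * \<bar>x $ 3\<bar> powr p"

definition drnum :: "real \<Rightarrow> real ^ 3 \<Rightarrow> real ^ 3 \<Rightarrow> real" where
  "drnum p x v = p * (wt 1 2 * (Phi p (x $ 1 + x $ 2) * (v $ 1 + v $ 2)) + wt 1 3 * (Phi p (x $ 1 + x $ 3) * (v $ 1 + v $ 3))
     + wt 2 3 * (Phi p (x $ 2 + x $ 3) * (v $ 2 + v $ 3))
     + (pot 1 * (Phi p (x $ 1) * v $ 1) + pot 2 * (Phi p (x $ 2) * v $ 2) + pot 3 * (Phi p (x $ 3) * v $ 3)))"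

definition drden :: "real \<Rightarrow> real ^ 3 \<Rightarrow> real ^ 3 \<Rightarrow> real" where
  "drden p x v = p * (ms 1 * (Phi p (x $ 1) * v $ 1) + ms 2 * (Phi p (x $ 2) * v $ 2) + ms 3 * (Phi p (x $ 3) * v $ 3))"

definition hrnum :: "real \<Rightarrow> real ^ 3 \<Rightarrow> real ^ 3 \<Rightarrow> real ^ 3 \<Rightarrow> real" where
  "hrnum p x v w = p * (wt 1 2 * (dPhi p (x $ 1 + x $ 2) * (w $ 1 + w $ 2) * (v $ 1 + v $ 2))
     + wt 1 3 * (dPhi p (x $ 1 + x $ 3) * (w $ 1 + w $ 3) * (v $ 1 + v $ 3))
     + wt 2 3 * (dPhi p (x $ 2 + x $ 3) * (w $ 2 + w $ 3) * (v $ 2 + v $ 3))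
     + (pot 1 * (dPhi p (x $ 1) * w $ 1 * v $ 1) + pot 2 * (dPhi p (x $ 2) * w $ 2 * v $ 2) + pot 3 * (dPhi p (x $ 3) * w $ 3 * v $ 3)))"

definition hrden :: "real \<Rightarrow> real ^ 3 \<Rightarrow> real ^ 3 \<Rightarrow> real ^ 3 \<Rightarrow> real" where
  "hrden p x v w = p * (ms 1 * (dPhi p (x $ 1) * w $ 1 * v $ 1) + ms 2 * (dPhi p (x $ 2) * w $ 2 * v $ 2) + ms 3 * (dPhi p (x $ 3) * w $ 3 * v $ 3))"

lemma rayleigh_eq: "rayleigh p signed_triangle x = rnum p x / rden p x"
proof -
  have "edge_sign signed_triangle i j = -1" for i j by (simp add: signed_triangle_def)
  then show ?thesis
    unfolding rayleigh_def triple_sum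
    by (simp add: sum_3 rnum_def rden_def wt_def [symmetric] pot_def [symmetric] ms_def [symmetric] wt_sym[of 3 1] wt_sym[of 3 2] add.commute)
qed

lemma rden_pos:
  assumes "x \<noteq> 0"
  shows "rden p x > 0"
proof -
  have "x $ 1 \<noteq> 0 \<or> x $ 2 \<noteq> 0 \<or> x $ 3 \<noteq> 0"
    using assms by (auto simp: vec_eq_iff forall_3)
  moreover have "0 \<le> \<bar>x $ i\<bar> powr p" "x $ i = 0 \<or> 0 < \<bar>x $ i\<bar> powr p" for i by auto
  note this[of 1] this[of 2] this[of 3]
  ultimately show ?thesis
    unfolding rden_def ms_simps by linarith
qed

lemma has_derivative_abs_powr:
  assumes "p > 2" "(f has_derivative f') (at x within S)"
  shows "((\<lambda>x. \<bar>f x\<bar> powr p) has_derivative (\<lambda>v. p * (Phi p (f x) * f' v))) (at x within S)"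
  using DERIV_compose_FDERIV[OF DERIV_abs_powr[OF assms(1)] assms(2)] by (simp add: algebra_simps)

lemma has_derivative_Phi:
  assumes "p > 2" "(f has_derivative f') (at x within S)"
  shows "((\<lambda>x. Phi p (f x)) has_derivative (\<lambda>v. dPhi p (f x) * f' v)) (at x within S)"
  using DERIV_compose_FDERIV[OF DERIV_Phi[OF assms(1)] assms(2)] by (simp add: algebra_simps)

lemma has_derivative_vec_nth' [derivative_intros]:
  "((\<lambda>x. x $ i) has_derivative (\<lambda>v. v $ i)) (at x within S)"
  by (rule bounded_linear.has_derivative[OF bounded_linear_vec_nth has_derivative_ident])

lemma rnum_derivative:
  assumes "p > 2"
  shows "(rnum p has_derivative drnum p x) (at x within S)"
    and "(rden p has_derivative drden p x) (at x within S)"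
    and "((\<lambda>x. drnum p x v) has_derivative hrnum p x v) (at x within S)"
    and "((\<lambda>x. drden p x v) has_derivative hrden p x v) (at x within S)"
  unfolding rnum_def [abs_def] rden_def [abs_def] drnum_def drden_def hrnum_def hrden_def
  by (rule derivative_eq_intros has_derivative_abs_powr[OF assms] has_derivative_Phi[OF assms] refl
      | simp add: fun_eq_iff algebra_simps)+

definition dray :: "real \<Rightarrow> real ^ 3 \<Rightarrow> real ^ 3 \<Rightarrow> real" where
  "dray p x v = (drnum p x v - rayleigh p signed_triangle x * drden p x v) / rden p x"

lemma rayleigh_derivative:
  assumes "p > 2" "x \<noteq> 0"
  shows "(rayleigh p signed_triangle has_derivative dray p x) (at x within S)"
proof -
  have d: "rden p x \<noteq> 0" using rden_pos[OF assms(2), of p] by simp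
  have "dray p x = (\<lambda>v. (drnum p x v * rden p x - rnum p x * drden p x v) / (rden p x * rden p x))"
    using d by (simp add: fun_eq_iff dray_def rayleigh_eq field_simps)
  then show ?thesis
    using has_derivative_divide'[OF rnum_derivative(1,2)[OF assms(1)] d] by (simp add: rayleigh_eq [abs_def])
qed

text \<open>Every edge term contributes to both of its endpoints; collected by components of
  \<open>v\<close>, the differential is \<open>p\<close> times the left-hand sides of the
  eigenequations paired with \<open>v\<close>.\<close>

lemma eigenpair_first_order:
  assumes "eigenpair p signed_triangle x l"
  shows "drnum p x v = l * drden p x v"
proof -
  have e: "Ef p 1 2 3 (x $ 1) (x $ 2) (x $ 3) = l * ms 1 * Phi p (x $ 1)"
    "Ef p 2 1 3 (x $ 2) (x $ 1) (x $ 3) = l * ms 2 * Phi p (x $ 2)"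
    "Ef p 3 1 2 (x $ 3) (x $ 1) (x $ 2) = l * ms 3 * Phi p (x $ 3)"
    using assms eigenpair_iff[of 1 2 3] by (auto simp: perm3_def)
  have "drnum p x v = p * (Ef p 1 2 3 (x $ 1) (x $ 2) (x $ 3) * v $ 1 + Ef p 2 1 3 (x $ 2) (x $ 1) (x $ 3) * v $ 2
      + Ef p 3 1 2 (x $ 3) (x $ 1) (x $ 2) * v $ 3)"
    by (simp add: drnum_def Ef_def algebra_simps)
  also have "\<dots> = l * drden p x v"
    unfolding e by (simp add: drden_def algebra_simps)
  finally show ?thesis .
qed

lemma Phi_mult_self: "Phi p t * t = \<bar>t\<bar> powr p"
proof (cases "t = 0")
  case False
  then show ?thesis using powr_add[of "\<bar>t\<bar>" "p - 2" 2] by (simp add: Phi_def power2_eq_square)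
qed simp

lemma euler: "drnum p x x = p * rnum p x" "drden p x x = p * rden p x"
  by (simp_all add: drnum_def drden_def rnum_def rden_def Phi_mult_self)

lemma eigenpair_rayleigh:
  assumes "p > 2" "eigenpair p signed_triangle x l"
  shows "rayleigh p signed_triangle x = l"
proof -
  have "x \<noteq> 0" using assms by (simp add: eigenpair_def)
  then show ?thesis
    using eigenpair_first_order[OF assms(2), of x] rden_pos[of x p] assms(1) by (simp add: euler rayleigh_eq field_simps)
qed

definition hform :: "real \<Rightarrow> real \<Rightarrow> real ^ 3 \<Rightarrow> real ^ 3 \<Rightarrow> real ^ 3 \<Rightarrow> real" where
  "hform p l x v w = hrnum p x v w - l * hrden p x v w"

text \<open>At an eigenvector the first differential vanishes, so varying the quotient or the
  denominator contributes nothing: the Hessian of the quotient is that of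
  \<open>rnum - l * rden\<close>, with \<open>l\<close> frozen, divided by
  \<open>rden\<close>.\<close>

lemma dray_derivative:
  assumes p: "p > 2" and ep: "eigenpair p signed_triangle x l"
  shows "((\<lambda>y. dray p y v) has_derivative (\<lambda>w. hform p l x v w / rden p x)) (at x within S)"
proof -
  have x: "x \<noteq> 0" using ep by (simp add: eigenpair_def)
  have d: "rden p x \<noteq> 0" using rden_pos[OF x, of p] by simp
  have r: "rayleigh p signed_triangle x = l" by (rule eigenpair_rayleigh[OF p ep])
  have "((\<lambda>y. drnum p y v - rayleigh p signed_triangle y * drden p y v) has_derivative
      (\<lambda>w. hrnum p x v w - (rayleigh p signed_triangle x * hrden p x v w + dray p x w * drden p x v))) (at x within S)"
    by (intro has_derivative_diff has_derivative_mult rnum_derivative[OF p] rayleigh_derivative[OF p x])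
  note has_derivative_divide[OF this rnum_derivative(2)[OF p] d]
  then show ?thesis
    unfolding dray_def by (simp add: r eigenpair_first_order[OF ep] hform_def divide_inverse)
qed

lemma hform_bilinear:
  "hform p l x (a *\<^sub>R v + b *\<^sub>R w) z = a * hform p l x v z + b * hform p l x w z"
  "hform p l x v w = hform p l x w v"
  by (simp_all add: hform_def hrnum_def hrden_def algebra_simps)

text \<open>Euler's identity again: the Hessian applied to \<open>x\<close> is p - 1 times the
  gradient, which vanishes at an eigenvector. The form thus lives on the quotient by the line of
  \<open>x\<close>, the tangent space of the projective plane.\<close>

lemma hform_self:
  assumes "p > 2" "eigenpair p signed_triangle x l"
  shows "hform p l x x w = 0"
proof -
  have "hrnum p x x w = (p - 1) * drnum p x w" "hrden p x x w = (p - 1) * drden p x w"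
    unfolding hrnum_def hrden_def drnum_def drden_def
    using mult_dPhi[of "x $ 1 + x $ 2" p] mult_dPhi[of "x $ 1 + x $ 3" p] mult_dPhi[of "x $ 2 + x $ 3" p]
      mult_dPhi[of "x $ 1" p] mult_dPhi[of "x $ 2" p] mult_dPhi[of "x $ 3" p]
    by algebra+
  then show ?thesis
    using eigenpair_first_order[OF assms(2), of w] by (simp add: hform_def)
qed

lemma hform_perm:
  assumes "perm3 i j k"
  shows "hform p l x v w = p * (wt i j * (dPhi p (x $ i + x $ j) * (w $ i + w $ j) * (v $ i + v $ j))
     + wt i k * (dPhi p (x $ i + x $ k) * (w $ i + w $ k) * (v $ i + v $ k))
     + wt j k * (dPhi p (x $ j + x $ k) * (w $ j + w $ k) * (v $ j + v $ k))
     + ((pot i - l * ms i) * (dPhi p (x $ i) * w $ i * v $ i) + (pot j - l * ms j) * (dPhi p (x $ j) * w $ j * v $ j)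
        + (pot k - l * ms k) * (dPhi p (x $ k) * w $ k * v $ k)))"
proof -
  define f where "f i j = wt i j * (dPhi p (x $ i + x $ j) * (w $ i + w $ j) * (v $ i + v $ j))" for i j
  define g where "g i = (pot i - l * ms i) * (dPhi p (x $ i) * w $ i * v $ i)" for i
  have fs: "f i j = f j i" for i j by (simp add: f_def wt_sym[of i j] add.commute)
  have "hform p l x v w = p * (f 1 2 + f 1 3 + f 2 3 + (g 1 + g 2 + g 3))"
    unfolding hform_def hrnum_def hrden_def f_def g_def by (simp add: algebra_simps del: wt_simps pot_simps ms_simps)
  moreover have "f 1 2 + f 1 3 + f 2 3 + (g 1 + g 2 + g 3) = f i j + f i k + f j k + (g i + g j + g k)"
    using perm3_cases[OF assms] fs[of 2 1] fs[of 3 1] fs[of 3 2] by auto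
  ultimately show ?thesis by (simp only: f_def g_def)
qed

lemma hform_chart:
  assumes "perm3 i j k" "v $ k = 0" "w $ k = 0" "l = lam p i j k u u'"
  shows "hform p l (cpt i j k u u') v w = p * (Hd p i j k u u' * (v $ i * w $ i) +
     Ho p i j u u' * (v $ i * w $ j + v $ j * w $ i) + Hd p j i k u' u * (v $ j * w $ j))"
  unfolding hform_perm[OF assms(1)] cpt_nth[OF assms(1)] Hd_def Ho_def lam_swap[of p j i] assms(2-4) [symmetric]
  using assms(2,3) by (simp add: algebra_simps wt_sym[of j i])

section \<open>Hessians on a subspace and the Morse index\<close>

lemma has_derivative_within_subspace_unique:
  assumes H: "subspace H" "y \<in> H" "v \<in> H"
    and "(g has_derivative D) (at y within H)" "(g has_derivative D') (at y within H)"
  shows "D v = D' v"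
proof -
  have "((\<lambda>t::real. g (y + t *\<^sub>R v)) has_derivative (\<lambda>t. E (t *\<^sub>R v))) (at 0)"
    if "(g has_derivative E) (at y within H)" for E
  proof (rule has_derivative_in_compose[where f = "\<lambda>t. y + t *\<^sub>R v"])
    show "((\<lambda>t. y + t *\<^sub>R v) has_derivative (\<lambda>t. t *\<^sub>R v)) (at 0)"
      by (auto intro!: derivative_eq_intros)
    show "(g has_derivative E) (at (y + 0 *\<^sub>R v) within range (\<lambda>t. y + t *\<^sub>R v))"
      using that by (auto intro!: has_derivative_subset[of g E y H] subspace_add subspace_scale H)
  qed
  from this[OF assms(4)] this[OF assms(5)] have "(\<lambda>t. D (t *\<^sub>R v)) = (\<lambda>t. D' (t *\<^sub>R v))"
    by (rule has_derivative_unique)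
  from fun_cong[OF this, of 1] show ?thesis by simp
qed

text \<open>\<open>nondegenerate_critical_on\<close> asserts only that some Hessian has index
  \<open>k\<close>; this uniqueness makes the index a function of the critical point. Near
  \<open>u\<close> the two first derivatives agree in directions of \<open>H\<close>, hence so do
  their derivatives.\<close>

lemma has_hessian_on_unique:
  assumes H: "subspace H" "u \<in> H" and Q: "has_hessian_on g H u Q" "has_hessian_on g H u Q'"
    and v: "v \<in> H" "w \<in> H"
  shows "Q v w = Q' v w"
proof -
  obtain D e where D: "e > 0" "\<And>y. y \<in> H \<inter> ball u e \<Longrightarrow> (g has_derivative D y) (at y within H)"
    "\<And>v. v \<in> H \<Longrightarrow> ((\<lambda>y. D y v) has_derivative Q v) (at u within H)"
    using Q(1) unfolding has_hessian_on_def by blast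
  obtain D' e' where D': "e' > 0" "\<And>y. y \<in> H \<inter> ball u e' \<Longrightarrow> (g has_derivative D' y) (at y within H)"
    "\<And>v. v \<in> H \<Longrightarrow> ((\<lambda>y. D' y v) has_derivative Q' v) (at u within H)"
    using Q(2) unfolding has_hessian_on_def by blast
  have "((\<lambda>y. D' y v) has_derivative Q v) (at u within H)"
  proof (rule has_derivative_transform_within[OF D(3)[OF v(1)]])
    show "0 < min e e'" using D D' by simp
    show "D y v = D' y v" if "y \<in> H" "dist y u < min e e'" for y
      using that by (intro has_derivative_within_subspace_unique[OF H(1) _ v(1) D(2) D'(2)]) (auto simp: dist_commute)
  qed (rule H)
  then show ?thesis
    using has_derivative_within_subspace_unique[OF H v(2) _ D'(3)[OF v(1)]] by blast
qed

lemma subspace_chart_space: "subspace (chart_space c)"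
  by (auto simp: chart_space_def subspace_def)

lemma dim_chart_space: "dim (chart_space c :: (real ^ 3) set) = 2"
proof -
  have "chart_space c = {x :: real ^ 3. axis c 1 \<bullet> x = 0}"
    by (auto simp: chart_space_def inner_axis inner_commute[of "axis c 1"])
  then show ?thesis by (simp add: dim_hyperplane axis_eq_0_iff)
qed

lemma negative_index_on_cong:
  assumes "\<And>v. v \<in> H \<Longrightarrow> Q v v = Q' v v"
  shows "negative_index_on H Q = negative_index_on H Q'"
proof -
  have "(V \<subseteq> H \<and> (\<forall>v\<in>V - {0}. Q v v < 0)) = (V \<subseteq> H \<and> (\<forall>v\<in>V - {0}. Q' v v < 0))" for V
    using assms by (metis DiffD1 subsetD)
  then show ?thesis unfolding negative_index_on_def by simp
qed

lemma negative_index_on_eqI: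
  fixes H :: "'a::euclidean_space set"
  assumes "subspace V" "V \<subseteq> H" "\<And>v. v \<in> V \<Longrightarrow> v \<noteq> 0 \<Longrightarrow> Q v v < 0" "dim V = n"
    and "\<And>V. subspace V \<Longrightarrow> V \<subseteq> H \<Longrightarrow> (\<And>v. v \<in> V \<Longrightarrow> v \<noteq> 0 \<Longrightarrow> Q v v < 0) \<Longrightarrow> dim V \<le> n"
  shows "negative_index_on H Q = n"
  unfolding negative_index_on_def
proof (rule Max_eqI)
  show "finite {dim V | V. subspace V \<and> V \<subseteq> H \<and> (\<forall>v\<in>V - {0}. Q v v < 0)}"
    by (rule finite_subset[of _ "{..n}"]) (use assms(5) in auto)
qed (use assms in auto)

lemma negative_index_on_pos:
  fixes H :: "'a::euclidean_space set"
  assumes "subspace H" "\<And>v. v \<in> H \<Longrightarrow> v \<noteq> 0 \<Longrightarrow> Q v v > 0"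
  shows "negative_index_on H Q = 0"
proof (rule negative_index_on_eqI[of "{0}"])
  fix V assume V: "subspace V" "V \<subseteq> H" "\<And>v. v \<in> V \<Longrightarrow> v \<noteq> 0 \<Longrightarrow> Q v v < 0"
  then have "V \<subseteq> {0}" using assms(2) by (metis insert_iff not_less_iff_gr_or_eq subset_iff)
  then show "dim V \<le> 0" by (simp add: dim_eq_0)
qed (use subspace_0[OF assms(1)] in auto)

lemma negative_index_on_neg:
  fixes H :: "'a::euclidean_space set"
  assumes "subspace H" "\<And>v. v \<in> H \<Longrightarrow> v \<noteq> 0 \<Longrightarrow> Q v v < 0"
  shows "negative_index_on H Q = dim H"
  by (rule negative_index_on_eqI[of H]) (use assms in \<open>auto intro: dim_subset\<close>)

text \<open>A negative definite subspace of dimension 2 would be all of \<open>H\<close>, but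
  \<open>H\<close> contains \<open>w\<close>.\<close>

lemma negative_index_on_indef:
  fixes H :: "'a::euclidean_space set"
  assumes H: "subspace H" "dim H = 2" and v: "v \<in> H" "Q v v < 0" and w: "w \<in> H" "Q w w > 0" "w \<noteq> 0" "v \<noteq> 0"
    and sc: "\<And>c. Q (c *\<^sub>R v) (c *\<^sub>R v) = c\<^sup>2 * Q v v"
  shows "negative_index_on H Q = 1"
proof (rule negative_index_on_eqI[of "span {v}"])
  show "span {v} \<subseteq> H" using H v by (simp add: span_minimal)
  show "Q z z < 0" if "z \<in> span {v}" "z \<noteq> 0" for z
    using that v by (auto simp: span_singleton sc mult_pos_neg)
  show "dim (span {v}) = 1" using w by (simp add: dim_singleton)
  fix V assume V: "subspace V" "V \<subseteq> H" "\<And>v. v \<in> V \<Longrightarrow> v \<noteq> 0 \<Longrightarrow> Q v v < 0"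
  show "dim V \<le> 1"
  proof (rule ccontr)
    assume "\<not> dim V \<le> 1"
    then have "V = H" using V H by (intro subspace_dim_equal) auto
    then show False using V(3)[of w] w by simp
  qed
qed simp

lemma proj_rayleigh_chart:
  assumes "y \<in> chart_space c"
  shows "(proj_rayleigh p d \<circ> affine_chart c) y = rayleigh p d (y + axis c 1)"
proof -
  have "(y + axis c 1) $ c \<noteq> 0" using assms by (simp add: chart_space_def axis_def)
  then have "y + axis c 1 \<noteq> 0" by (metis zero_index)
  then show ?thesis by (simp add: affine_chart_def proj_rayleigh_span)
qed

definition chart_hessian :: "real \<Rightarrow> real \<Rightarrow> real ^ 3 \<Rightarrow> real ^ 3 \<Rightarrow> real ^ 3 \<Rightarrow> real" where
  "chart_hessian p l x v w = hform p l x v w / rden p x"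

lemma has_hessian_on_chart:
  assumes p: "p > 2" and ep: "eigenpair p signed_triangle (u + axis c 1) l" and u: "u \<in> chart_space c"
  shows "has_hessian_on (proj_rayleigh p signed_triangle \<circ> affine_chart c) (chart_space c) u
      (chart_hessian p l (u + axis c 1))"
    and "((proj_rayleigh p signed_triangle \<circ> affine_chart c) has_derivative (\<lambda>_. 0)) (at u within chart_space c)"
proof -
  let ?g = "proj_rayleigh p signed_triangle \<circ> affine_chart c" and ?a = "axis c 1 :: real ^ 3"
  have tr: "((\<lambda>y. y + ?a) has_derivative (\<lambda>v. v)) (at y within S)" for y S
    by (auto intro!: derivative_eq_intros)
  have d1: "(?g has_derivative dray p (y + ?a)) (at y within chart_space c)" if "y \<in> chart_space c" for y
  proof (rule has_derivative_transform[OF that proj_rayleigh_chart])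
    have "(y + ?a) $ c \<noteq> 0" using that by (simp add: chart_space_def axis_def)
    then have "y + ?a \<noteq> 0" by (metis zero_index)
    then show "((\<lambda>y. rayleigh p signed_triangle (y + ?a)) has_derivative dray p (y + ?a)) (at y within chart_space c)"
      by (intro has_derivative_compose[OF tr] rayleigh_derivative[OF p])
  qed
  have d2: "((\<lambda>y. dray p (y + ?a) v) has_derivative chart_hessian p l (u + ?a) v) (at u within chart_space c)" for v
    unfolding chart_hessian_def [abs_def]
    by (rule has_derivative_compose[OF tr dray_derivative[OF p ep]])
  show "has_hessian_on ?g (chart_space c) u (chart_hessian p l (u + ?a))"
    unfolding has_hessian_on_def
    using d1 d2 by (intro exI[of _ "\<lambda>y. dray p (y + ?a)"] conjI exI[of _ 1]) auto
  have "dray p (u + ?a) = (\<lambda>_. 0)"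
    using eigenpair_first_order[OF ep] eigenpair_rayleigh[OF p ep] by (simp add: dray_def fun_eq_iff)
  then show "(?g has_derivative (\<lambda>_. 0)) (at u within chart_space c)"
    using d1[OF u] by simp
qed

text \<open>The index of the form modulo the line of \<open>x\<close>, phrased without a chart so
  that it can be transferred between representatives and charts. In the case \<open>n = 1\<close>,
  indefiniteness together with a radical no larger than the line means signature (1, 1) on the
  two-dimensional quotient.\<close>

definition index_type :: "real \<Rightarrow> real \<Rightarrow> real ^ 3 \<Rightarrow> nat \<Rightarrow> bool" where
  "index_type p l x n \<longleftrightarrow>
     n = 0 \<and> (\<forall>v. v \<notin> span {x} \<longrightarrow> 0 < hform p l x v v) \<or>
     n = 2 \<and> (\<forall>v. v \<notin> span {x} \<longrightarrow> hform p l x v v < 0) \<or>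
     n = 1 \<and> (\<exists>v. hform p l x v v < 0) \<and> (\<exists>v. 0 < hform p l x v v) \<and>
       (\<forall>v. (\<forall>w. hform p l x v w = 0) \<longrightarrow> v \<in> span {x})"

lemma hform_scale: "hform p l (s *\<^sub>R x) v w = \<bar>s\<bar> powr (p - 2) * hform p l x v w"
proof -
  have d: "dPhi p (s * a + s * b) = \<bar>s\<bar> powr (p - 2) * dPhi p (a + b)" for a b
    by (simp add: dPhi_mult flip: distrib_left)
  show ?thesis
    by (simp add: hform_def hrnum_def hrden_def d dPhi_mult algebra_simps del: wt_simps pot_simps ms_simps)
qed

lemma span_singleton_scale: "s \<noteq> 0 \<Longrightarrow> span {s *\<^sub>R x} = span {x}" for x :: "'a::real_vector"
  using span_image_scale[of "{x}" "\<lambda>_. s"] by simp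

lemma hform_scale_args: "hform p l x (r *\<^sub>R v) (r *\<^sub>R v) = r\<^sup>2 * hform p l x v v"
  by (simp add: hform_def hrnum_def hrden_def power2_eq_square algebra_simps)

lemma index_type_scale:
  assumes "s \<noteq> 0" "index_type p l x n"
  shows "index_type p l (s *\<^sub>R x) n"
proof -
  have "span {s *\<^sub>R x} = span {x}" using assms(1) by (simp add: span_singleton_scale)
  moreover have "0 < \<bar>s\<bar> powr (p - 2) * z \<longleftrightarrow> 0 < z" "\<bar>s\<bar> powr (p - 2) * z < 0 \<longleftrightarrow> z < 0"
    "\<bar>s\<bar> powr (p - 2) * z = 0 \<longleftrightarrow> z = 0" for z
    using assms(1) by (auto simp: zero_less_mult_iff mult_less_0_iff)
  ultimately show ?thesis
    using assms(2) unfolding index_type_def hform_scale by (simp only:)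
qed

lemma hform_shift:
  assumes "p > 2" "eigenpair p signed_triangle x l"
  shows "hform p l x (v - a *\<^sub>R x) w = hform p l x v w" "hform p l x v (w - a *\<^sub>R x) = hform p l x v w"
proof -
  have *: "hform p l x (y - a *\<^sub>R x) z = hform p l x y z" for y z
    using hform_bilinear(1)[of p l x 1 y "- a" x z] hform_self[OF assms] by simp
  show "hform p l x (v - a *\<^sub>R x) w = hform p l x v w" by (rule *)
  show "hform p l x v (w - a *\<^sub>R x) = hform p l x v w"
    using *[of w v] by (simp only: hform_bilinear(2)[of p l x v])
qed

text \<open>The chart space is a complement of the line of the eigenvector. Subtracting a multiple
  of the eigenvector moves any vector into it without changing the form, so signs modulo the line
  become signs on the chart space. The forward direction uses uniqueness of the Hessian.\<close>

lemma nondegenerate_critical_on_chart: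
  assumes p: "p > 2" and ep: "eigenpair p signed_triangle (u + axis c 1) l" and u: "u \<in> chart_space c"
    and it: "index_type p l (u + axis c 1) n"
  shows "nondegenerate_critical_on (proj_rayleigh p signed_triangle \<circ> affine_chart c) (chart_space c) u m \<longleftrightarrow> m = n"
proof -
  let ?g = "proj_rayleigh p signed_triangle \<circ> affine_chart c"
  define X where "X = u + axis c 1"
  define Q where "Q = chart_hessian p l X"
  note ep = ep[folded X_def] and it = it[folded X_def]
  have Xc: "X $ c = 1" using u by (simp add: X_def chart_space_def axis_def)
  then have X0: "X \<noteq> 0" by auto
  have dp: "rden p X > 0" by (rule rden_pos[OF X0])
  have Q: "Q v w = hform p l X v w / rden p X" for v w by (simp add: Q_def chart_hessian_def)
  have hs: "has_hessian_on ?g (chart_space c) u Q" "(?g has_derivative (\<lambda>_. 0)) (at u within chart_space c)"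
    using has_hessian_on_chart[OF p _ u, of l] ep by (simp_all add: Q_def X_def)
  have out: "v \<notin> span {X}" if "v \<in> chart_space c" "v \<noteq> 0" for v
    using that Xc by (auto simp: span_singleton chart_space_def)
  have proj: "v - v $ c *\<^sub>R X \<in> chart_space c" for v
    using Xc by (simp add: chart_space_def)
  have same: "Q (v - v $ c *\<^sub>R X) (v - v $ c *\<^sub>R X) = Q v v" for v
    by (simp add: Q hform_shift[OF p ep])
  have Q0: "Q 0 w = 0" for w
    using hform_bilinear(1)[of p l X 0 0 0 0 w] by (simp add: Q)
  have nondeg: "nondegenerate_on (chart_space c) Q"
    unfolding nondegenerate_on_def
  proof (intro ballI impI, rule ccontr)
    fix v assume v: "v \<in> chart_space c" "\<forall>w\<in>chart_space c. Q v w = 0" "v \<noteq> 0"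
    have "hform p l X v w = 0" for w
    proof -
      have "Q v (w - w $ c *\<^sub>R X) = 0" using v(2) proj by blast
      then show ?thesis using dp by (simp add: Q hform_shift[OF p ep])
    qed
    then show False using it out[OF v(1,3)] unfolding index_type_def by auto
  qed
  have idx: "negative_index_on (chart_space c) Q = n"
    using it unfolding index_type_def
  proof (elim disjE conjE exE)
    assume "n = 0" "\<forall>v. v \<notin> span {X} \<longrightarrow> 0 < hform p l X v v"
    then show ?thesis
      using negative_index_on_pos[OF subspace_chart_space, of c Q] out dp by (simp add: Q)
  next
    assume "n = 2" "\<forall>v. v \<notin> span {X} \<longrightarrow> hform p l X v v < 0"
    then show ?thesis
      using negative_index_on_neg[OF subspace_chart_space, of c Q] out dp
      by (simp add: Q dim_chart_space divide_neg_pos)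
  next
    fix v w assume n: "n = 1" and vw: "hform p l X v v < 0" "0 < hform p l X w w"
    let ?v = "v - v $ c *\<^sub>R X" and ?w = "w - w $ c *\<^sub>R X"
    have q: "Q ?v ?v < 0" "0 < Q ?w ?w" using vw dp by (simp_all add: same) (simp_all add: Q divide_neg_pos)
    have "negative_index_on (chart_space c) Q = 1"
    proof (rule negative_index_on_indef[where Q = Q, OF subspace_chart_space dim_chart_space proj[of v] q(1) proj[of w] q(2)])
      show "?w \<noteq> 0" "?v \<noteq> 0" using q Q0[of 0] by force+
      show "Q (r *\<^sub>R ?v) (r *\<^sub>R ?v) = r\<^sup>2 * Q ?v ?v" for r
        by (simp only: Q hform_scale_args) simp
    qed
    then show ?thesis using n by simp
  qed
  show ?thesis
  proof
    assume "nondegenerate_critical_on ?g (chart_space c) u m"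
    then obtain Q' where Q': "has_hessian_on ?g (chart_space c) u Q'" "negative_index_on (chart_space c) Q' = m"
      by (auto simp: nondegenerate_critical_on_def)
    have "negative_index_on (chart_space c) Q' = negative_index_on (chart_space c) Q"
      by (rule negative_index_on_cong) (rule has_hessian_on_unique[OF subspace_chart_space u Q'(1) hs(1)])
    then show "m = n" using Q' idx by simp
  next
    assume "m = n"
    then show "nondegenerate_critical_on ?g (chart_space c) u m"
      using hs nondeg idx by (auto simp: nondegenerate_critical_on_def)
  qed
qed

text \<open>Whichever chart witnesses \<open>has_morse_index\<close>, its representative is a
  nonzero multiple of \<open>x\<close>, and \<open>index_type\<close> is invariant under
  scaling.\<close>

lemma has_morse_index_eigenline:
  assumes p: "p > 2" and ep: "eigenpair p signed_triangle x l" and it: "index_type p l x n"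
  shows "has_morse_index (proj_rayleigh p signed_triangle) (span {x}) m \<longleftrightarrow> m = n"
proof
  assume "has_morse_index (proj_rayleigh p signed_triangle) (span {x}) m"
  then obtain c u where u: "u \<in> chart_space c" and L: "span {x} = affine_chart c u"
    and nd: "nondegenerate_critical_on (proj_rayleigh p signed_triangle \<circ> affine_chart c) (chart_space c) u m"
    by (auto simp: has_morse_index_def)
  have "u + axis c 1 \<in> span {x}" by (simp add: L affine_chart_def span_base)
  then obtain s where s: "u + axis c 1 = s *\<^sub>R x" by (auto simp: span_singleton)
  have "(u + axis c 1) $ c = 1" using u by (simp add: chart_space_def axis_def)
  then have "s \<noteq> 0" using s by auto
  then show "m = n"
    using nondegenerate_critical_on_chart[OF p _ u, of l n m] nd
      eigenpair_scale[OF _ ep, of s] index_type_scale[OF _ it, of s] by (simp add: s)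
next
  assume m: "m = n"
  have "x \<noteq> 0" using ep by (simp add: eigenpair_def)
  then obtain c where c: "x $ c \<noteq> 0" by (auto simp: vec_eq_iff)
  define s where "s = 1 / x $ c"
  define u where "u = s *\<^sub>R x - axis c 1"
  have s: "s \<noteq> 0" "u + axis c 1 = s *\<^sub>R x" using c by (simp_all add: s_def u_def)
  have u: "u \<in> chart_space c" using c by (simp add: u_def s_def chart_space_def axis_def)
  have "span {x} = affine_chart c u" using s(1) by (simp add: affine_chart_def s(2) span_singleton_scale)
  moreover have "nondegenerate_critical_on (proj_rayleigh p signed_triangle \<circ> affine_chart c) (chart_space c) u m"
    using nondegenerate_critical_on_chart[OF p _ u, of l n m] m
      eigenpair_scale[OF s(1) ep] index_type_scale[OF s(1) it] by (simp add: s)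
  ultimately show "has_morse_index (proj_rayleigh p signed_triangle) (span {x}) m"
    using u unfolding has_morse_index_def by blast
qed

section \<open>Signature of a binary quadratic form\<close>

lemma quadratic_form_pos:
  fixes a b c x y :: real
  assumes "0 < a" "0 < a * c - b\<^sup>2" "x \<noteq> 0 \<or> y \<noteq> 0"
  shows "0 < a * (x * x) + b * (x * y + y * x) + c * (y * y)"
proof -
  have e: "a * (a * (x * x) + b * (x * y + y * x) + c * (y * y)) = (a * x + b * y)\<^sup>2 + (a * c - b\<^sup>2) * y\<^sup>2"
    by (simp add: power2_eq_square algebra_simps)
  have "0 < (a * x + b * y)\<^sup>2 + (a * c - b\<^sup>2) * y\<^sup>2"
  proof (cases "y = 0")
    case True
    then show ?thesis using assms by simp
  next
    case False
    then show ?thesis using assms by (intro add_nonneg_pos mult_pos_pos) auto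
  qed
  then show ?thesis using assms(1) unfolding e [symmetric] by (simp add: zero_less_mult_iff)
qed

lemma quadratic_form_indef:
  fixes a b c :: real
  assumes "a * c - b\<^sup>2 < 0"
  shows "\<exists>x y. a * (x * x) + b * (x * y + y * x) + c * (y * y) < 0"
proof (cases "a = 0")
  case True
  then have b: "b \<noteq> 0" using assms by auto
  \<comment> \<open>With vanishing \<open>a\<close> and second coordinate 1 the form is affine in
    \<open>x\<close>; this \<open>x\<close> gives it the value -1.\<close>
  have "a * (x * x) + b * (x * 1 + 1 * x) + c * (1 * 1) < 0" if "x = (- c - 1) / (2 * b)" for x
    using b True that by (simp add: field_simps)
  then show ?thesis by blast
next
  case False
  show ?thesis
  proof (cases "a < 0")
    case True
    then show ?thesis by (intro exI[of _ 1] exI[of _ 0]) simp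
  next
    case a: False
    have "a * ((- b) * (- b)) + b * ((- b) * a + a * (- b)) + c * (a * a) = a * (a * c - b\<^sup>2)"
      by (simp add: power2_eq_square algebra_simps)
    also have "\<dots> < 0" using a False assms by (intro mult_pos_neg) auto
    finally show ?thesis by blast
  qed
qed

text \<open>Determinant and one diagonal entry decide the signature. For index 2 it is
  \<open>c\<close> that is tested: at the eigenline concerned this is the entry of vertex 3, which
  the huge mass there makes strongly negative.\<close>

lemma index_type_chart:
  assumes p: "p > 2" and p3: "perm3 i j k" and F: "Fc p i j k u v = 0" "Fc p j i k v u = 0"
  defines "a \<equiv> Hd p i j k u v" and "b \<equiv> Ho p i j u v" and "c \<equiv> Hd p j i k v u"
  assumes it: "n = 0 \<and> 0 < a * c - b\<^sup>2 \<and> 0 < a \<or> n = 2 \<and> 0 < a * c - b\<^sup>2 \<and> c < 0 \<or> n = 1 \<and> a * c - b\<^sup>2 < 0"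
  shows "index_type p (lam p i j k u v) (cpt i j k u v) n"
proof -
  define l where "l = lam p i j k u v"
  define x where "x = cpt i j k u v"
  have ep: "eigenpair p signed_triangle x l"
    using eigenpair_cpt_iff[OF p3, of p u v l] F by (simp add: x_def l_def)
  have xk: "x $ k = 1" by (simp add: x_def cpt_nth[OF p3])
  define q where "q r s r' s' = p * (a * (r * r') + b * (r * s' + s * r') + c * (s * s'))" for r s r' s'
  have hf: "hform p l x y z = q (y $ i - y $ k * x $ i) (y $ j - y $ k * x $ j) (z $ i - z $ k * x $ i) (z $ j - z $ k * x $ j)" for y z
  proof -
    have "hform p l x y z = hform p l x (y - y $ k *\<^sub>R x) (z - z $ k *\<^sub>R x)"
      by (simp add: hform_shift[OF p ep])
    also have "\<dots> = q (y $ i - y $ k * x $ i) (y $ j - y $ k * x $ j) (z $ i - z $ k * x $ i) (z $ j - z $ k * x $ j)"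
      unfolding x_def q_def a_def b_def c_def
      by (subst hform_chart[OF p3]) (simp_all add: l_def cpt_nth[OF p3])
    finally show ?thesis .
  qed
  have inspan: "y \<in> span {x}" if "y $ i - y $ k * x $ i = 0" "y $ j - y $ k * x $ j = 0" for y
  proof -
    have "y = y $ k *\<^sub>R x" using that xk by (simp add: vec3_eq[OF p3])
    then show ?thesis by (metis span_base span_scale insertI1)
  qed
  define vc where "vc r s = ((\<chi> m. if m = i then r else if m = j then s else 0) :: real ^ 3)" for r s :: real
  have vc: "vc r s $ i = r" "vc r s $ j = s" "vc r s $ k = 0" for r s
    using p3 by (auto simp: vc_def perm3_def)
  have p0: "p > 0" using p by simp
  have "index_type p l x n"
    using it
  proof (elim disjE conjE)
    assume n: "n = 0" and d: "0 < a * c - b\<^sup>2" "0 < a"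
    have "0 < hform p l x y y" if "y \<notin> span {x}" for y
      unfolding hf q_def using inspan[of y] that p0
      by (intro mult_pos_pos quadratic_form_pos[OF d(2,1)]) auto
    then show "index_type p l x n" unfolding index_type_def using n by blast
  next
    assume n: "n = 2" and d: "0 < a * c - b\<^sup>2" "c < 0"
    have "hform p l x y y < 0" if "y \<notin> span {x}" for y
    proof -
      \<comment> \<open>The criterion is applied to the negated form with the two coordinates
        exchanged, since the sign of \<open>c\<close> is the known one.\<close>
      have "0 < - c" "0 < (- c) * (- a) - (- b)\<^sup>2" using d by (simp_all add: algebra_simps)
      from quadratic_form_pos[OF this, of "y $ j - y $ k * x $ j" "y $ i - y $ k * x $ i"] inspan[of y] that
      have "a * ((y $ i - y $ k * x $ i) * (y $ i - y $ k * x $ i)) + b * ((y $ i - y $ k * x $ i) * (y $ j - y $ k * x $ j)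
        + (y $ j - y $ k * x $ j) * (y $ i - y $ k * x $ i)) + c * ((y $ j - y $ k * x $ j) * (y $ j - y $ k * x $ j)) < 0"
        by (auto simp: algebra_simps)
      then show ?thesis unfolding hf q_def using p0 by (rule mult_pos_neg[rotated])
    qed
    then show "index_type p l x n" unfolding index_type_def using n by blast
  next
    assume n: "n = 1" and d: "a * c - b\<^sup>2 < 0"
    obtain r s where "a * (r * r) + b * (r * s + s * r) + c * (s * s) < 0"
      using quadratic_form_indef[OF d] by blast
    then have 1: "hform p l x (vc r s) (vc r s) < 0"
      unfolding hf q_def vc using p0 by (simp add: mult_pos_neg)
    have "(- a) * (- c) - (- b)\<^sup>2 < 0" using d by simp
    from quadratic_form_indef[OF this] obtain r' s' where "(- a) * (r' * r') + (- b) * (r' * s' + s' * r') + (- c) * (s' * s') < 0"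
      by blast
    then have "0 < a * (r' * r') + b * (r' * s' + s' * r') + c * (s' * s')" by simp
    then have 2: "0 < hform p l x (vc r' s') (vc r' s')"
      unfolding hf q_def vc using p0 by (simp add: mult_pos_pos)
    have 3: "y \<in> span {x}" if y: "\<forall>w. hform p l x y w = 0" for y
    proof (rule inspan)
      let ?r = "y $ i - y $ k * x $ i" and ?s = "y $ j - y $ k * x $ j"
      have "hform p l x y (vc 1 0) = 0" "hform p l x y (vc 0 1) = 0" using y by auto
      then have e: "a * ?r + b * ?s = 0" "b * ?r + c * ?s = 0"
        unfolding hf q_def vc using p0 by simp_all
      have "(a * c - b\<^sup>2) * ?r = c * (a * ?r + b * ?s) - b * (b * ?r + c * ?s)"
        "(a * c - b\<^sup>2) * ?s = a * (b * ?r + c * ?s) - b * (a * ?r + b * ?s)"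
        by (simp_all add: power2_eq_square algebra_simps)
      then show "?r = 0" "?s = 0" using d unfolding e by simp_all
    qed
    show "index_type p l x n" unfolding index_type_def using n 1 2 3 by blast
  qed
  then show ?thesis by (simp only: l_def x_def)
qed

section \<open>Subdivision trees at p = 4\<close>

text \<open>The suffix of \<open>poly\<close>, \<open>tree\<close> and \<open>check\<close> is the vertex whose coordinate is normalized to \<open>1\<close>.  The trees
  were found by an adaptive search; the tables \<open>pw\<close> hold the Bernstein coefficients of the powers of the
  affine parametrization of the sides of the rectangle, cleared of denominators.\<close>

definition pw_quarter :: coeffs where
  "pw_quarter = [[61440, 61440, 61440, 61440, 61440, 61440, 61440],
    [- 15360, - 10240, - 5120, 0, 5120, 10240, 15360],
    [3840, 1280, - 256, - 768, - 256, 1280, 3840],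
    [- 960, 0, 192, 0, - 192, 0, 960],
    [240, - 80, - 16, 48, - 16, - 80, 240],
    [- 60, 40, - 20, 0, 20, - 40, 60],
    [15, - 15, 15, - 15, 15, - 15, 15]]"

definition pw_32nd :: coeffs where
  "pw_32nd = [[16106127360, 16106127360, 16106127360, 16106127360, 16106127360, 16106127360, 16106127360],
    [- 503316480, - 335544320, - 167772160, 0, 167772160, 335544320, 503316480],
    [15728640, 5242880, - 1048576, - 3145728, - 1048576, 5242880, 15728640],
    [- 491520, 0, 98304, 0, - 98304, 0, 491520],
    [15360, - 5120, - 1024, 3072, - 1024, - 5120, 15360],
    [- 480, 320, - 160, 0, 160, - 320, 480],
    [15, - 15, 15, - 15, 15, - 15, 15]]"

lemma powers_pw_quarter: "powers pw_quarter 61440 (- 1 / 4) (1 / 2)"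
  by (rule powers_I) (auto simp: square7_def pw_quarter_def all_less_7 bez_6 power_divide field_simps, algebra+)

lemma powers_pw_32nd: "powers pw_32nd 16106127360 (- 1 / 32) (1 / 16)"
  by (rule powers_I) (auto simp: square7_def pw_32nd_def all_less_7 bez_6 power_divide field_simps, algebra+)

text \<open>Coefficients of \<open>Fc\<close> at exponent 4: rows are indexed by the power of
  \<open>u\<close>, positions in a row by the power of \<open>v\<close>; trailing zeros of a row are
  omitted.\<close>

definition poly_2a :: coeffs where
  "poly_2a = [[4212267890, 0, 0, 1881641240],
    [12636803670, 0, 5644923720],
    [12636803670, 5644923720],
    [- 106159608534, - 319344536826, - 319344536826, - 106448178942],
    [- 325384585785],
    [- 325384585785],
    [- 108461528595]]"

definition poly_2b :: coeffs where
  "poly_2b = [[4134076404, 12402229212, 12402229212, - 185940955837824180276, - 538176758684041208574, - 538176758684041208574, - 179392252894680402858],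
    [0, 0, 5644923720, - 548355777255505565715],
    [0, 5644923720, 0, - 548355777255505565715],
    [1881641240, 0, 0, - 182785259085168521905],
    [0],
    [0],
    [0]]"

lemma poly_2a: "poly2 poly_2a u v = Fc 4 1 3 2 u v"
  by (simp add: poly_2a_def Fc_def Ef_def Phi_4 power3_eq_cube algebra_simps)

lemma poly_2b: "poly2 poly_2b u v = Fc 4 3 1 2 v u"
  by (simp add: poly_2b_def Fc_def Ef_def Phi_4 power3_eq_cube algebra_simps)

text \<open>On this rectangle the first equation alone has no zero, so no eigenline is dominated by
  the coordinate at vertex 2 to this extent.\<close>

definition tree_2 :: tree where
  "tree_2 =
    Excl 1 0"

lemma check_2:
  "check False 1
     (map (map (drop_bit 53)) (bernstein pw_quarter pw_32nd poly_2a))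
     (map (map (drop_bit 74)) (bernstein pw_quarter pw_32nd poly_2b)) tree_2"
  by code_simp

definition pw_8 :: coeffs where
  "pw_8 = [[15, 15, 15, 15, 15, 15, 15],
    [- 120, - 80, - 40, 0, 40, 80, 120],
    [960, 320, - 64, - 192, - 64, 320, 960],
    [- 7680, 0, 1536, 0, - 1536, 0, 7680],
    [61440, - 20480, - 4096, 12288, - 4096, - 20480, 61440],
    [- 491520, 327680, - 163840, 0, 163840, - 327680, 491520],
    [3932160, - 3932160, 3932160, - 3932160, 3932160, - 3932160, 3932160]]"

definition pw_32 :: coeffs where
  "pw_32 = [[15, 15, 15, 15, 15, 15, 15],
    [- 480, - 320, - 160, 0, 160, 320, 480],
    [15360, 5120, - 1024, - 3072, - 1024, 5120, 15360],
    [- 491520, 0, 98304, 0, - 98304, 0, 491520],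
    [15728640, - 5242880, - 1048576, 3145728, - 1048576, - 5242880, 15728640],
    [- 503316480, 335544320, - 167772160, 0, 167772160, - 335544320, 503316480],
    [16106127360, - 16106127360, 16106127360, - 16106127360, 16106127360, - 16106127360, 16106127360]]"

lemma powers_pw_8: "powers pw_8 15 (- 8) 16"
  by (rule powers_I) (auto simp: square7_def pw_8_def all_less_7 bez_6 power_divide field_simps, algebra+)

lemma powers_pw_32: "powers pw_32 15 (- 32) 64"
  by (rule powers_I) (auto simp: square7_def pw_32_def all_less_7 bez_6 power_divide field_simps, algebra+)

definition poly_3a :: coeffs where
  "poly_3a = [[81651094028290247980, 0, 0, 182785259085168521905],
    [244953282084870743940, 0, 548355777255505565715],
    [244953282084870743940, 548355777255505565715],
    [181144402076132498955, - 319344536826, - 319344536826, - 106448178942],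
    [- 145350930060],
    [- 145350930060],
    [- 48450310020]]"

definition poly_3b :: coeffs where
  "poly_3b = [[179392252894680402858, 538176758684041208574, 538176758684041208574, 185940955837824180276, - 12402229212, - 12402229212, - 4134076404],
    [0, 0, 548355777255505565715, - 5644923720],
    [0, 548355777255505565715, 0, - 5644923720],
    [182785259085168521905, 0, 0, - 1881641240],
    [0],
    [0],
    [0]]"

lemma poly_3a: "poly2 poly_3a u v = Fc 4 1 2 3 u v"
  by (simp add: poly_3a_def Fc_def Ef_def Phi_4 power3_eq_cube algebra_simps)

lemma poly_3b: "poly2 poly_3b u v = Fc 4 2 1 3 v u"
  by (simp add: poly_3b_def Fc_def Ef_def Phi_4 power3_eq_cube algebra_simps)

definition tree_3 :: tree where
  "tree_3 =
    SplitT (SplitT (Excl (- 1) 0) (SplitT (Excl (- 1) 1) (SplitS (SplitT (Excl (- 1) 0) (SplitT (Excl (- 1) 0)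
    (SplitT (Excl (- 1) 0) (SplitS (Excl (- 1) 0) (SplitS (Excl (- 1) 0) (SplitS (Excl (- 1) 0) (SplitS (Excl
    (- 1) 0) (SplitT (SplitT (Excl 1 (- 16)) (Excl 1 (- 2))) (SplitT (SplitS (Excl (- 1) 1) (SplitT (SplitS
    (Solve 1254966 4 (- 3) 775699 (- 1) 2 (SplitS (Excl (- 1) 1) (SplitT (SplitS (SplitS (Here) (Excl 1 (-
    1))) (Excl 1 (- 1))) (Excl 0 1)))) (Excl 1 0)) (Excl 0 1))) (Excl 0 1)))))))))) (SplitS (SplitT (Excl (-
    1) 1) (SplitS (SplitT (Excl (- 1) 2) (SplitS (SplitT (Excl (- 1) 4) (SplitT (SplitT (SplitS (SplitS
    (SplitS (SplitS (SplitT (Excl (- 1) 0) (Solve 6089678 (- 1) 32 1529784 9 (- 16) (Here))) (Excl 0 1)) (Excl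
    0 1)) (Excl 1 0)) (Excl 1 0)) (Excl 1 0)) (Excl 1 0))) (Excl 1 0))) (Excl 1 0))) (Excl 1 1))))) (SplitS
    (SplitT (SplitT (SplitT (SplitT (SplitS (SplitS (Excl (- 1) 0) (Excl 16 (- 13))) (SplitT (SplitT (SplitS
    (Excl (- 1) 0) (Excl (- 2) 1)) (SplitS (SplitS (Excl 0 (- 1)) (SplitS (Excl 8 (- 5)) (SplitT (SplitT
    (SplitS (Excl 0 (- 1)) (SplitS (Excl 16 (- 9)) (SplitT (Solve 4971712 (- 16) 9 2887420 8 (- 3) (Here))
    (Excl 3 (- 1))))) (Excl 5 (- 2))) (Excl 1 0)))) (Excl (- 2) 1))) (SplitS (SplitT (SplitS (Excl 2 (- 1))
    (Excl 1 0)) (Excl 1 0)) (Excl 0 1)))) (SplitS (SplitS (SplitS (Excl 4 (- 3)) (Excl 8 (- 5))) (SplitS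
    (SplitT (Excl 2 (- 1)) (Excl 1 0)) (Excl 1 0))) (Excl 0 1))) (Excl 1 1)) (Excl 1 0)) (Excl 1 0)) (Excl 1
    0))"

lemma check_3:
  "check False 1
     (map (map (drop_bit 50)) (bernstein pw_8 pw_32 poly_3a))
     (map (map (drop_bit 50)) (bernstein pw_8 pw_32 poly_3b)) tree_3"
  by code_simp

definition pw_4 :: coeffs where
  "pw_4 = [[15, 15, 15, 15, 15, 15, 15],
    [- 60, - 40, - 20, 0, 20, 40, 60],
    [240, 80, - 16, - 48, - 16, 80, 240],
    [- 960, 0, 192, 0, - 192, 0, 960],
    [3840, - 1280, - 256, 768, - 256, - 1280, 3840],
    [- 15360, 10240, - 5120, 0, 5120, - 10240, 15360],
    [61440, - 61440, 61440, - 61440, 61440, - 61440, 61440]]"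

definition pw_slab :: coeffs where
  "pw_slab = [[1030792151040, 1030792151040, 1030792151040, 1030792151040, 1030792151040, 1030792151040, 1030792151040],
    [- 161061273600, - 110058536960, - 59055800320, - 8053063680, 42949672960, 93952409600, 144955146240],
    [25165824000, 9227468800, - 654311424, - 4479516672, - 2248146944, 6039797760, 20384317440],
    [- 3932160000, - 196608000, 699924480, 105971712, - 629932032, - 159252480, 2866544640],
    [614400000, - 163840000, - 54886400, 98426880, - 12939264, - 164229120, 403107840],
    [- 96000000, 56000000, - 23040000, - 3888000, 25660800, - 43040160, 56687040],
    [15000000, - 13500000, 12150000, - 10935000, 9841500, - 8857350, 7971615]]"

lemma powers_pw_4: "powers pw_4 15 (- 4) 8"
  by (rule powers_I) (auto simp: square7_def pw_4_def all_less_7 bez_6 power_divide field_simps, algebra+)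

text \<open>The side from -5/32 to 9/64 contains the required range |v| \<le> 1/8. Because of the
  factor 19, no dyadic subdivision line is v = 0, although all six solved pieces of this chart lie
  within |v| < 1/100.\<close>

lemma powers_pw_slab: "powers pw_slab 1030792151040 (- 5 / 32) (19 / 64)"
  by (rule powers_I) (auto simp: square7_def pw_slab_def all_less_7 bez_6 power_divide field_simps, algebra+)

definition poly_1a :: coeffs where
  "poly_1a = [[108461528595, 0, 0, 106448178942],
    [325384585785, 0, 319344536826],
    [325384585785, 319344536826],
    [106159608534, - 5644923720, - 5644923720, - 1881641240],
    [- 12636803670],
    [- 12636803670],
    [- 4212267890]]"

definition poly_1b :: coeffs where
  "poly_1b = [[48450310020, 145350930060, 145350930060, - 181144402076132498955, - 244953282084870743940, - 244953282084870743940, - 81651094028290247980],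
    [0, 0, 319344536826, - 548355777255505565715],
    [0, 319344536826, 0, - 548355777255505565715],
    [106448178942, 0, 0, - 182785259085168521905],
    [0],
    [0],
    [0]]"

lemma poly_1a: "poly2 poly_1a u v = Fc 4 2 3 1 u v"
  by (simp add: poly_1a_def Fc_def Ef_def Phi_4 power3_eq_cube algebra_simps)

lemma poly_1b: "poly2 poly_1b u v = Fc 4 3 2 1 v u"
  by (simp add: poly_1b_def Fc_def Ef_def Phi_4 power3_eq_cube algebra_simps)

definition tree_1 :: tree where
  "tree_1 =
    SplitS (SplitS (Excl (- 4096) 1) (SplitS (SplitT (Excl (- 1) 0) (SplitS (SplitT (Excl (- 16) 1) (Excl 640
    1)) (SplitT (SplitT (SplitT (SplitT (Excl (- 1) 0) (SplitS (Excl (- 1) 0) (SplitT (Excl (- 1) (- 4))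
    (SplitT (SplitS (SplitS (Excl (- 1) 0) (SplitS (Excl 0 1) (SplitT (Excl (- 1) (- 2)) (SplitT (Solve
    1148003508 0 (- 1) 971691591 1 2 (SplitT (SplitS (Excl 0 1) (SplitT (SplitS (Excl 2 15) (SplitT (SplitS
    (SplitS (SplitS (SplitS (Here) (Excl (- 1) (- 4))) (Excl (- 1) (- 4))) (Excl 0 (- 1))) (Excl 1 0)) (Excl 1
    0))) (Excl 1 2))) (Excl 1 2))) (Excl 1 0))))) (Excl (- 1) (- 8))) (Excl 8 9))))) (SplitT (SplitS (Excl 1
    1) (Excl 8 1)) (Excl 20 1))) (Excl 256 1)) (Excl 1 0)))) (SplitS (SplitT (SplitS (Excl (- 1) 0) (SplitT
    (Excl 512 (- 1)) (SplitS (SplitT (Excl (- 1) 0) (SplitT (Excl 64 (- 3)) (SplitS (SplitT (Excl 0 (- 1))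
    (SplitS (SplitS (Excl (- 1) 0) (SplitT (Excl (- 1) 0) (SplitT (Excl 0 (- 1)) (SplitS (Excl 11 (- 16))
    (Excl 1 (- 1)))))) (SplitT (SplitS (Excl 2 (- 1)) (Excl 4 (- 1))) (SplitT (SplitS (Excl 2 (- 1)) (Excl 1
    0)) (Excl 1 0))))) (SplitS (SplitT (Excl 9 (- 1)) (Excl 1 0)) (Excl 1 0))))) (SplitT (SplitS (Excl 128 (-
    1)) (Excl 512 (- 1))) (Excl 128 (- 1)))))) (SplitT (SplitT (SplitT (SplitT (SplitS (SplitS (Excl (- 1) 0)
    (SplitS (Excl (- 1) (- 4)) (SplitS (SplitT (Excl (- 1) 0) (Excl 0 (- 1))) (SplitS (SplitT (Excl (- 1) 0)
    (SplitT (SplitT (Excl 1 (- 40)) (Excl 1 (- 64))) (Excl 1 0))) (SplitT (SplitT (Excl (- 1) 0) (SplitT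
    (SplitS (Excl (- 1) 0) (SplitT (Excl (- 2) 9) (SplitT (SplitS (Excl (- 1) 0) (Excl (- 1) 7)) (SplitS (Excl
    (- 1) 8) (Excl (- 1) 10))))) (SplitS (SplitS (SplitT (Excl (- 1) 0) (SplitT (Excl (- 1) 0) (Excl 7 (-
    128)))) (SplitT (SplitT (Excl (- 1) 0) (SplitS (Excl (- 1) 0) (Excl (- 1) 12))) (SplitT (SplitT (Excl (-
    9) 128) (SplitT (Excl (- 1) 16) (SplitT (Excl (- 1) 16) (Excl (- 15) 256)))) (SplitT (SplitT (SplitS
    (SplitS (Solve 408498063 (- 13) 256 819132431 61 (- 1024) (SplitT (SplitS (SplitS (SplitT (SplitS (SplitS
    (Excl (- 1) 0) (SplitT (Excl (- 1) 0) (SplitS (Excl 1 (- 18)) (Here)))) (Excl (- 7) 128)) (Excl 1 (- 16)))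
    (Excl 1 0)) (Excl 1 0)) (Excl 1 0))) (Excl 1 0)) (Excl 1 0)) (Excl 1 0)) (Excl 1 0))))) (SplitT (SplitS
    (SplitT (Excl (- 1) 10) (Excl (- 1) 16)) (Excl 1 0)) (Excl 1 0))))) (Excl 1 (- 18))))))) (SplitT (SplitS
    (SplitS (SplitS (SplitT (SplitS (SplitT (SplitS (Excl (- 1) 0) (SplitT (Excl 4 (- 9)) (SplitS (Excl 3 (-
    8)) (Excl 4 (- 9))))) (SplitS (SplitT (SplitT (Excl (- 1) 0) (Excl (- 1) 3)) (SplitT (SplitT (Excl (- 2)
    7) (Excl (- 4) 15)) (SplitS (Excl (- 1) 4) (Excl (- 2) 9)))) (SplitS (SplitT (SplitT (SplitS (SplitT (Excl
    (- 1) 0) (SplitT (Excl (- 2) 5) (Excl (- 11) 32))) (SplitS (SplitT (SplitT (Excl 4 (- 11)) (SplitS (Excl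
    (- 3) 8) (SplitS (SplitT (Solve 326475140 97 (- 256) 152637429 (- 93) 256 (SplitT (SplitS (Here) (SplitT
    (Excl 4 (- 11)) (SplitS (SplitT (Here) (Excl (- 4) 11)) (Excl 1 0)))) (Excl (- 4) 11))) (Excl 1 0)) (Excl
    1 0)))) (Excl (- 11) 32)) (Excl 2 (- 5)))) (SplitS (SplitT (SplitS (Excl (- 1) 3) (Excl (- 5) 16)) (Excl
    (- 1) 4)) (Excl 1 0))) (Excl 1 0)) (Excl 1 0)))) (SplitT (Excl 2 (- 3)) (Excl 1 0))) (SplitT (SplitT
    (SplitT (SplitT (Excl (- 13) 64) (Excl (- 3) 16)) (Excl (- 5) 32)) (Excl 1 0)) (Excl 1 0))) (Excl 1 0))
    (Excl 1 0)) (Excl 1 0)) (Excl 1 0))) (SplitS (SplitT (SplitS (SplitT (Excl (- 1) 0) (SplitT (SplitS (Excl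
    (- 1) 0) (SplitS (Excl (- 1) 0) (SplitT (Excl (- 1) (- 8)) (SplitS (SplitT (Excl (- 1) 0) (Excl 1 24))
    (SplitS (SplitS (SplitT (SplitT (Excl (- 1) 0) (SplitT (Excl (- 1) 0) (Solve 87044493 (- 1) (- 32)
    389973606 9 128 (SplitS (Excl (- 1) 0) (SplitS (SplitT (Excl (- 1) 0) (SplitS (SplitS (Excl 0 1) (SplitS
    (Here) (SplitS (Here) (Excl (- 1) (- 32))))) (Excl (- 1) (- 32)))) (Excl (- 1) (- 32))))))) (Excl 9 128))
    (Excl (- 1) (- 32))) (Excl 0 (- 1))))))) (SplitT (SplitS (Excl (- 1) 8) (SplitS (Excl 1 18) (Excl 1 8)))
    (SplitS (SplitT (SplitS (Excl (- 1) (- 8)) (SplitS (Solve 880660870 1 16 453311635 1 (- 16) (SplitT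
    (SplitT (Excl (- 1) 0) (SplitT (Excl (- 1) 16) (SplitS (Excl 0 (- 1)) (SplitT (SplitS (SplitT (SplitS
    (Excl (- 1) 0) (SplitT (Excl (- 1) 8) (Here))) (Excl 1 (- 24))) (Here)) (Here))))) (Here))) (Excl 1 16)))
    (Excl 0 (- 1))) (Excl 1 0))))) (SplitT (Excl 0 (- 1)) (Excl 0 (- 1)))) (Excl 1 0)) (Excl 1 0))) (Excl 1
    0)) (Excl 1 0)) (Excl 1 0))) (Excl 9216 (- 1))))) (SplitT (Excl 0 1) (SplitT (SplitS (Excl 1 0) (SplitS
    (SplitT (SplitT (SplitT (SplitS (Excl 1 0) (SplitT (Excl 0 1) (SplitT (Excl 0 1) (SplitT (Excl 0 1)
    (SplitT (SplitS (Excl 1 0) (Solve 29605388152 (- 1) 0 14675562821 0 (- 1) (Here))) (Excl 0 (- 1)))))))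
    (Excl 0 (- 1))) (Excl 0 (- 1))) (Excl 0 (- 1))) (Excl (- 1) 0))) (Excl 0 (- 1))))"

lemma check_1:
  "check False 1
     (map (map (drop_bit 37)) (bernstein pw_4 pw_slab poly_1a))
     (map (map (drop_bit 47)) (bernstein pw_4 pw_slab poly_1b)) tree_1"
  by code_simp

section \<open>The nine eigenlines\<close>

text \<open>\<kappa>1 and \<kappa>2 collect the denominators of the tables and the dropped bits;
  only their positivity matters later.\<close>

lemma covered_chart:
  assumes chk: "check False 1 (map (map (drop_bit m)) (bernstein W1 W2 M)) (map (map (drop_bit m')) (bernstein W1 W2 M')) T"
    and W: "powers W1 q1 x h" "powers W2 q2 y w"
    and M: "\<And>u v. poly2 M u v = Fc 4 i j k u v" "length M = 7" "\<forall>r\<in>set M. length r \<le> 7"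
    and M': "\<And>u v. poly2 M' u v = Fc 4 j i k v u" "length M' = 7" "\<forall>r\<in>set M'. length r \<le> 7"
    and pos: "h > 0" "w > 0" "q1 > 0" "q2 > 0"
  shows "\<exists>\<kappa>1 > 0. \<exists>\<kappa>2 > 0. covered (\<lambda>u v. \<kappa>1 * Fc 4 i j k u v) (\<lambda>u v. \<kappa>2 * Fc 4 j i k v u) False (x, h, y, w) T"
proof -
  define \<kappa>1 where "\<kappa>1 = q1 * q2 / 2 ^ m"
  define \<kappa>2 where "\<kappa>2 = q1 * q2 / 2 ^ m'"
  have "covered (\<lambda>u v. \<kappa>1 * Fc 4 i j k u v) (\<lambda>u v. \<kappa>2 * Fc 4 j i k v u) False (x, h, y, w) T"
    using check_sound[OF chk pos(1,2), of "\<lambda>u v. \<kappa>1 * Fc 4 i j k u v" x y "\<lambda>u v. \<kappa>2 * Fc 4 j i k v u"]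
      rep_bernstein[OF W M(2,3), of m] rep_bernstein[OF W M'(2,3), of m']
    by (simp add: M(1) M'(1) \<kappa>1_def \<kappa>2_def)
  moreover have "\<kappa>1 > 0" "\<kappa>2 > 0" using pos by (simp_all add: \<kappa>1_def \<kappa>2_def)
  ultimately show ?thesis by blast
qed

lemma covered_2: "\<exists>\<kappa>1 > 0. \<exists>\<kappa>2 > 0. covered (\<lambda>u v. \<kappa>1 * Fc 4 1 3 2 u v) (\<lambda>u v. \<kappa>2 * Fc 4 3 1 2 v u) False
    (- (1 / 4), 1 / 2, - (1 / 32), 1 / 16) tree_2"
  by (rule covered_chart[OF check_2 powers_pw_quarter powers_pw_32nd poly_2a _ _ poly_2b, simplified])
     (simp_all add: poly_2a_def poly_2b_def)

lemma covered_3: "\<exists>\<kappa>1 > 0. \<exists>\<kappa>2 > 0. covered (\<lambda>u v. \<kappa>1 * Fc 4 1 2 3 u v) (\<lambda>u v. \<kappa>2 * Fc 4 2 1 3 v u) False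
    (- 8, 16, - 32, 64) tree_3"
  by (rule covered_chart[OF check_3 powers_pw_8 powers_pw_32 poly_3a _ _ poly_3b, simplified])
     (simp_all add: poly_3a_def poly_3b_def)

lemma covered_1: "\<exists>\<kappa>1 > 0. \<exists>\<kappa>2 > 0. covered (\<lambda>u v. \<kappa>1 * Fc 4 2 3 1 u v) (\<lambda>u v. \<kappa>2 * Fc 4 3 2 1 v u) False
    (- 4, 8, - (5 / 32), 19 / 64) tree_1"
  by (rule covered_chart[OF check_1 powers_pw_4 powers_pw_slab poly_1a _ _ poly_1b, simplified])
     (simp_all add: poly_1a_def poly_1b_def)

lemma solves_2: "solves b tree_2 = []"
  by (cases b) (simp add: tree_2_def)

text \<open>Each entry lists a solved rectangle, its preconditioner, and the smaller rectangles in
  which its zero at exponent 4 can lie.\<close>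

lemma solves_3: "solves (- 8, 16, - 32, 64) tree_3 = [
     ((- 1 / 4, 1 / 8, - 1 / 2, 1 / 8), (4, - 3, - 1, 2),
      [(- 3 / 16, 1 / 64, - 1 / 2, 1 / 16)]),
     ((0, 1 / 16, - 7 / 8, 1 / 8), (- 1, 32, 9, - 16),
      [(0, 1 / 16, - 7 / 8, 1 / 8)]),
     ((- 17 / 8, 1 / 8, 1 / 2, 1 / 16), (- 16, 9, 8, - 3),
      [(- 17 / 8, 1 / 8, 1 / 2, 1 / 16)])]"
  by (simp add: tree_3_def)

lemma solves_1: "solves (- 4, 8, - (5 / 32), 19 / 64) tree_1 = [
     ((- 37 / 32, 1 / 32, 119 / 16384, 19 / 32768), (0, - 1, 1, 2),
      [(- 145 / 128, 1 / 2048, 119 / 16384, 19 / 262144)]),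
     ((- 195 / 256, 1 / 1024, - 227 / 65536, 19 / 262144), (- 13, 256, 61, - 1024),
      [(- 24957 / 32768, 1 / 32768, - 7245 / 2097152, 19 / 2097152)]),
     ((- 1515 / 2048, 1 / 4096, - 1725 / 262144, 19 / 524288), (97, - 256, - 93, 256),
      [(- 1515 / 2048, 1 / 8192, - 1725 / 262144, 19 / 1048576),
       (- 6059 / 8192, 1 / 16384, - 13781 / 2097152, 19 / 4194304)]),
     ((- 57 / 64, 1 / 256, 1201 / 262144, 19 / 262144), (- 1, - 32, 9, 128),
      [(- 3639 / 4096, 1 / 8192, 2421 / 524288, 19 / 524288),
       (- 7277 / 8192, 1 / 16384, 2421 / 524288, 19 / 524288)]),
     ((- 31 / 32, 1 / 64, 181 / 32768, 19 / 65536), (1, 16, 1, - 16),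
      [(- 491 / 512, 1 / 512, 23643 / 4194304, 19 / 4194304),
       (- 245 / 256, 1 / 256, 2953 / 524288, 19 / 1048576),
       (- 123 / 128, 1 / 128, 5925 / 1048576, 19 / 1048576),
       (- 31 / 32, 1 / 64, 743 / 131072, 19 / 131072)]),
     ((11 / 4, 1 / 4, 5 / 16384, 19 / 32768), (- 1, 0, 0, - 1),
      [(11 / 4, 1 / 4, 5 / 16384, 19 / 32768)])]"
  by (simp add: tree_1_def)

section \<open>Isolated eigenlines and their persistence\<close>

definition in_open :: "box \<Rightarrow> real \<Rightarrow> real \<Rightarrow> bool" where
  "in_open b u v = (case b of (x, h, y, k) \<Rightarrow> u \<in> {x<..<x + h} \<and> v \<in> {y<..<y + k})"

text \<open>Confinement to the open rectangle is part of the claim: the cells must be open for their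
  complement in the sphere to be compact.\<close>

definition isolated :: "real \<Rightarrow> 3 \<Rightarrow> 3 \<Rightarrow> 3 \<Rightarrow> box \<Rightarrow> real \<Rightarrow> real \<Rightarrow> nat \<Rightarrow> bool" where
  "isolated p i j k b lo hi n \<longleftrightarrow> (\<exists>x l. eigenpair p signed_triangle x l \<and> lo < l \<and> l < hi \<and> index_type p l x n \<and>
     (\<forall>x' l'. eigenpair p signed_triangle x' l' \<longrightarrow> x' $ k \<noteq> 0 \<longrightarrow> in_box b (x' $ i / x' $ k) (x' $ j / x' $ k) \<longrightarrow>
        x' \<in> span {x} \<and> in_open b (x' $ i / x' $ k) (x' $ j / x' $ k)))"

lemma continuous_on_Hd [continuous_intros]:
  assumes "continuous_on S a" "continuous_on S b" "continuous_on S c" "\<And>x. x \<in> S \<Longrightarrow> a x > 2"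
  shows "continuous_on S (\<lambda>x. Hd (a x) i j k (b x) (c x))"
  using assms unfolding Hd_def by (auto intro!: continuous_intros)

text \<open>The bounds at exponent 4 are demanded at zeros only, which leaves room for refined
  location. The sign of the integer determinant passes to the Jacobian and, through the positive
  factor \<open>R\<close>, to the determinant of the Hessian.\<close>

lemma isolated_near:
  fixes x h y w :: real
  assumes p3: "perm3 i j k"
    and sol: "solvable (\<lambda>u v. \<kappa>1 * Fc 4 i j k u v) (\<lambda>u v. \<kappa>2 * Fc 4 j i k v u) (x, h, y, w) (c11, c12, c21, c22)"
    and pos: "h > 0" "w > 0" "\<kappa>1 > 0" "\<kappa>2 > 0"
    and at4: "\<And>u v. in_box (x, h, y, w) u v \<Longrightarrow> Fc 4 i j k u v = 0 \<Longrightarrow> Fc 4 j i k v u = 0 \<Longrightarrow>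
      lo < lam 4 i j k u v \<and> lam 4 i j k u v < hi \<and> (n = 0 \<longrightarrow> 0 < Hd 4 i j k u v) \<and> (n = 2 \<longrightarrow> Hd 4 j i k v u < 0)"
    and n: "n = 0 \<and> 0 < c11 * c22 - c12 * c21 \<or> n = 2 \<and> 0 < c11 * c22 - c12 * c21 \<or> n = 1 \<and> c11 * c22 - c12 * c21 < 0"
  shows "\<forall>\<^sub>F p in nhds 4. isolated p i j k (x, h, y, w) lo hi n"
proof -
  let ?K = "{x..x + h} \<times> {y..y + w}"
  \<comment> \<open>A sum of squares merges both equations into the single scalar condition of
    \<open>eventually_compact_param\<close>.\<close>
  define f where "f p z = (Fc p i j k (fst z) (snd z))\<^sup>2 + (Fc p j i k (snd z) (fst z))\<^sup>2" for p and z :: "real \<times> real"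
  have f0: "f p z = 0 \<longleftrightarrow> Fc p i j k (fst z) (snd z) = 0 \<and> Fc p j i k (snd z) (fst z) = 0" for p z
    by (auto simp: f_def add_nonneg_eq_0_iff)
  have K: "compact ?K" by (intro compact_Times) auto
  have cf: "continuous_on ({3..5} \<times> ?K) (\<lambda>(p, z). f p z)"
    unfolding f_def case_prod_unfold by (intro continuous_intros) auto
  have near: "\<forall>\<^sub>F p in nhds 4. \<forall>z\<in>?K. f p z = 0 \<longrightarrow> 0 < g p z"
    if "continuous_on ({3..5} \<times> ?K) (\<lambda>(p, z). g p z)" "\<And>z. z \<in> ?K \<Longrightarrow> f 4 z = 0 \<Longrightarrow> 0 < g 4 z" for g :: "real \<Rightarrow> real \<times> real \<Rightarrow> real"
    by (rule eventually_compact_param[where lo = 3 and hi = 5 and f = f and g = g, OF K]) (use cf that in auto)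
  have "\<forall>\<^sub>F p in nhds 4. \<forall>z\<in>?K. f p z = 0 \<longrightarrow> 0 < lam p i j k (fst z) (snd z) - lo"
    by (rule near) (use at4 f0 in \<open>auto simp: case_prod_unfold in_box_def intro!: continuous_intros\<close>)
  moreover have "\<forall>\<^sub>F p in nhds 4. \<forall>z\<in>?K. f p z = 0 \<longrightarrow> 0 < hi - lam p i j k (fst z) (snd z)"
    by (rule near) (use at4 f0 in \<open>auto simp: case_prod_unfold in_box_def intro!: continuous_intros\<close>)
  \<comment> \<open>The default 1 makes the condition trivially true when \<open>n\<close> does not
    ask for this sign.\<close>
  moreover have "\<forall>\<^sub>F p in nhds 4. \<forall>z\<in>?K. f p z = 0 \<longrightarrow> 0 < (if n = 0 then Hd p i j k (fst z) (snd z) else 1)"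
    by (rule near; cases "n = 0") (use at4 f0 in \<open>auto simp: case_prod_unfold in_box_def intro!: continuous_intros\<close>)
  moreover have "\<forall>\<^sub>F p in nhds 4. \<forall>z\<in>?K. f p z = 0 \<longrightarrow> 0 < (if n = 2 then - Hd p j i k (snd z) (fst z) else 1)"
    by (rule near; cases "n = 2") (use at4 f0 in \<open>auto simp: case_prod_unfold in_box_def intro!: continuous_intros\<close>)
  moreover have "\<forall>\<^sub>F p in nhds (4 :: real). p > 2"
    by (rule eventually_nhds_in_open[of "{2<..}", THEN eventually_mono]) auto
  moreover note solvable_near[OF sol pos]
  ultimately show ?thesis
  proof eventually_elim
    case (elim p)
    have p: "p > 2" by fact
    obtain u v where uv: "in_box (x, h, y, w) u v" and F: "Fc p i j k u v = 0" "Fc p j i k v u = 0"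
      using elim(6) by blast
    have z: "(u, v) \<in> ?K" "f p (u, v) = 0" using uv F f0[of p "(u, v)"] by (auto simp: in_box_def)
    define a where "a = Hd p i j k u v"
    define b where "b = Ho p i j u v"
    define c where "c = Hd p j i k v u"
    define R where "R = ms k * (ms k + ms i * (u * Phi p u) + ms j * (v * Phi p v))"
    have nn: "0 \<le> u * Phi p u" "0 \<le> v * Phi p v"
      by (simp_all add: Phi_def mult.left_commute[of _ "_ powr _"])
    have "0 \<le> ms i * (u * Phi p u)" "0 \<le> ms j * (v * Phi p v)"
      by (rule mult_nonneg_nonneg[OF less_imp_le[OF ms_pos] nn(1)] mult_nonneg_nonneg[OF less_imp_le[OF ms_pos] nn(2)])+
    then have R: "R > 0"
      unfolding R_def using ms_pos[of k] by (intro mult_pos_pos) auto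
    have "0 < of_int (c11 * c22 - c12 * c21) * (R * (a * c - b\<^sup>2))"
      using elim(6) uv unfolding jacobian_hessian[OF F, folded a_def b_def c_def R_def, symmetric] by blast
    then have "0 < R * (of_int (c11 * c22 - c12 * c21) * (a * c - b\<^sup>2))"
      by (simp only: mult.left_commute)
    then have sg: "0 < real_of_int (c11 * c22 - c12 * c21) * (a * c - b\<^sup>2)"
      using R by (rule zero_less_mult_pos)
    have sgn: "0 < c11 * c22 - c12 * c21 \<Longrightarrow> 0 < a * c - b\<^sup>2" "c11 * c22 - c12 * c21 < 0 \<Longrightarrow> a * c - b\<^sup>2 < 0"
    proof -
      show "0 < a * c - b\<^sup>2" if "0 < c11 * c22 - c12 * c21"
        using sg by (rule zero_less_mult_pos) (use that in \<open>simp only: of_int_0_less_iff\<close>)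
      show "a * c - b\<^sup>2 < 0" if "c11 * c22 - c12 * c21 < 0"
        using sg that unfolding zero_less_mult_iff by (simp only: of_int_less_0_iff of_int_0_less_iff) linarith
    qed
    have ac: "n = 0 \<Longrightarrow> 0 < a" "n = 2 \<Longrightarrow> c < 0"
      using elim(3,4) z by (auto simp: a_def c_def)
    have it: "index_type p (lam p i j k u v) (cpt i j k u v) n"
      by (rule index_type_chart[OF p p3 F]) (use n sgn ac in \<open>auto simp: a_def b_def c_def\<close>)
    have ep: "eigenpair p signed_triangle (cpt i j k u v) (lam p i j k u v)"
      using eigenpair_cpt_iff[OF p3] F by blast
    have "x' \<in> span {cpt i j k u v} \<and> in_open (x, h, y, w) (x' $ i / x' $ k) (x' $ j / x' $ k)"
      if x': "eigenpair p signed_triangle x' l'" "x' $ k \<noteq> 0" "in_box (x, h, y, w) (x' $ i / x' $ k) (x' $ j / x' $ k)" for x' l'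
    proof -
      have "Fc p i j k (x' $ i / x' $ k) (x' $ j / x' $ k) = 0" "Fc p j i k (x' $ j / x' $ k) (x' $ i / x' $ k) = 0"
        using eigenpair_chart[OF p3 x'(2) refl refl] x'(1) by blast+
      then have e: "x' $ i / x' $ k = u" "x' $ j / x' $ k = v"
        using elim(6) uv F x'(3) by blast+
      then have "in_open (x, h, y, w) (x' $ i / x' $ k) (x' $ j / x' $ k)"
        using elim(6) uv F by (auto simp: in_open_def)
      moreover have "x' = x' $ k *\<^sub>R cpt i j k u v"
        using cpt_normalize[OF p3 x'(2)] e by simp
      then have "x' \<in> span {cpt i j k u v}" by (metis span_base span_scale insertI1)
      ultimately show ?thesis by blast
    qed
    then show ?case
      unfolding isolated_def using ep it elim(1,2) z
      by (intro exI[of _ "cpt i j k u v"] exI[of _ "lam p i j k u v"]) auto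
  qed
qed

text \<open>At exponent 4 the value \<open>lam\<close> is a nonnegative combination of the cubes of
  1 + u and 1 + v plus a constant, hence increasing in both variables: its extremes sit at two
  opposite corners.\<close>

lemma lam_bounds:
  assumes "in_box (x, h, y, w) u v"
  shows "lam 4 i j k x y \<le> lam 4 i j k u v" "lam 4 i j k u v \<le> lam 4 i j k (x + h) (y + w)"
proof -
  have wt0: "wt i j \<ge> 0" for i j by (simp add: wt_def signed_triangle_def)
  have "(1 + s) ^ 3 \<le> (1 + t) ^ 3" if "s \<le> t" for s t :: real
    using that by (intro power_mono_odd) auto
  then show "lam 4 i j k x y \<le> lam 4 i j k u v" "lam 4 i j k u v \<le> lam 4 i j k (x + h) (y + w)"
    using assms ms_pos[of k] wt0 unfolding lam_def Ef_def Phi_4 in_box_def prod.case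
    by (auto intro!: divide_right_mono add_mono mult_left_mono)
qed

definition located :: "3 \<Rightarrow> 3 \<Rightarrow> 3 \<Rightarrow> box \<Rightarrow> real \<Rightarrow> real \<Rightarrow> nat \<Rightarrow> bool" where
  "located i j k b lo hi n \<longleftrightarrow> (\<forall>u v. in_box b u v \<longrightarrow> lo < lam 4 i j k u v \<and> lam 4 i j k u v < hi \<and>
     (n = 0 \<longrightarrow> 0 < Hd 4 i j k u v) \<and> (n = 2 \<longrightarrow> Hd 4 j i k v u < 0))"

lemma located_1:
  assumes "lo < lam 4 i j k x y" "lam 4 i j k (x + h) (y + w) < hi"
  shows "located i j k (x, h, y, w) lo hi 1"
  unfolding located_def
proof (intro allI impI)
  fix u v assume b: "in_box (x, h, y, w) u v"
  show "lo < lam 4 i j k u v \<and> lam 4 i j k u v < hi \<and> (1 = (0 :: nat) \<longrightarrow> 0 < Hd 4 i j k u v) \<and>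
      (1 = (2 :: nat) \<longrightarrow> Hd 4 j i k v u < 0)"
    using lam_bounds[OF b, of i j k] assms by auto
qed

text \<open>\<open>dPhi\<close> at exponent 4 is 3 t^2, so a lower bound for the diagonal entry
  needs |u + v| \<ge> \<open>s1\<close> and |u + 1| \<ge> \<open>s2\<close> for the edge terms. The
  coefficient of u^2 is at least the nonpositive number \<open>pot i - hi * ms i\<close>, so there
  |u| \<le> \<open>s3\<close> is what counts.\<close>

lemma located_0:
  assumes lam: "lo < lam 4 i j k x y" "lam 4 i j k (x + h) (y + w) < hi"
    and s1: "0 \<le> s1" "s1 \<le> x + y \<or> s1 \<le> - (x + h + (y + w))"
    and s2: "0 \<le> s2" "s2 \<le> x + 1 \<or> s2 \<le> - (x + h + 1)"
    and s3: "- s3 \<le> x" "x + h \<le> s3"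
    and c: "pot i - hi * ms i \<le> 0" "0 < wt i j * s1\<^sup>2 + wt i k * s2\<^sup>2 + (pot i - hi * ms i) * s3\<^sup>2"
  shows "located i j k (x, h, y, w) lo hi 0"
  unfolding located_def
proof (intro allI impI)
  fix u v assume b: "in_box (x, h, y, w) u v"
  have l: "lo < lam 4 i j k u v" "lam 4 i j k u v < hi" using lam_bounds[OF b, of i j k] lam by auto
  have wt0: "wt i j \<ge> 0" for i j by (simp add: wt_def signed_triangle_def)
  have "s1 \<le> \<bar>u + v\<bar>" "s2 \<le> \<bar>u + 1\<bar>" "\<bar>u\<bar> \<le> \<bar>s3\<bar>" using b s1 s2 s3 by (auto simp: in_box_def)
  then have sq: "s1\<^sup>2 \<le> (u + v)\<^sup>2" "s2\<^sup>2 \<le> (u + 1)\<^sup>2" "u\<^sup>2 \<le> s3\<^sup>2"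
    using s1 s2 by (auto simp: abs_le_square_iff [symmetric])
  have "(pot i - hi * ms i) * s3\<^sup>2 \<le> (pot i - hi * ms i) * u\<^sup>2"
    using c(1) sq by (intro mult_left_mono_neg) auto
  also have "\<dots> \<le> (pot i - lam 4 i j k u v * ms i) * u\<^sup>2"
    using l ms_pos[of i] by (intro mult_right_mono) auto
  finally have "0 < wt i j * (u + v)\<^sup>2 + wt i k * (u + 1)\<^sup>2 + (pot i - lam 4 i j k u v * ms i) * u\<^sup>2"
    using c(2) mult_left_mono[OF sq(1) wt0[of i j]] mult_left_mono[OF sq(2) wt0[of i k]] by linarith
  then show "lo < lam 4 i j k u v \<and> lam 4 i j k u v < hi \<and> (0 = (0 :: nat) \<longrightarrow> 0 < Hd 4 i j k u v) \<and>
      (0 = (2 :: nat) \<longrightarrow> Hd 4 j i k v u < 0)"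
    using l by (simp add: Hd_def dPhi_4)
qed

text \<open>Here the entry at \<open>j\<close> is bounded from above. With nonnegative coordinates
  all squares are monotone, and replacing the spectral value by its lower bound \<open>lo\<close>
  only increases the entry.\<close>

lemma located_2:
  assumes lam: "lo < lam 4 i j k x y" "lam 4 i j k (x + h) (y + w) < hi"
    and nn: "0 \<le> x" "0 \<le> y" "0 \<le> h" "0 \<le> w"
    and c: "pot j - lo * ms j \<le> 0"
      "wt j i * (x + h + (y + w))\<^sup>2 + wt j k * (y + w + 1)\<^sup>2 + (pot j - lo * ms j) * y\<^sup>2 < 0"
  shows "located i j k (x, h, y, w) lo hi 2"
  unfolding located_def
proof (intro allI impI)
  fix u v assume b: "in_box (x, h, y, w) u v"
  have l: "lo < lam 4 i j k u v" "lam 4 i j k u v < hi" using lam_bounds[OF b, of i j k] lam by auto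
  have wt0: "wt i j \<ge> 0" for i j by (simp add: wt_def signed_triangle_def)
  have sq: "(v + u)\<^sup>2 \<le> (x + h + (y + w))\<^sup>2" "(v + 1)\<^sup>2 \<le> (y + w + 1)\<^sup>2" "y\<^sup>2 \<le> v\<^sup>2"
    using b nn by (auto simp: in_box_def intro!: power_mono)
  have "(pot j - lam 4 i j k u v * ms j) * v\<^sup>2 \<le> (pot j - lo * ms j) * v\<^sup>2"
    using l ms_pos[of j] by (intro mult_right_mono) auto
  also have "\<dots> \<le> (pot j - lo * ms j) * y\<^sup>2"
    using c(1) sq by (intro mult_left_mono_neg) auto
  finally have "wt j i * (v + u)\<^sup>2 + wt j k * (v + 1)\<^sup>2 + (pot j - lam 4 i j k u v * ms j) * v\<^sup>2 < 0"
    using c(2) mult_left_mono[OF sq(1) wt0[of j i]] mult_left_mono[OF sq(2) wt0[of j k]] by linarith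
  then show "lo < lam 4 i j k u v \<and> lam 4 i j k u v < hi \<and> (2 = (0 :: nat) \<longrightarrow> 0 < Hd 4 i j k u v) \<and>
      (2 = (2 :: nat) \<longrightarrow> Hd 4 j i k v u < 0)"
    using l by (simp add: Hd_def dPhi_4 lam_swap[of 4 j i])
qed

text \<open>The refined rectangles \<open>bs\<close> are used at exponent 4 alone, to bound the
  spectral value and a Hessian entry; existence, uniqueness and persistence concern the larger
  solved rectangle.\<close>

lemma isolated_solves:
  assumes cov: "covered (\<lambda>u v. \<kappa>1 * Fc 4 i j k u v) (\<lambda>u v. \<kappa>2 * Fc 4 j i k v u) False B T" "\<kappa>1 > 0" "\<kappa>2 > 0"
    and mem: "((x, h, y, w), (c11, c12, c21, c22), bs) \<in> set (solves B T)"
    and p3: "perm3 i j k" and pos: "h > 0" "w > 0"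
    and loc: "\<And>b. b \<in> set bs \<Longrightarrow> located i j k b lo hi n"
    and n: "n = 0 \<and> 0 < c11 * c22 - c12 * c21 \<or> n = 2 \<and> 0 < c11 * c22 - c12 * c21 \<or> n = 1 \<and> c11 * c22 - c12 * c21 < 0"
  shows "\<forall>\<^sub>F p in nhds 4. isolated p i j k (x, h, y, w) lo hi n"
proof (rule isolated_near[OF p3 _ pos cov(2,3) _ n])
  have *: "solvable (\<lambda>u v. \<kappa>1 * Fc 4 i j k u v) (\<lambda>u v. \<kappa>2 * Fc 4 j i k v u) (x, h, y, w) (c11, c12, c21, c22) \<and>
      (\<forall>u v. in_box (x, h, y, w) u v \<longrightarrow> \<kappa>1 * Fc 4 i j k u v = 0 \<longrightarrow> \<kappa>2 * Fc 4 j i k v u = 0 \<longrightarrow> (\<exists>b\<in>set bs. in_box b u v))"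
    using bspec[OF conjunct2[OF cov(1)[unfolded covered_def if_False]] mem] by simp
  then show "solvable (\<lambda>u v. \<kappa>1 * Fc 4 i j k u v) (\<lambda>u v. \<kappa>2 * Fc 4 j i k v u) (x, h, y, w) (c11, c12, c21, c22)" ..
  fix u v assume "in_box (x, h, y, w) u v" "Fc 4 i j k u v = 0" "Fc 4 j i k v u = 0"
  then obtain b where "b \<in> set bs" "in_box b u v"
    using conjunct2[OF *, rule_format, of u v] by (metis mult_zero_right)
  then show "lo < lam 4 i j k u v \<and> lam 4 i j k u v < hi \<and> (n = 0 \<longrightarrow> 0 < Hd 4 i j k u v) \<and> (n = 2 \<longrightarrow> Hd 4 j i k v u < 0)"
    using loc[of b] by (auto simp: located_def)
qed

type_synonym cell = "(3 \<times> 3 \<times> 3) \<times> box \<times> (real \<times> real) \<times> nat"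

text \<open>Listed by increasing spectral value. In the bounds with denominator \<open>ms 3\<close>
  the numerators are \<open>pot 3\<close> plus 1, 3.78, 3.79, 10, 15 and 40 million. The indices
  give 4 - 4 + 1 = 1, the Euler characteristic of the projective plane, as Morse theory
  requires.\<close>

definition cells :: "cell list" where
  "cells = [
     ((2, 3, 1), (- 37 / 32, 1 / 32, 119 / 16384, 19 / 32768), (- 3 / 10, 3 / 100), 0),
     ((2, 3, 1), (- 57 / 64, 1 / 256, 1201 / 262144, 19 / 262144), (31 / 1000, 75 / 1000), 0),
     ((2, 3, 1), (- 31 / 32, 1 / 64, 181 / 32768, 19 / 65536), (755 / 10000, 4 / 10), 1),
     ((2, 3, 1), (- 1515 / 2048, 1 / 4096, - 1725 / 262144, 19 / 524288), (7 / 10, 964 / 1000), 0),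
     ((2, 3, 1), (- 195 / 256, 1 / 1024, - 227 / 65536, 19 / 262144), (9645 / 10000, 9995 / 10000), 1),
     ((1, 2, 3), (- 1 / 4, 1 / 8, - 1 / 2, 1 / 8), (20915688727748 / 20915691304489, 20915691507748 / 20915691304489), 0),
     ((1, 2, 3), (0, 1 / 16, - 7 / 8, 1 / 8), (20915691517748 / 20915691304489, 20915697727748 / 20915691304489), 1),
     ((1, 2, 3), (- 17 / 8, 1 / 8, 1 / 2, 1 / 16), (20915702727748 / 20915691304489, 20915727727748 / 20915691304489), 1),
     ((2, 3, 1), (11 / 4, 1 / 4, 5 / 16384, 19 / 32768), (1000, 1000000), 2)]"

text \<open>Here and in the other index 0 cases the constants are the exact extremes on the
  rectangle: \<open>s1\<close> is minus the largest u + v, \<open>s2\<close> the distance of the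
  u-range from -1, and \<open>s3\<close> minus its left end.\<close>

lemma located_a0: "located 2 3 1 (- 145 / 128, 1 / 2048, 119 / 16384, 19 / 262144) (- 3 / 10) (3 / 100) 0"
  by (rule located_0[where ?s1.0 = "294909 / 262144" and ?s2.0 = "271 / 2048" and ?s3.0 = "145 / 128"]) (simp_all add: lam_def Ef_def Phi_4 power_divide)

lemma located_b0: "located 2 3 1 (- 3639 / 4096, 1 / 8192, 2421 / 524288, 19 / 524288) (31 / 1000) (75 / 1000) 0"
  by (rule located_0[where ?s1.0 = "57911 / 65536" and ?s2.0 = "457 / 4096" and ?s3.0 = "3639 / 4096"]) (simp_all add: lam_def Ef_def Phi_4 power_divide)

lemma located_b1: "located 2 3 1 (- 7277 / 8192, 1 / 16384, 2421 / 524288, 19 / 524288) (31 / 1000) (75 / 1000) 0"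
  by (rule located_0[where ?s1.0 = "57907 / 65536" and ?s2.0 = "915 / 8192" and ?s3.0 = "7277 / 8192"]) (simp_all add: lam_def Ef_def Phi_4 power_divide)

lemma located_c0: "located 2 3 1 (- 491 / 512, 1 / 512, 23643 / 4194304, 19 / 4194304) (755 / 10000) (4 / 10) 1"
  by (rule located_1) (simp_all add: lam_def Ef_def Phi_4 power_divide)

lemma located_c1: "located 2 3 1 (- 245 / 256, 1 / 256, 2953 / 524288, 19 / 1048576) (755 / 10000) (4 / 10) 1"
  by (rule located_1) (simp_all add: lam_def Ef_def Phi_4 power_divide)

lemma located_c2: "located 2 3 1 (- 123 / 128, 1 / 128, 5925 / 1048576, 19 / 1048576) (755 / 10000) (4 / 10) 1"
  by (rule located_1) (simp_all add: lam_def Ef_def Phi_4 power_divide)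

lemma located_c3: "located 2 3 1 (- 31 / 32, 1 / 64, 743 / 131072, 19 / 131072) (755 / 10000) (4 / 10) 1"
  by (rule located_1) (simp_all add: lam_def Ef_def Phi_4 power_divide)

lemma located_d0: "located 2 3 1 (- 1515 / 2048, 1 / 8192, - 1725 / 262144, 19 / 1048576) (7 / 10) (964 / 1000) 0"
  by (rule located_0[where ?s1.0 = "782433 / 1048576" and ?s2.0 = "533 / 2048" and ?s3.0 = "1515 / 2048"]) (simp_all add: lam_def Ef_def Phi_4 power_divide)

lemma located_d1: "located 2 3 1 (- 6059 / 8192, 1 / 16384, - 13781 / 2097152, 19 / 4194304) (7 / 10) (964 / 1000) 0"
  by (rule located_0[where ?s1.0 = "3129495 / 4194304" and ?s2.0 = "2133 / 8192" and ?s3.0 = "6059 / 8192"]) (simp_all add: lam_def Ef_def Phi_4 power_divide)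

lemma located_e0: "located 2 3 1 (- 24957 / 32768, 1 / 32768, - 7245 / 2097152, 19 / 2097152) (9645 / 10000) (9995 / 10000) 1"
  by (rule located_1) (simp_all add: lam_def Ef_def Phi_4 power_divide)

lemma located_f0: "located 1 2 3 (- 3 / 16, 1 / 64, - 1 / 2, 1 / 16) (20915688727748 / 20915691304489) (20915691507748 / 20915691304489) 0"
  by (rule located_0[where ?s1.0 = "39 / 64" and ?s2.0 = "13 / 16" and ?s3.0 = "3 / 16"]) (simp_all add: lam_def Ef_def Phi_4 power_divide)

lemma located_g0: "located 1 2 3 (0, 1 / 16, - 7 / 8, 1 / 8) (20915691517748 / 20915691304489) (20915697727748 / 20915691304489) 1"
  by (rule located_1) (simp_all add: lam_def Ef_def Phi_4 power_divide)

lemma located_h0: "located 1 2 3 (- 17 / 8, 1 / 8, 1 / 2, 1 / 16) (20915702727748 / 20915691304489) (20915727727748 / 20915691304489) 1"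
  by (rule located_1) (simp_all add: lam_def Ef_def Phi_4 power_divide)

lemma located_i0: "located 2 3 1 (11 / 4, 1 / 4, 5 / 16384, 19 / 32768) (1000) (1000000) 2"
  by (rule located_2) (simp_all add: lam_def Ef_def Phi_4 power_divide)

lemma isolated_1: "\<forall>\<^sub>F p in nhds 4. \<forall>((i, j, k), b, (lo, hi), n)\<in>set cells.
    k = 1 \<longrightarrow> isolated p i j k b lo hi n"
proof -
  obtain \<kappa>1 \<kappa>2 where cov: "covered (\<lambda>u v. \<kappa>1 * Fc 4 2 3 1 u v) (\<lambda>u v. \<kappa>2 * Fc 4 3 2 1 v u) False (- 4, 8, - (5 / 32), 19 / 64) tree_1" "\<kappa>1 > 0" "\<kappa>2 > 0"
    using covered_1 by blast
  have p3: "perm3 2 3 1" by (simp add: perm3_def)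
  note iso = isolated_solves[OF cov _ p3]
  have "\<forall>\<^sub>F p in nhds 4. isolated p 2 3 1 (- 37 / 32, 1 / 32, 119 / 16384, 19 / 32768) (- 3 / 10) (3 / 100) 0"
    by (rule iso[where bs = "[(- 145 / 128, 1 / 2048, 119 / 16384, 19 / 262144)]" and ?c11.0 = "0" and ?c12.0 = "- 1" and ?c21.0 = "1" and ?c22.0 = "2"])
       (use located_a0 in \<open>auto simp: solves_1\<close>)
  moreover have "\<forall>\<^sub>F p in nhds 4. isolated p 2 3 1 (- 57 / 64, 1 / 256, 1201 / 262144, 19 / 262144) (31 / 1000) (75 / 1000) 0"
    by (rule iso[where bs = "[(- 3639 / 4096, 1 / 8192, 2421 / 524288, 19 / 524288), (- 7277 / 8192, 1 / 16384, 2421 / 524288, 19 / 524288)]" and ?c11.0 = "- 1" and ?c12.0 = "- 32" and ?c21.0 = "9" and ?c22.0 = "128"])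
       (use located_b0 located_b1 in \<open>auto simp: solves_1\<close>)
  moreover have "\<forall>\<^sub>F p in nhds 4. isolated p 2 3 1 (- 31 / 32, 1 / 64, 181 / 32768, 19 / 65536) (755 / 10000) (4 / 10) 1"
    by (rule iso[where bs = "[(- 491 / 512, 1 / 512, 23643 / 4194304, 19 / 4194304), (- 245 / 256, 1 / 256, 2953 / 524288, 19 / 1048576), (- 123 / 128, 1 / 128, 5925 / 1048576, 19 / 1048576), (- 31 / 32, 1 / 64, 743 / 131072, 19 / 131072)]" and ?c11.0 = "1" and ?c12.0 = "16" and ?c21.0 = "1" and ?c22.0 = "- 16"])
       (use located_c0 located_c1 located_c2 located_c3 in \<open>auto simp: solves_1\<close>)
  moreover have "\<forall>\<^sub>F p in nhds 4. isolated p 2 3 1 (- 1515 / 2048, 1 / 4096, - 1725 / 262144, 19 / 524288) (7 / 10) (964 / 1000) 0"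
    by (rule iso[where bs = "[(- 1515 / 2048, 1 / 8192, - 1725 / 262144, 19 / 1048576), (- 6059 / 8192, 1 / 16384, - 13781 / 2097152, 19 / 4194304)]" and ?c11.0 = "97" and ?c12.0 = "- 256" and ?c21.0 = "- 93" and ?c22.0 = "256"])
       (use located_d0 located_d1 in \<open>auto simp: solves_1\<close>)
  moreover have "\<forall>\<^sub>F p in nhds 4. isolated p 2 3 1 (- 195 / 256, 1 / 1024, - 227 / 65536, 19 / 262144) (9645 / 10000) (9995 / 10000) 1"
    by (rule iso[where bs = "[(- 24957 / 32768, 1 / 32768, - 7245 / 2097152, 19 / 2097152)]" and ?c11.0 = "- 13" and ?c12.0 = "256" and ?c21.0 = "61" and ?c22.0 = "- 1024"])
       (use located_e0 in \<open>auto simp: solves_1\<close>)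
  moreover have "\<forall>\<^sub>F p in nhds 4. isolated p 2 3 1 (11 / 4, 1 / 4, 5 / 16384, 19 / 32768) (1000) (1000000) 2"
    by (rule iso[where bs = "[(11 / 4, 1 / 4, 5 / 16384, 19 / 32768)]" and ?c11.0 = "- 1" and ?c12.0 = "0" and ?c21.0 = "0" and ?c22.0 = "- 1"])
       (use located_i0 in \<open>auto simp: solves_1\<close>)
  ultimately show ?thesis
    by eventually_elim (simp add: cells_def)
qed

lemma isolated_3: "\<forall>\<^sub>F p in nhds 4. \<forall>((i, j, k), b, (lo, hi), n)\<in>set cells.
    k = 3 \<longrightarrow> isolated p i j k b lo hi n"
proof -
  obtain \<kappa>1 \<kappa>2 where cov: "covered (\<lambda>u v. \<kappa>1 * Fc 4 1 2 3 u v) (\<lambda>u v. \<kappa>2 * Fc 4 2 1 3 v u) False (- 8, 16, - 32, 64) tree_3" "\<kappa>1 > 0" "\<kappa>2 > 0"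
    using covered_3 by blast
  have p3: "perm3 1 2 3" by (simp add: perm3_def)
  note iso = isolated_solves[OF cov _ p3]
  have "\<forall>\<^sub>F p in nhds 4. isolated p 1 2 3 (- 1 / 4, 1 / 8, - 1 / 2, 1 / 8) (20915688727748 / 20915691304489) (20915691507748 / 20915691304489) 0"
    by (rule iso[where bs = "[(- 3 / 16, 1 / 64, - 1 / 2, 1 / 16)]" and ?c11.0 = "4" and ?c12.0 = "- 3" and ?c21.0 = "- 1" and ?c22.0 = "2"])
       (use located_f0 in \<open>auto simp: solves_3\<close>)
  moreover have "\<forall>\<^sub>F p in nhds 4. isolated p 1 2 3 (0, 1 / 16, - 7 / 8, 1 / 8) (20915691517748 / 20915691304489) (20915697727748 / 20915691304489) 1"
    by (rule iso[where bs = "[(0, 1 / 16, - 7 / 8, 1 / 8)]" and ?c11.0 = "- 1" and ?c12.0 = "32" and ?c21.0 = "9" and ?c22.0 = "- 16"])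
       (use located_g0 in \<open>auto simp: solves_3\<close>)
  moreover have "\<forall>\<^sub>F p in nhds 4. isolated p 1 2 3 (- 17 / 8, 1 / 8, 1 / 2, 1 / 16) (20915702727748 / 20915691304489) (20915727727748 / 20915691304489) 1"
    by (rule iso[where bs = "[(- 17 / 8, 1 / 8, 1 / 2, 1 / 16)]" and ?c11.0 = "- 16" and ?c12.0 = "9" and ?c21.0 = "8" and ?c22.0 = "- 3"])
       (use located_h0 in \<open>auto simp: solves_3\<close>)
  ultimately show ?thesis
    by eventually_elim (simp add: cells_def)
qed

section \<open>No eigenlines outside the nine cells\<close>

fun in_cell :: "cell \<Rightarrow> real ^ 3 \<Rightarrow> bool" where
  "in_cell ((i, j, k), b, _) x \<longleftrightarrow> x $ k \<noteq> 0 \<and> in_open b (x $ i / x $ k) (x $ j / x $ k)"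

lemma less_divide_iff: "(c :: real) \<noteq> 0 \<Longrightarrow> a < b / c \<longleftrightarrow> 0 < (b - a * c) * c"
  and divide_less_iff: "(c :: real) \<noteq> 0 \<Longrightarrow> b / c < a \<longleftrightarrow> 0 < (a * c - b) * c"
  by (cases "c > 0"; force simp: field_simps zero_less_mult_iff)+

lemma open_in_cell: "open {x. in_cell c x}"
proof -
  obtain i j k x h y w r where c: "c = ((i, j, k), (x, h, y, w), r)" by (metis surj_pair)
  \<comment> \<open>Multiplying by the square of the \<open>k\<close>-th coordinate removes the
    divisions; each strict product inequality already forces that coordinate to be nonzero.\<close>
  have "in_cell c z \<longleftrightarrow> 0 < (z $ i - x * z $ k) * z $ k \<and> 0 < ((x + h) * z $ k - z $ i) * z $ k \<and>
      0 < (z $ j - y * z $ k) * z $ k \<and> 0 < ((y + w) * z $ k - z $ j) * z $ k" for z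
    by (cases "z $ k = 0") (auto simp: c in_open_def less_divide_iff divide_less_iff simp del: zero_less_mult_iff)
  then have "{x. in_cell c x} = {z. 0 < (z $ i - x * z $ k) * z $ k} \<inter> {z. 0 < ((x + h) * z $ k - z $ i) * z $ k}
      \<inter> {z. 0 < (z $ j - y * z $ k) * z $ k} \<inter> {z. 0 < ((y + w) * z $ k - z $ j) * z $ k}"
    by blast
  then show ?thesis
    by (auto intro!: open_Int open_Collect_less continuous_intros)
qed

lemma in_cell_scale: "s \<noteq> 0 \<Longrightarrow> in_cell c (s *\<^sub>R x) \<longleftrightarrow> in_cell c x"
  by (cases c) auto

lemma isolated_cells:
  "\<forall>\<^sub>F p in nhds 4. \<forall>((i, j, k), b, (lo, hi), n)\<in>set cells. isolated p i j k b lo hi n"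
  using isolated_1 isolated_3
  by eventually_elim (simp add: cells_def)

lemma in_box_abs:
  assumes "\<bar>u\<bar> \<le> a" "\<bar>v\<bar> \<le> b" "x \<le> - a" "a \<le> x + h" "y \<le> - b" "b \<le> y + k"
  shows "in_box (x, h, y, k) u v"
  using assms by (auto simp: in_box_def)

lemma covered_zero:
  assumes "\<exists>\<kappa>1 > 0. \<exists>\<kappa>2 > 0. covered (\<lambda>u v. \<kappa>1 * F u v) (\<lambda>u v. \<kappa>2 * G u v) False B T"
    and "in_box B u v" "F u v = 0 \<and> G u v = 0"
  shows "\<exists>b\<in>fst ` set (solves B T). in_box b u v"
proof -
  obtain \<kappa>1 \<kappa>2 where "covered (\<lambda>u v. \<kappa>1 * F u v) (\<lambda>u v. \<kappa>2 * G u v) False B T"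
    using assms(1) by blast
  from conjunct1[OF this[unfolded covered_def if_False], rule_format, of u v] assms(2,3)
  show ?thesis by force
qed

lemma eigenpair_4_in_cell:
  assumes ep: "eigenpair 4 signed_triangle x l"
  shows "\<exists>c\<in>set cells. in_cell c x"
proof -
  have x0: "x \<noteq> 0" using ep by (simp add: eigenpair_def)
  have p3: "perm3 1 2 3" "perm3 2 3 1" "perm3 1 3 2" by (simp_all add: perm3_def)
  \<comment> \<open>A property that holds near 4 holds at 4; it improves membership in a closed
    solved rectangle to membership in an open cell.\<close>
  have iso: "\<forall>((i, j, k), b, (lo, hi), n)\<in>set cells. isolated 4 i j k b lo hi n"
    by (rule eventually_nhds_x_imp_x[OF isolated_cells])
  have conclude: "\<exists>c\<in>set cells. in_cell c x"
    if c: "((i, j, k), b, (lo, hi), n) \<in> set cells" and k: "x $ k \<noteq> 0" "in_box b (x $ i / x $ k) (x $ j / x $ k)" for i j k b lo hi n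
  proof -
    have "isolated 4 i j k b lo hi n" using iso c by fast
    then have "in_open b (x $ i / x $ k) (x $ j / x $ k)"
      using ep k unfolding isolated_def by blast
    then show ?thesis using c k by (intro bexI[OF _ c]) simp
  qed
  have zero: "Fc 4 i j k (x $ i / x $ k) (x $ j / x $ k) = 0 \<and> Fc 4 j i k (x $ j / x $ k) (x $ i / x $ k) = 0"
    if "perm3 i j k" "x $ k \<noteq> 0" for i j k
    using eigenpair_chart[OF that refl refl] ep by blast
  \<comment> \<open>The three regions exhaust the space because 32 = 4 * 8: the bounds of the first
    case follow from either one of them together with the comparison of the coordinates 1 and
    2.\<close>
  consider "\<bar>x $ 1\<bar> \<le> 8 * \<bar>x $ 3\<bar>" "\<bar>x $ 2\<bar> \<le> 32 * \<bar>x $ 3\<bar>"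
    | "\<bar>x $ 2\<bar> \<le> 4 * \<bar>x $ 1\<bar>" "8 * \<bar>x $ 3\<bar> < \<bar>x $ 1\<bar>"
    | "4 * \<bar>x $ 1\<bar> < \<bar>x $ 2\<bar>" "32 * \<bar>x $ 3\<bar> < \<bar>x $ 2\<bar>"
    by linarith
  then show ?thesis
  proof cases
    case 1
    then have k: "x $ 3 \<noteq> 0" using x0 by (auto simp: vec_eq_iff forall_3)
    let ?u = "x $ 1 / x $ 3" and ?v = "x $ 2 / x $ 3"
    have "\<bar>?u\<bar> \<le> 8" "\<bar>?v\<bar> \<le> 32" using 1 k by (simp_all add: field_simps)
    then have "in_box (- 8, 16, - 32, 64) ?u ?v" by (rule in_box_abs) simp_all
    from covered_zero[OF covered_3 this zero[OF p3(1) k]] obtain b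
      where "b \<in> fst ` set (solves (- 8, 16, - 32, 64) tree_3)" and b: "in_box b ?u ?v" ..
    moreover have "\<forall>b\<in>fst ` set (solves (- 8, 16, - 32, 64) tree_3). ((1, 2, 3), b) \<in> (\<lambda>(t, b, _). (t, b)) ` set cells"
      by (simp add: solves_3 cells_def)
    ultimately obtain q n where "((1, 2, 3), b, q, n) \<in> set cells" by fastforce
    then show ?thesis using conclude[OF _ k b] by (metis surj_pair)
  next
    case 2
    then have k: "x $ 1 \<noteq> 0" by auto
    let ?u = "x $ 2 / x $ 1" and ?v = "x $ 3 / x $ 1"
    have "\<bar>?u\<bar> \<le> 4" "\<bar>?v\<bar> \<le> 1 / 8" using 2 k by (simp_all add: field_simps)
    then have "in_box (- 4, 8, - (5 / 32), 19 / 64) ?u ?v" by (rule in_box_abs) simp_all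
    from covered_zero[OF covered_1 this zero[OF p3(2) k]] obtain b
      where "b \<in> fst ` set (solves (- 4, 8, - (5 / 32), 19 / 64) tree_1)" and b: "in_box b ?u ?v" ..
    moreover have "\<forall>b\<in>fst ` set (solves (- 4, 8, - (5 / 32), 19 / 64) tree_1). ((2, 3, 1), b) \<in> (\<lambda>(t, b, _). (t, b)) ` set cells"
      by (simp add: solves_1 cells_def)
    ultimately obtain q n where "((2, 3, 1), b, q, n) \<in> set cells" by fastforce
    then show ?thesis using conclude[OF _ k b] by (metis surj_pair)
  next
    case 3
    then have k: "x $ 2 \<noteq> 0" by auto
    let ?u = "x $ 1 / x $ 2" and ?v = "x $ 3 / x $ 2"
    have "\<bar>?u\<bar> \<le> 1 / 4" "\<bar>?v\<bar> \<le> 1 / 32" using 3 k by (simp_all add: field_simps)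
    then have "in_box (- (1 / 4), 1 / 2, - (1 / 32), 1 / 16) ?u ?v" by (rule in_box_abs) simp_all
    from covered_zero[OF covered_2 this zero[OF p3(3) k]] show ?thesis by (simp add: solves_2)
  qed
qed

text \<open>The 2x2 minors of the matrix with columns (left-hand sides) and (mass times
  \<open>Phi\<close>). The second column is nonzero for nonzero \<open>x\<close>, so all minors
  vanish exactly when the first is a multiple of it, that is, for eigenvectors. No chart and no
  spectral value enters.\<close>

definition minors :: "real \<Rightarrow> real ^ 3 \<Rightarrow> real" where
  "minors p x = (let e = (\<lambda>i j k. Ef p i j k (x $ i) (x $ j) (x $ k)); q = (\<lambda>i. ms i * Phi p (x $ i)) in
     (q 2 * e 1 2 3 - q 1 * e 2 1 3)\<^sup>2 + (q 3 * e 1 2 3 - q 1 * e 3 1 2)\<^sup>2 + (q 3 * e 2 1 3 - q 2 * e 3 1 2)\<^sup>2)"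

lemma eigenpair_minors: "eigenpair p signed_triangle x l \<Longrightarrow> minors p x = 0"
  using eigenpair_iff[of 1 2 3 p x l] by (simp add: perm3_def minors_def Let_def)

lemma minors_eigenpair:
  assumes "x \<noteq> 0" "minors p x = 0"
  shows "\<exists>l. eigenpair p signed_triangle x l"
proof -
  define e1 where "e1 = Ef p 1 2 3 (x $ 1) (x $ 2) (x $ 3)"
  define e2 where "e2 = Ef p 2 1 3 (x $ 2) (x $ 1) (x $ 3)"
  define e3 where "e3 = Ef p 3 1 2 (x $ 3) (x $ 1) (x $ 2)"
  define q where "q i = ms i * Phi p (x $ i)" for i
  have "(q 2 * e1 - q 1 * e2)\<^sup>2 + (q 3 * e1 - q 1 * e3)\<^sup>2 + (q 3 * e2 - q 2 * e3)\<^sup>2 = 0"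
    using assms(2) by (simp only: minors_def Let_def e1_def e2_def e3_def q_def)
  then have m: "q 2 * e1 = q 1 * e2" "q 3 * e1 = q 1 * e3" "q 3 * e2 = q 2 * e3"
    by (simp_all add: add_nonneg_eq_0_iff)
  have "x $ 1 \<noteq> 0 \<or> x $ 2 \<noteq> 0 \<or> x $ 3 \<noteq> 0" using assms(1) by (auto simp: vec_eq_iff forall_3)
  then have "q 1 \<noteq> 0 \<or> q 2 \<noteq> 0 \<or> q 3 \<noteq> 0" by (auto simp: q_def)
  then have "\<exists>l. e1 = l * q 1 \<and> e2 = l * q 2 \<and> e3 = l * q 3"
  proof (elim disjE)
    assume "q 1 \<noteq> 0"
    then show ?thesis using m by (intro exI[of _ "e1 / q 1"]) (auto simp: field_simps)
  next
    assume "q 2 \<noteq> 0"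
    then show ?thesis using m by (intro exI[of _ "e2 / q 2"]) (auto simp: field_simps)
  next
    assume "q 3 \<noteq> 0"
    then show ?thesis using m by (intro exI[of _ "e3 / q 3"]) (auto simp: field_simps)
  qed
  then show ?thesis
    using assms(1) eigenpair_iff[of 1 2 3 p x] by (simp add: perm3_def e1_def e2_def e3_def q_def mult.assoc)
qed

text \<open>Removing open cells from the sphere leaves a compact set without eigenvectors at
  exponent 4, hence without eigenvectors at nearby exponents. Rescaling to unit length changes
  neither the eigenproblem nor the cells.\<close>

lemma eigenpairs_in_cells:
  "\<forall>\<^sub>F p in nhds 4. \<forall>x l. eigenpair p signed_triangle x l \<longrightarrow> (\<exists>c\<in>set cells. in_cell c x)"
proof -
  define K where "K = sphere (0 :: real ^ 3) 1 - (\<Union>c\<in>set cells. {x. in_cell c x})"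
  have K: "compact K"
    unfolding K_def by (intro compact_diff open_UN) (auto simp: open_in_cell)
  \<comment> \<open>The conclusion \<open>0 < -1\<close> is plain falsity, put into the shape of
    \<open>eventually_compact_param\<close>.\<close>
  have "\<forall>\<^sub>F p in nhds 4. \<forall>x\<in>K. minors p x = 0 \<longrightarrow> 0 < (-1 :: real)"
  proof (rule eventually_compact_param[where lo = 3 and hi = 5, OF K])
    show "continuous_on ({3..5} \<times> K) (\<lambda>(p, x). minors p x)"
      unfolding minors_def Let_def case_prod_unfold by (intro continuous_intros) auto
    show "0 < (-1 :: real)" if x: "x \<in> K" "minors 4 x = 0" for x
    proof -
      have "x \<noteq> 0" using x(1) by (auto simp: K_def)
      then obtain l where "eigenpair 4 signed_triangle x l" using minors_eigenpair x(2) by blast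
      then show ?thesis using eigenpair_4_in_cell[of x l] x(1) by (auto simp: K_def)
    qed
  qed auto
  then show ?thesis
  proof eventually_elim
    case (elim p)
    show ?case
    proof (intro allI impI)
      fix x l assume ep: "eigenpair p signed_triangle x l"
      then have x0: "x \<noteq> 0" by (simp add: eigenpair_def)
      define y where "y = (1 / norm x) *\<^sub>R x"
      have "eigenpair p signed_triangle y l"
        unfolding y_def using x0 ep by (intro eigenpair_scale) auto
      then have "minors p y = 0" by (rule eigenpair_minors)
      moreover have "y \<in> sphere 0 1" using x0 by (simp add: y_def)
      ultimately have "\<exists>c\<in>set cells. in_cell c y" using elim by (auto simp: K_def)
      then show "\<exists>c\<in>set cells. in_cell c x" using x0 by (simp add: y_def in_cell_scale)
    qed
  qed
qed

section \<open>Effect of a spectral shift\<close>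

lemma eigenpair_shift:
  "eigenpair p (spectral_shift t d) x l \<longleftrightarrow> eigenpair p d x (l - t)"
  unfolding eigenpair_def spectral_shift_def by (simp add: algebra_simps)

lemma p_spectrum_shift: "p_spectrum p (spectral_shift t d) = (\<lambda>l. l + t) ` p_spectrum p d"
  unfolding p_spectrum_def eigenpair_shift by (auto simp: image_iff) (metis diff_add_cancel)

lemma eigenlines_shift: "eigenlines p (spectral_shift t d) = eigenlines p d"
  unfolding eigenlines_def eigenpair_shift by (auto, metis add_diff_cancel)

lemma has_derivative_shift_within:
  fixes g g' :: "'a::real_normed_vector \<Rightarrow> real"
  assumes "\<And>y. y \<in> H \<Longrightarrow> g' y = g y + t" "y \<in> H" "(g has_derivative D) (at y within H)"
  shows "(g' has_derivative D) (at y within H)"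
  using has_derivative_transform[OF assms(2,1) has_derivative_add_const[OF assms(3)]] .

lemma nondegenerate_critical_on_shift:
  fixes g g' :: "'a::euclidean_space \<Rightarrow> real"
  assumes g: "\<And>y. y \<in> H \<Longrightarrow> g' y = g y + t" and u: "u \<in> H" and nd: "nondegenerate_critical_on g H u k"
  shows "nondegenerate_critical_on g' H u k"
proof -
  obtain Q where Q: "has_hessian_on g H u Q" "nondegenerate_on H Q" "negative_index_on H Q = k"
    and d: "(g has_derivative (\<lambda>_. 0)) (at u within H)"
    using nd by (auto simp: nondegenerate_critical_on_def)
  obtain D e where D: "e > 0" "\<forall>y\<in>H \<inter> ball u e. (g has_derivative D y) (at y within H)"
    "\<forall>v\<in>H. ((\<lambda>y. D y v) has_derivative Q v) (at u within H)"
    using Q(1) unfolding has_hessian_on_def by blast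
  have "(g' has_derivative D y) (at y within H)" if "y \<in> H \<inter> ball u e" for y
    by (rule has_derivative_shift_within[where g = g and t = t]) (use g D that in auto)
  then have "has_hessian_on g' H u Q"
    unfolding has_hessian_on_def using D by blast
  moreover have "(g' has_derivative (\<lambda>_. 0)) (at u within H)"
    by (rule has_derivative_shift_within[where g = g and t = t]) (use g u d in auto)
  ultimately show ?thesis
    using Q by (auto simp: nondegenerate_critical_on_def)
qed

lemma has_morse_index_shift:
  assumes "\<And>x. x \<noteq> 0 \<Longrightarrow> F' (span {x}) = F (span {x}) + (t :: real)" "has_morse_index F L k"
  shows "has_morse_index F' L k"
proof -
  obtain i u where u: "u \<in> chart_space i" "L = affine_chart i u"
    and nd: "nondegenerate_critical_on (F \<circ> affine_chart i) (chart_space i) u k"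
    using assms(2) by (auto simp: has_morse_index_def)
  have "(F' \<circ> affine_chart i) y = (F \<circ> affine_chart i) y + t" if "y \<in> chart_space i" for y
  proof -
    have "(y + axis i 1) $ i \<noteq> 0" using that by (simp add: chart_space_def axis_def)
    then have "y + axis i 1 \<noteq> 0" by (metis zero_index)
    then show ?thesis using assms(1) by (simp add: affine_chart_def)
  qed
  from nondegenerate_critical_on_shift[OF this u(1) nd] show ?thesis
    using u unfolding has_morse_index_def by blast
qed

lemma proj_rayleigh_shift:
  assumes "x \<noteq> 0"
  shows "proj_rayleigh p (spectral_shift t signed_triangle) (span {x}) = proj_rayleigh p signed_triangle (span {x}) + t"
proof -
  have e: "(\<Sum>i\<in>UNIV. mass signed_triangle $ i * \<bar>x $ i\<bar> powr p) = rden p x"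
    by (simp add: sum_3 rden_def ms_def)
  have "(\<Sum>i\<in>UNIV. (potential signed_triangle $ i + t * mass signed_triangle $ i) * \<bar>x $ i\<bar> powr p) =
      (\<Sum>i\<in>UNIV. potential signed_triangle $ i * \<bar>x $ i\<bar> powr p) + t * rden p x"
    unfolding e [symmetric] by (simp add: algebra_simps sum.distrib sum_distrib_left)
  then have "rayleigh p (spectral_shift t signed_triangle) x = rayleigh p signed_triangle x + t"
    using rden_pos[OF assms, of p] unfolding rayleigh_def
    by (simp add: spectral_shift_def e add_divide_distrib)
  then show ?thesis using assms by (simp add: proj_rayleigh_span)
qed

section \<open>Counting eigenlines and spectral values\<close>

lemma cells_intervals: "sorted_wrt (\<lambda>(_, _, (_, hi), _) (_, _, (lo, _), _). hi \<le> lo) cells"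
  by (simp add: cells_def)

lemma spectrum_near_4:
  assumes p: "p > 2" and iso: "\<forall>((i, j, k), b, (lo, hi), n)\<in>set cells. isolated p i j k b lo hi n"
    and all: "\<And>x l. eigenpair p signed_triangle x l \<Longrightarrow> \<exists>c\<in>set cells. in_cell c x"
  shows "card (eigenlines p signed_triangle) = 9" "card (p_spectrum p signed_triangle) = 9"
    and "card {L \<in> eigenlines p signed_triangle. has_morse_index (proj_rayleigh p signed_triangle) L m} =
      length (filter (\<lambda>(_, _, _, n). n = m) cells)"
proof -
  have "\<forall>c\<in>set cells. \<exists>xl. case (c, xl) of ((_, _, (lo, hi), n), (x, l)) \<Rightarrow>
      eigenpair p signed_triangle x l \<and> lo < l \<and> l < hi \<and> index_type p l x n \<and>
      (\<forall>x' l'. eigenpair p signed_triangle x' l' \<longrightarrow> in_cell c x' \<longrightarrow> x' \<in> span {x})"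
  proof
    fix c assume c: "c \<in> set cells"
    obtain i j k b lo hi n where ce: "c = ((i, j, k), b, (lo, hi), n)" by (metis surj_pair)
    have "isolated p i j k b lo hi n" using iso c ce by fast
    then obtain x l where "eigenpair p signed_triangle x l \<and> lo < l \<and> l < hi \<and> index_type p l x n \<and>
      (\<forall>x' l'. eigenpair p signed_triangle x' l' \<longrightarrow> x' $ k \<noteq> 0 \<longrightarrow> in_box b (x' $ i / x' $ k) (x' $ j / x' $ k) \<longrightarrow> x' \<in> span {x})"
      unfolding isolated_def by blast
    moreover have "in_box b u v" if "in_open b u v" for u v
      using that by (auto simp: in_box_def in_open_def split: prod.splits)
    ultimately show "\<exists>xl. case (c, xl) of ((_, _, (lo, hi), n), (x, l)) \<Rightarrow>
      eigenpair p signed_triangle x l \<and> lo < l \<and> l < hi \<and> index_type p l x n \<and>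
      (\<forall>x' l'. eigenpair p signed_triangle x' l' \<longrightarrow> in_cell c x' \<longrightarrow> x' \<in> span {x})"
      unfolding ce by (intro exI[of _ "(x, l)"]) auto
  qed
  from bchoice[OF this] obtain XL where XL: "\<forall>c\<in>set cells. case (c, XL c) of ((_, _, (lo, hi), n), (x, l)) \<Rightarrow>
      eigenpair p signed_triangle x l \<and> lo < l \<and> l < hi \<and> index_type p l x n \<and>
      (\<forall>x' l'. eigenpair p signed_triangle x' l' \<longrightarrow> in_cell c x' \<longrightarrow> x' \<in> span {x})" ..
  define X where "X c = fst (XL c)" for c
  define \<Lambda> where "\<Lambda> c = snd (XL c)" for c
  have ep: "eigenpair p signed_triangle (X c) (\<Lambda> c)"
    and it: "index_type p (\<Lambda> c) (X c) (snd (snd (snd c)))"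
    and lohi: "fst (fst (snd (snd c))) < \<Lambda> c" "\<Lambda> c < snd (fst (snd (snd c)))"
    and un: "\<And>x' l'. eigenpair p signed_triangle x' l' \<Longrightarrow> in_cell c x' \<Longrightarrow> x' \<in> span {X c}" if "c \<in> set cells" for c
    using bspec[OF XL that] by (auto simp: X_def \<Lambda>_def split: prod.splits)
  \<comment> \<open>Each spectral value lies strictly inside its interval and the intervals are
    ordered, so the values increase strictly along the list. Distinctness of cells, values and lines
    all follows from this.\<close>
  have "sorted_wrt (\<lambda>c d. \<Lambda> c < \<Lambda> d) cells"
    by (rule sorted_wrt_mono_rel[OF _ cells_intervals]) (use lohi in fastforce)
  then have "sorted_wrt (<) (map \<Lambda> cells)" by (simp add: sorted_wrt_map)
  then have "distinct (map \<Lambda> cells)" by (simp add: strict_sorted_iff)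
  then have dist: "distinct cells" and inj\<Lambda>: "inj_on \<Lambda> (set cells)" by (auto simp: distinct_map)
  have len: "card (set cells) = 9" using distinct_card[OF dist] by (simp add: cells_def)
  \<comment> \<open>The spectral value is the Rayleigh quotient of the eigenvector, which is
    constant along the line.\<close>
  have same: "l = l'" if xx': "eigenpair p signed_triangle x l" "eigenpair p signed_triangle x' l'" "x' \<in> span {x}" for x x' l l'
  proof -
    obtain s where s: "x' = s *\<^sub>R x" using xx'(3) by (auto simp: span_singleton)
    then have "s \<noteq> 0" using xx'(2) by (auto simp: eigenpair_def)
    then show ?thesis
      using eigenpair_rayleigh[OF p xx'(1)] eigenpair_rayleigh[OF p xx'(2)] by (simp add: s rayleigh_scaleR)
  qed
  have spaneq: "span {x'} = span {x}" if xx': "x' \<in> span {x}" "x' \<noteq> 0" for x x' :: "real ^ 3"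
  proof -
    obtain s where s: "x' = s *\<^sub>R x" using xx'(1) by (auto simp: span_singleton)
    then have "s \<noteq> 0" using xx'(2) by auto
    then show ?thesis by (simp add: s span_singleton_scale)
  qed
  have sol: "\<exists>c\<in>set cells. span {x} = span {X c} \<and> l = \<Lambda> c" if x: "eigenpair p signed_triangle x l" for x l
  proof -
    obtain c where c: "c \<in> set cells" "in_cell c x" using all[OF x] by blast
    have "x \<in> span {X c}" by (rule un[OF c(1) x c(2)])
    then show ?thesis using c(1) same[OF ep[OF c(1)] x] spaneq[of x "X c"] x by (auto simp: eigenpair_def)
  qed
  have lines: "eigenlines p signed_triangle = (\<lambda>c. span {X c}) ` set cells"
    unfolding eigenlines_def using sol ep by blast
  have spec: "p_spectrum p signed_triangle = \<Lambda> ` set cells"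
    unfolding p_spectrum_def using sol ep by blast
  \<comment> \<open>Cells from different charts need no geometric comparison: equal lines would have
    equal spectral values.\<close>
  have injX: "inj_on (\<lambda>c. span {X c}) (set cells)"
  proof (rule inj_onI)
    fix c d assume cd: "c \<in> set cells" "d \<in> set cells" "span {X c} = span {X d}"
    then have "X c \<in> span {X d}" by (metis span_base insertI1)
    then have "\<Lambda> d = \<Lambda> c" using same[OF ep[OF cd(2)] ep[OF cd(1)]] by simp
    then show "c = d" using inj\<Lambda> cd by (auto simp: inj_on_def)
  qed
  show "card (eigenlines p signed_triangle) = 9" unfolding lines using card_image[OF injX] len by simp
  show "card (p_spectrum p signed_triangle) = 9" unfolding spec using card_image[OF inj\<Lambda>] len by simp
  have "{L \<in> eigenlines p signed_triangle. has_morse_index (proj_rayleigh p signed_triangle) L m} =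
      (\<lambda>c. span {X c}) ` set (filter (\<lambda>(_, _, _, n). n = m) cells)"
    unfolding lines using has_morse_index_eigenline[OF p ep it] by (auto simp: case_prod_unfold)
  moreover have "card ((\<lambda>c. span {X c}) ` set (filter (\<lambda>(_, _, _, n). n = m) cells)) = card (set (filter (\<lambda>(_, _, _, n). n = m) cells))"
    by (rule card_image) (use injX in \<open>auto simp: inj_on_def\<close>)
  moreover have "\<dots> = length (filter (\<lambda>(_, _, _, n). n = m) cells)"
    by (rule distinct_card) (use dist in simp)
  ultimately show "card {L \<in> eigenlines p signed_triangle. has_morse_index (proj_rayleigh p signed_triangle) L m} =
      length (filter (\<lambda>(_, _, _, n). n = m) cells)" by simp
qed

theorem corollaryE3:
  shows "\<exists>lo hi :: real. 2 < lo \<and> lo < 4 \<and> 4 < hi \<and>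
    (\<forall>p\<in>{lo<..<hi}.
       card (eigenlines p signed_triangle) = 9 \<and>
       card (p_spectrum p signed_triangle) = 9 \<and>
       card {L \<in> eigenlines p signed_triangle.
          has_morse_index (proj_rayleigh p signed_triangle) L 0} = 4 \<and>
       card {L \<in> eigenlines p signed_triangle.
          has_morse_index (proj_rayleigh p signed_triangle) L 1} = 4 \<and>
       card {L \<in> eigenlines p signed_triangle.
          has_morse_index (proj_rayleigh p signed_triangle) L 2} = 1 \<and>
       potential (spectral_shift 17481 signed_triangle) = vector [212986831, 279, 365648115381499957] \<and>
       eigenlines p (spectral_shift 17481 signed_triangle) = eigenlines p signed_triangle \<and>
       (\<forall>L\<in>eigenlines p signed_triangle. \<forall>k.
          has_morse_index (proj_rayleigh p (spectral_shift 17481 signed_triangle)) L k \<longleftrightarrow>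
          has_morse_index (proj_rayleigh p signed_triangle) L k) \<and>
       card (p_spectrum p (spectral_shift 17481 signed_triangle)) = 9 \<and>
       max_spectral_count TYPE(3) p \<ge> 9)"
    (is "\<exists>lo hi. _ \<and> _ \<and> _ \<and> (\<forall>p\<in>_. ?P p)")
proof -
  have "\<forall>\<^sub>F p in nhds 4. p > 2 \<and> (\<forall>((i, j, k), b, (lo, hi), n)\<in>set cells. isolated p i j k b lo hi n) \<and>
      (\<forall>x l. eigenpair p signed_triangle x l \<longrightarrow> (\<exists>c\<in>set cells. in_cell c x))"
    using eventually_nhds_in_open[of "{2<..}" "4 :: real"]
    by (intro eventually_conj isolated_cells eigenpairs_in_cells) auto
  then obtain e where e: "e > 0" "\<And>p. dist p 4 < e \<Longrightarrow> p > 2 \<and>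
      (\<forall>((i, j, k), b, (lo, hi), n)\<in>set cells. isolated p i j k b lo hi n) \<and>
      (\<forall>x l. eigenpair p signed_triangle x l \<longrightarrow> (\<exists>c\<in>set cells. in_cell c x))"
    unfolding eventually_nhds_metric by blast
  \<comment> \<open>Capping the radius at 1 keeps the interval inside [3, 5], away from exponent
    2.\<close>
  have "?P p" if "p \<in> {4 - min e 1<..<4 + min e 1}" for p
  proof -
    have "dist p 4 < e" using that by (auto simp: dist_real_def)
    note near = e(2)[OF this]
    have p: "p > 2" using near by blast
    note near4 = spectrum_near_4[OF p conjunct1[OF conjunct2[OF near]] conjunct2[OF conjunct2[OF near], rule_format]]
    have spec: "card (p_spectrum p (spectral_shift 17481 signed_triangle)) = 9"
      unfolding p_spectrum_shift by (subst card_image) (use near4(2) in \<open>auto simp: inj_on_def\<close>)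
    \<comment> \<open>17481 is the least integer shift with nonnegative potential, and vertex 2
      decides: 482 * 17480 is below 8425563, while 482 * 17481 exceeds it by 279.\<close>
    have "potential (spectral_shift 17481 signed_triangle) = vector [212986831, 279, 365648115381499957]"
      by (simp add: spectral_shift_def signed_triangle_def vec_eq_iff forall_3 vector_3)
    \<comment> \<open>Shifting by 17481 and back by its negative gives the two implications.\<close>
    moreover have "has_morse_index (proj_rayleigh p (spectral_shift 17481 signed_triangle)) L k \<longleftrightarrow>
        has_morse_index (proj_rayleigh p signed_triangle) L k" for L k
      using has_morse_index_shift[of "proj_rayleigh p (spectral_shift 17481 signed_triangle)" "proj_rayleigh p signed_triangle" 17481]
        has_morse_index_shift[of "proj_rayleigh p signed_triangle" "proj_rayleigh p (spectral_shift 17481 signed_triangle)" "- 17481"]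
      by (auto simp: proj_rayleigh_shift)
    moreover have "9 \<le> max_spectral_count TYPE(3) p"
      unfolding max_spectral_count_def
    proof (rule SUP_upper2[of signed_triangle])
      have "finite (p_spectrum p signed_triangle)" using near4(2) by (intro card_ge_0_finite) simp
      then show "9 \<le> (if finite (p_spectrum p signed_triangle) then enat (card (p_spectrum p signed_triangle)) else \<infinity>)"
        using near4(2) by (simp add: numeral_eq_enat)
    qed (simp add: valid_data_signed_triangle)
    ultimately show ?thesis
      using near4 spec by (simp add: eigenlines_shift cells_def)
  qed
  then show ?thesis
    using e(1) by (intro exI[of _ "4 - min e 1"] exI[of _ "4 + min e 1"]) auto
qed

end
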